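(* Let $k$ be a ring, $S=k[x_1,\ldots,x_n]$, $\prec$ a monomial order on $S$, $\Delta\subset\mathbb{N}^n$ a standard set of finite size $d\ge1$, and $N\subset\mathbb{N}^n$ a standard set containing $\Delta$. (i) Let $R^\Delta$ be the coordinate ring of ${\rm Hilb}^{\Delta}_{S/k}$ as presented in (P1) or (P2) of the context (where $N=\Delta$ in the case of (P2)). Then the universal object of the representable functor $\mathcal{H}{\rm ilb}^{\Delta}_{S/k}$ is the affine scheme $$U^\Delta={\rm Spec}\,R^\Delta[x]/\Bigl(x^\alpha-\sum_{\beta\in\Delta}T_{\alpha,\beta}x^\beta;\ \alpha\in N\cup N^{(1)}\Bigr)$$ over ${\rm Hilb}^{\Delta}_{S/k}={\rm Spec}\,R^\Delta$. (ii) Let $R^{\prec\Delta}$ be the coordinate ring of ${\rm Hilb}^{\prec\Delta}_{S/k}$ as presented in (P3) or (P4) of the context. Then the universal object of the representable functor $\mathcal{H}{\rm ilb}^{\prec\Delta}_{S/k}$ is the affine scheme $$U^{\prec\Delta}={\rm Spec}\,R^{\prec\Delta}[x]/\Bigl(x^\alpha-\sum_{\beta\in\Delta,\,\beta\prec\alpha}T_{\alpha,\beta}x^\beta;\ \alpha\in\mathscr{C}(\Delta)\Bigr)$$ over ${\rm Hilb}^{\prec\Delta}_{S/k}={\rm Spec}\,R^{\prec\Delta}$.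
   Context: All rings are commutative with $1$; $x^\alpha=x_1^{\alpha_1}\cdots x_n^{\alpha_n}$ for $\alpha\in\mathbb{N}^n$, $B[x]=B[x_1,\ldots,x_n]$; $\prec$ also denotes the induced order on exponents; $e_i$ is the $i$-th standard basis vector and $\delta$ the Kronecker delta. A standard set is a subset $N\subset\mathbb{N}^n$ whose complement is closed with respect to addition with elements of $\mathbb{N}^n$. Its border is $\mathscr{B}(N)=\bigcup_{i=1}^n(N+e_i)-N$; put $N^{(1)}=\mathscr{B}(N)$ and $N^{(2)}=\mathscr{B}(N\cup N^{(1)})$. The set of corners $\mathscr{C}(N)$ consists of those $\alpha\in\mathbb{N}^n-N$ with $\alpha-e_i\notin\mathbb{N}^n-N$ for all $i$. An edge triple of $\Delta$ is a triple $(\epsilon,\lambda,\lambda')$ with $\epsilon\in\Delta$, $\lambda,\lambda'\in\{e_1,\ldots,e_n\}$, $\epsilon+\lambda,\epsilon+\lambda'\in\mathscr{B}(\Delta)$ and $\epsilon+\lambda+\lambda'\in\mathscr{C}(\Delta\cup\mathscr{B}(\Delta))$. Gröbner bases: for an ideal $I\subset B[x]$, a Gröbner basis of $I$ is a finite subset $G\subset I$ such that the leading terms (with coefficients) of the elements of $G$ generate the same ideal as the leading terms of all nonzero elements of $I$. The standard set attached to $I$ is the complement in $\mathbb{N}^n$ of the set of leading exponents of nonzero elements of $I$. A Gröbner basis $G$ is reduced if the set of leading exponents of its elements is the set of corners of the standard set attached to $I$, each $g\in G$ is monic, and all non-leading exponents of each $g$ lie in that standard set. Functors on $k$-algebras: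 $\mathcal{H}{\rm ilb}^{\Delta}_{S/k}(B)$ is the set of surjective $B$-algebra homomorphisms $\phi:B[x]\to Q$ such that $(\phi(x^\beta))_{\beta\in\Delta}$ is a $B$-basis of $Q$, modulo $\phi\sim\phi'$ iff $\ker\phi=\ker\phi'$, with functoriality by base change. $\mathcal{H}{\rm ilb}^{\prec\Delta}_{S/k}$ is its subfunctor of those $\phi$ for which $\ker\phi$ has a reduced Gröbner basis of the form $f_\alpha=x^\alpha+\sum_{\beta\in\Delta,\beta\prec\alpha}d_{\alpha,\beta}x^\beta$, $\alpha\in\mathscr{C}(\Delta)$. The representing schemes are denoted ${\rm Hilb}^{\Delta}_{S/k}$ and ${\rm Hilb}^{\prec\Delta}_{S/k}$. The universal object is the element of the functor's value on the coordinate ring corresponding to the identity, viewed as the spectrum of the quotient algebra $Q$. In the presentations below, a homomorphism $T_{\alpha,\beta}\mapsto a_{\alpha,\beta}$ from the coordinate ring to $B$ corresponds to the class of $\phi$ with $\phi(x^\alpha)=\sum_{\beta\in\Delta}a_{\alpha,\beta}\phi(x^\beta)$. (P1) $R=k[T_{\alpha,\beta};\alpha\in N\cup N^{(1)},\beta\in\Delta]$ and $R^\Delta=R/I^\Delta$ with $I^\Delta=I^\Delta_1+I^\Delta_2+I^\Delta_3$, where: $I^\Delta_1$ is generated by all $T_{\alpha,\beta}-\delta_{\alpha,\beta}$ with $\alpha\in N$, $\beta\in\Delta$; $I^\Delta_2$ by all $T_{\alpha+\lambda,\beta}-\sum_{\gamma\in\Delta}T_{\alpha,\gamma}T_{\gamma+\lambda,\beta}$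 with $\alpha\in N\cup N^{(1)}$, $\lambda\in\{e_1,\ldots,e_n\}$, $\alpha+\lambda\in N\cup N^{(1)}$, $\beta\in\Delta$; $I^\Delta_3$ by all $\sum_{\gamma\in\Delta}T_{\alpha,\gamma}T_{\gamma+\lambda,\beta}-\sum_{\gamma\in\Delta}T_{\alpha',\gamma}T_{\gamma+\lambda',\beta}$ with $\alpha,\alpha'\in N^{(1)}$, $\lambda,\lambda'\in\{e_1,\ldots,e_n\}$, $\alpha+\lambda=\alpha'+\lambda'\in N^{(2)}$, $\beta\in\Delta$. (P2) As (P1) with $N=\Delta$, but with $I^\Delta_2$ replaced by the ideal generated by all $T_{\alpha+\lambda,\beta}-\sum_{\gamma\in\Delta}T_{\alpha,\gamma}T_{\gamma+\lambda,\beta}$ with $\alpha\in\Delta^{(1)}$, $\lambda\in\{e_1,\ldots,e_n\}$, $\alpha+\lambda\in\Delta^{(1)}$, $\beta\in\Delta$, and $I^\Delta_3$ replaced by the ideal generated by all $\sum_{\gamma\in\Delta}T_{\epsilon+\lambda',\gamma}T_{\gamma+\lambda,\beta}-\sum_{\gamma\in\Delta}T_{\epsilon+\lambda,\gamma}T_{\gamma+\lambda',\beta}$ with $(\epsilon,\lambda,\lambda')$ an edge triple of $\Delta$ and $\beta\in\Delta$. (P3) With $N$, $R$, $I^\Delta$ as in (P1), $R^{\prec\Delta}=R/I^{\prec\Delta}$ with $I^{\prec\Delta}=I^\Delta+(T_{\alpha,\beta};\alpha\in N\cup N^{(1)},\beta\in\Delta,\alpha\prec\beta)$. (P4) $R^{\prec\Delta}$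 is presented as $R_m/I^{\prec\Delta}_m$, where $R_m=k[T_{\alpha,\beta};\alpha\in\mathscr{C}(\Delta),\beta\in\Delta,\alpha\succ\beta]$. For $\alpha\in\mathscr{B}(\Delta)-\mathscr{C}(\Delta)$ and $\beta\in\Delta$ with $\alpha\succ\beta$, elements $T_{\alpha,\beta}\in R_m$ are defined recursively, going through the $\alpha\in\mathscr{B}(\Delta)-\mathscr{C}(\Delta)$ in increasing order: find some $\nu\in\{e_1,\ldots,e_n\}$ with $\alpha-\nu\in\mathscr{B}(\Delta)$ and set $T_{\alpha,\beta}=\sum_{\gamma\in\Delta,\,\alpha\succ\gamma+\nu\succ\beta}T_{\alpha-\nu,\gamma}T_{\gamma+\nu,\beta}$, where $T_{\gamma+\nu,\beta}=\delta_{\gamma+\nu,\beta}$ if $\gamma+\nu\in\Delta$. The ideal $I^{\prec\Delta}_m\subset R_m$ is defined by the same formulas as $I^\Delta$ in (P1) with $N=\Delta$, with the following modification: in all summands of all generators, every $T_{\alpha,\beta}$ with $\alpha\in\Delta$ is replaced by $\delta_{\alpha,\beta}$, and all $T_{\alpha,\beta}$ with $\alpha\prec\beta$ are deleted (set to $0$).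
   Formalization: In (P1)/(P3) the relations T_{α,β}=δ_{α,β} are imposed only for α∈Δ, not all α∈N; in (P4) the recursive sum also includes γ+ν=β; for (P2), that R^Δ is the coordinate ring of Hilb^Δ is a hypothesis, as it can fail (n=3, Δ={1,x,y,z,y²,z²}). *)

theory Defs
  imports "HOL-Algebra.Algebra" "HOL-Library.Poly_Mapping"
begin

section \<open>Polynomial rings in an arbitrary set of variables\<close>

definition monomials :: "'v set \<Rightarrow> ('v \<Rightarrow>\<^sub>0 nat) set" where
  "monomials V = {m. Poly_Mapping.keys m \<subseteq> V}"

text \<open>The ring \<open>R[V]\<close>; a polynomial is its family of coefficients.\<close>

definition mpoly_ring :: "('a, 'm) ring_scheme \<Rightarrow> 'v set \<Rightarrow> (('v \<Rightarrow>\<^sub>0 nat) \<Rightarrow> 'a) ring" where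
  "mpoly_ring R V =
    \<lparr>partial_object.carrier = {p. (\<forall>m. p m \<in> carrier R) \<and> (\<forall>m. m \<notin> monomials V \<longrightarrow> p m = \<zero>\<^bsub>R\<^esub>) \<and>
                   finite {m. p m \<noteq> \<zero>\<^bsub>R\<^esub>}},
     monoid.mult = (\<lambda>p q m. \<Oplus>\<^bsub>R\<^esub>ab\<in>{ab. fst ab + snd ab = m}. p (fst ab) \<otimes>\<^bsub>R\<^esub> q (snd ab)),
     monoid.one = (\<lambda>m. if m = 0 then \<one>\<^bsub>R\<^esub> else \<zero>\<^bsub>R\<^esub>),
     ring.zero = (\<lambda>m. \<zero>\<^bsub>R\<^esub>),
     ring.add = (\<lambda>p q m. p m \<oplus>\<^bsub>R\<^esub> q m)\<rparr>"

definition mterm :: "('a, 'm) ring_scheme \<Rightarrow> 'a \<Rightarrow> ('v \<Rightarrow>\<^sub>0 nat) \<Rightarrow> ('v \<Rightarrow>\<^sub>0 nat) \<Rightarrow> 'a" where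
  "mterm R c m = (\<lambda>m'. if m' = m then c else \<zero>\<^bsub>R\<^esub>)"

definition mconst :: "('a, 'm) ring_scheme \<Rightarrow> 'a \<Rightarrow> ('v \<Rightarrow>\<^sub>0 nat) \<Rightarrow> 'a" where
  "mconst R c = mterm R c 0"

definition mpower :: "('a, 'm) ring_scheme \<Rightarrow> ('v \<Rightarrow>\<^sub>0 nat) \<Rightarrow> ('v \<Rightarrow>\<^sub>0 nat) \<Rightarrow> 'a" where
  "mpower R m = mterm R \<one>\<^bsub>R\<^esub> m"

definition mvar :: "('a, 'm) ring_scheme \<Rightarrow> 'v \<Rightarrow> ('v \<Rightarrow>\<^sub>0 nat) \<Rightarrow> 'a" where
  "mvar R v = mpower R (Poly_Mapping.single v 1)"


section \<open>Exponents, standard sets, monomial orders\<close>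

text \<open>\<open>\<nat>\<^sup>n\<close> is \<^term>\<open>expos n\<close>, and \<open>B[x]\<close> is \<^term>\<open>xring n B\<close>; the variables are indexed by \<open>{..<n}\<close>.\<close>

type_synonym expo = "nat \<Rightarrow>\<^sub>0 nat"

abbreviation expos :: "nat \<Rightarrow> expo set" where
  "expos n \<equiv> monomials {..<n}"

abbreviation xring :: "nat \<Rightarrow> ('a, 'm) ring_scheme \<Rightarrow> (expo \<Rightarrow> 'a) ring" where
  "xring n B \<equiv> mpoly_ring B {..<n}"

definition unit_expo :: "nat \<Rightarrow> expo" where
  "unit_expo i = Poly_Mapping.single i 1"

definition standard_set :: "nat \<Rightarrow> expo set \<Rightarrow> bool" where
  "standard_set n N \<longleftrightarrow>
    N \<subseteq> expos n \<and> (\<forall>\<alpha>\<in>expos n - N. \<forall>\<gamma>\<in>expos n. \<alpha> + \<gamma> \<in> expos n - N)"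

definition border :: "nat \<Rightarrow> expo set \<Rightarrow> expo set" where
  "border n N = (\<Union>i<n. (\<lambda>\<alpha>. \<alpha> + unit_expo i) ` N) - N"

text \<open>The condition \<open>\<alpha> - e\<^sub>i \<notin> \<nat>\<^sup>n - N\<close> refers to subtraction in \<open>\<int>\<^sup>n\<close>.\<close>

definition corners :: "nat \<Rightarrow> expo set \<Rightarrow> expo set" where
  "corners n N =
    {\<alpha> \<in> expos n - N. \<forall>i<n. \<not> (\<exists>\<gamma>\<in>expos n - N. \<gamma> + unit_expo i = \<alpha>)}"

definition edge_triple :: "nat \<Rightarrow> expo set \<Rightarrow> expo \<Rightarrow> nat \<Rightarrow> nat \<Rightarrow> bool" where
  "edge_triple n \<Delta> \<epsilon> i j \<longleftrightarrow>
    \<epsilon> \<in> \<Delta> \<and> i < n \<and> j < n \<and>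
    \<epsilon> + unit_expo i \<in> border n \<Delta> \<and> \<epsilon> + unit_expo j \<in> border n \<Delta> \<and>
    \<epsilon> + unit_expo i + unit_expo j \<in> corners n (\<Delta> \<union> border n \<Delta>)"

definition monomial_order :: "nat \<Rightarrow> (expo \<Rightarrow> expo \<Rightarrow> bool) \<Rightarrow> bool" where
  "monomial_order n lt \<longleftrightarrow>
    irreflp_on (expos n) lt \<and> transp_on (expos n) lt \<and> totalp_on (expos n) lt \<and>
    wfp_on (expos n) lt \<and>
    (\<forall>\<alpha>\<in>expos n. \<forall>\<beta>\<in>expos n. \<forall>\<gamma>\<in>expos n. lt \<alpha> \<beta> \<longrightarrow> lt (\<alpha> + \<gamma>) (\<beta> + \<gamma>))"


section \<open>Groebner bases over rings\<close>

text \<open>The leading coefficient and leading term of \<open>0\<close> are \<open>0\<close>. Hence \<open>0\<close> is monic precisely over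
  the zero ring, and there \<open>{0}\<close> is a reduced Groebner basis of the zero ideal.\<close>

definition lead_expo :: "(expo \<Rightarrow> expo \<Rightarrow> bool) \<Rightarrow> ('b, 'm) ring_scheme \<Rightarrow> (expo \<Rightarrow> 'b) \<Rightarrow> expo" where
  "lead_expo lt B p = (THE \<alpha>. p \<alpha> \<noteq> \<zero>\<^bsub>B\<^esub> \<and> (\<forall>\<beta>. p \<beta> \<noteq> \<zero>\<^bsub>B\<^esub> \<and> \<beta> \<noteq> \<alpha> \<longrightarrow> lt \<beta> \<alpha>))"

definition lead_cf :: "(expo \<Rightarrow> expo \<Rightarrow> bool) \<Rightarrow> ('b, 'm) ring_scheme \<Rightarrow> (expo \<Rightarrow> 'b) \<Rightarrow> 'b" where
  "lead_cf lt B p = (if p = (\<lambda>_. \<zero>\<^bsub>B\<^esub>) then \<zero>\<^bsub>B\<^esub> else p (lead_expo lt B p))"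

definition lead_term :: "(expo \<Rightarrow> expo \<Rightarrow> bool) \<Rightarrow> ('b, 'm) ring_scheme \<Rightarrow> (expo \<Rightarrow> 'b) \<Rightarrow> expo \<Rightarrow> 'b" where
  "lead_term lt B p = mterm B (lead_cf lt B p) (lead_expo lt B p)"

definition lead_expos ::
    "(expo \<Rightarrow> expo \<Rightarrow> bool) \<Rightarrow> ('b, 'm) ring_scheme \<Rightarrow> (expo \<Rightarrow> 'b) set \<Rightarrow> expo set" where
  "lead_expos lt B G = lead_expo lt B ` (G - {\<lambda>_. \<zero>\<^bsub>B\<^esub>})"

definition attached_std_set ::
    "nat \<Rightarrow> (expo \<Rightarrow> expo \<Rightarrow> bool) \<Rightarrow> ('b, 'm) ring_scheme \<Rightarrow> (expo \<Rightarrow> 'b) set \<Rightarrow> expo set" where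
  "attached_std_set n lt B I = expos n - lead_expos lt B I"

definition groebner_basis ::
    "nat \<Rightarrow> (expo \<Rightarrow> expo \<Rightarrow> bool) \<Rightarrow> ('b, 'm) ring_scheme \<Rightarrow>
     (expo \<Rightarrow> 'b) set \<Rightarrow> (expo \<Rightarrow> 'b) set \<Rightarrow> bool" where
  "groebner_basis n lt B I G \<longleftrightarrow>
    finite G \<and> G \<subseteq> I \<and>
    Idl\<^bsub>xring n B\<^esub> (lead_term lt B ` G) = Idl\<^bsub>xring n B\<^esub> (lead_term lt B ` (I - {\<lambda>_. \<zero>\<^bsub>B\<^esub>}))"

definition reduced_groebner_basis ::
    "nat \<Rightarrow> (expo \<Rightarrow> expo \<Rightarrow> bool) \<Rightarrow> ('b, 'm) ring_scheme \<Rightarrow>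
     (expo \<Rightarrow> 'b) set \<Rightarrow> (expo \<Rightarrow> 'b) set \<Rightarrow> bool" where
  "reduced_groebner_basis n lt B I G \<longleftrightarrow>
    groebner_basis n lt B I G \<and>
    lead_expos lt B G = corners n (attached_std_set n lt B I) \<and>
    (\<forall>g\<in>G. lead_cf lt B g = \<one>\<^bsub>B\<^esub>) \<and>
    (\<forall>g\<in>G. \<forall>\<beta>. g \<beta> \<noteq> \<zero>\<^bsub>B\<^esub> \<and> \<beta> \<noteq> lead_expo lt B g \<longrightarrow> \<beta> \<in> attached_std_set n lt B I)"


section \<open>Algebras over the ground ring\<close>

definition k_algebra :: "('k, 'm) ring_scheme \<Rightarrow> ('b, 'l) ring_scheme \<Rightarrow> ('k \<Rightarrow> 'b) \<Rightarrow> bool" where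
  "k_algebra k B \<iota> \<longleftrightarrow> cring B \<and> \<iota> \<in> ring_hom k B"

text \<open>Homomorphisms are extensional, so that equality of functions is equality on the carrier.\<close>

definition alg_homs ::
    "('k, 'm) ring_scheme \<Rightarrow> ('b, 'l) ring_scheme \<Rightarrow> ('k \<Rightarrow> 'b) \<Rightarrow>
     ('c, 'l2) ring_scheme \<Rightarrow> ('k \<Rightarrow> 'c) \<Rightarrow> ('b \<Rightarrow> 'c) set" where
  "alg_homs k B \<iota> B' \<iota>' =
    {f \<in> ring_hom B B' \<inter> extensional (carrier B). \<forall>c\<in>carrier k. f (\<iota> c) = \<iota>' c}"


section \<open>The functors\<close>

text \<open>A ring homomorphism out of \<open>B[x]\<close> is the same thing as a \<open>B\<close>-algebra homomorphism, where \<open>B\<close> acts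
  on the target via the images of the constants.\<close>

definition hilb_point ::
    "nat \<Rightarrow> expo set \<Rightarrow> ('b, 'm) ring_scheme \<Rightarrow> ('q, 'l) ring_scheme \<Rightarrow> ((expo \<Rightarrow> 'b) \<Rightarrow> 'q) \<Rightarrow> bool" where
  "hilb_point n \<Delta> B Q \<phi> \<longleftrightarrow>
    cring Q \<and> \<phi> \<in> ring_hom (xring n B) Q \<and> \<phi> ` carrier (xring n B) = carrier Q \<and>
    (\<forall>q\<in>carrier Q. \<exists>!c. c \<in> \<Delta> \<rightarrow>\<^sub>E carrier B \<and>
       q = (\<Oplus>\<^bsub>Q\<^esub>\<beta>\<in>\<Delta>. \<phi> (mconst B (c \<beta>)) \<otimes>\<^bsub>Q\<^esub> \<phi> (mpower B \<beta>)))"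

text \<open>A class of such homomorphisms is represented by the common kernel of its members. The target can
  be taken to be the quotient by the kernel, so one type for the targets is enough.\<close>

definition Hilb :: "nat \<Rightarrow> expo set \<Rightarrow> 'b ring \<Rightarrow> (expo \<Rightarrow> 'b) set set" where
  "Hilb n \<Delta> B =
    {a_kernel (xring n B) Q \<phi> | (Q :: (expo \<Rightarrow> 'b) set ring) \<phi>. hilb_point n \<Delta> B Q \<phi>}"

definition Hilb_lt ::
    "nat \<Rightarrow> (expo \<Rightarrow> expo \<Rightarrow> bool) \<Rightarrow> expo set \<Rightarrow> 'b ring \<Rightarrow> (expo \<Rightarrow> 'b) set set" where
  "Hilb_lt n lt \<Delta> B =
    {I \<in> Hilb n \<Delta> B. \<exists>d. (\<forall>\<alpha>\<in>corners n \<Delta>. \<forall>\<beta>\<in>\<Delta>. d \<alpha> \<beta> \<in> carrier B) \<and>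
       reduced_groebner_basis n lt B I
         ((\<lambda>\<alpha>. mpower B \<alpha> \<oplus>\<^bsub>xring n B\<^esub>
               (\<Oplus>\<^bsub>xring n B\<^esub>\<beta>\<in>{\<beta>\<in>\<Delta>. lt \<beta> \<alpha>}. mterm B (d \<alpha> \<beta>) \<beta>)) ` corners n \<Delta>)}"

text \<open>Base change along \<open>f : B \<rightarrow> B'\<close>: by right exactness of the tensor product, the kernel of
  \<open>B'[x] = B' \<otimes> B[x] \<rightarrow> B' \<otimes> Q\<close> is generated by the image of the kernel of \<open>B[x] \<rightarrow> Q\<close>.\<close>

definition base_change ::
    "nat \<Rightarrow> ('c, 'm) ring_scheme \<Rightarrow> ('b \<Rightarrow> 'c) \<Rightarrow> (expo \<Rightarrow> 'b) set \<Rightarrow> (expo \<Rightarrow> 'c) set" where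
  "base_change n B' f I = Idl\<^bsub>xring n B'\<^esub> ((\<lambda>p m. f (p m)) ` I)"

definition rewrite_poly ::
    "nat \<Rightarrow> ('b, 'm) ring_scheme \<Rightarrow> expo set \<Rightarrow> (expo \<Rightarrow> expo \<Rightarrow> 'b) \<Rightarrow> expo \<Rightarrow> expo \<Rightarrow> 'b" where
  "rewrite_poly n B D a \<alpha> =
    mpower B \<alpha> \<ominus>\<^bsub>xring n B\<^esub> (\<Oplus>\<^bsub>xring n B\<^esub>\<beta>\<in>D. mterm B (a \<alpha> \<beta>) \<beta>)"

text \<open>The class with kernel \<open>I\<close> satisfies \<open>\<phi>(x\<^sup>\<alpha>) = \<Sum>\<^sub>\<beta>\<^sub>\<in>\<^sub>\<Delta> a\<^sub>\<alpha>\<^sub>,\<^sub>\<beta> \<phi>(x\<^sup>\<beta>)\<close> for all \<open>\<alpha> \<in> M\<close>.\<close>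

definition corresponds ::
    "nat \<Rightarrow> expo set \<Rightarrow> expo set \<Rightarrow> ('b, 'm) ring_scheme \<Rightarrow>
     (expo \<Rightarrow> expo \<Rightarrow> 'b) \<Rightarrow> (expo \<Rightarrow> 'b) set \<Rightarrow> bool" where
  "corresponds n \<Delta> M B a I \<longleftrightarrow> (\<forall>\<alpha>\<in>M. rewrite_poly n B \<Delta> a \<alpha> \<in> I)"

text \<open>\<open>A\<close>, with its elements \<open>T\<^sub>\<alpha>\<^sub>,\<^sub>\<beta>\<close>, is the coordinate ring of the scheme representing the functor \<open>H\<close>: a
  homomorphism \<open>f : A \<rightarrow> B\<close> corresponds to the class with \<open>\<phi>(x\<^sup>\<alpha>) = \<Sum>\<^sub>\<beta> f(T\<^sub>\<alpha>\<^sub>,\<^sub>\<beta>) \<phi>(x\<^sup>\<beta>)\<close>, and this is a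
  bijection. Only algebras \<open>B\<close> over the type of elements of \<open>A\<close> are considered.\<close>

definition coordinate_ring ::
    "('k, 'm) ring_scheme \<Rightarrow> nat \<Rightarrow> expo set \<Rightarrow> expo set \<Rightarrow> 'b ring \<Rightarrow> ('k \<Rightarrow> 'b) \<Rightarrow>
     (expo \<Rightarrow> expo \<Rightarrow> 'b) \<Rightarrow> ('b ring \<Rightarrow> (expo \<Rightarrow> 'b) set set) \<Rightarrow> bool" where
  "coordinate_ring k n \<Delta> M A \<iota> T H \<longleftrightarrow>
    (\<forall>B \<iota>B. k_algebra k B \<iota>B \<longrightarrow>
      (\<forall>f\<in>alg_homs k A \<iota> B \<iota>B. \<exists>!I. I \<in> H B \<and> corresponds n \<Delta> M B (\<lambda>\<alpha> \<beta>. f (T \<alpha> \<beta>)) I) \<and>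
      (\<forall>I\<in>H B. \<exists>!f. f \<in> alg_homs k A \<iota> B \<iota>B \<and> corresponds n \<Delta> M B (\<lambda>\<alpha> \<beta>. f (T \<alpha> \<beta>)) I))"

text \<open>The class of \<open>\<phi> : A[x] \<rightarrow> Q\<close> is the element of \<open>H(A)\<close> corresponding to the identity of \<open>A\<close>, and it
  is universal: every element of \<open>H(B)\<close> is its base change along a unique homomorphism \<open>A \<rightarrow> B\<close>.
  The set \<open>HA\<close> is \<open>H(A)\<close>; it is a separate argument because \<open>A\<close> and \<open>B\<close> have different types.\<close>

definition universal_object ::
    "('k, 'm) ring_scheme \<Rightarrow> nat \<Rightarrow> expo set \<Rightarrow> expo set \<Rightarrow> 'a ring \<Rightarrow> ('k \<Rightarrow> 'a) \<Rightarrow>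
     (expo \<Rightarrow> expo \<Rightarrow> 'a) \<Rightarrow> (expo \<Rightarrow> 'a) set set \<Rightarrow> ('b ring \<Rightarrow> (expo \<Rightarrow> 'b) set set) \<Rightarrow>
     'q ring \<Rightarrow> ((expo \<Rightarrow> 'a) \<Rightarrow> 'q) \<Rightarrow> bool" where
  "universal_object k n \<Delta> M A \<iota> T HA H Q \<phi> \<longleftrightarrow>
    k_algebra k A \<iota> \<and> hilb_point n \<Delta> A Q \<phi> \<and>
    a_kernel (xring n A) Q \<phi> \<in> HA \<and>
    corresponds n \<Delta> M A T (a_kernel (xring n A) Q \<phi>) \<and>
    (\<forall>B \<iota>B. k_algebra k B \<iota>B \<longrightarrow>
      bij_betw (\<lambda>f. base_change n B f (a_kernel (xring n A) Q \<phi>)) (alg_homs k A \<iota> B \<iota>B) (H B))"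


section \<open>The presentations of the coordinate rings\<close>

definition rel_delta ::
    "('p, 'm) ring_scheme \<Rightarrow> expo set \<Rightarrow> (expo \<Rightarrow> expo \<Rightarrow> 'p) \<Rightarrow> 'p set" where
  "rel_delta P \<Delta> T =
    {T \<alpha> \<beta> \<ominus>\<^bsub>P\<^esub> (if \<alpha> = \<beta> then \<one>\<^bsub>P\<^esub> else \<zero>\<^bsub>P\<^esub>) | \<alpha> \<beta>. \<alpha> \<in> \<Delta> \<and> \<beta> \<in> \<Delta>}"

definition shift_sum ::
    "('p, 'm) ring_scheme \<Rightarrow> expo set \<Rightarrow> (expo \<Rightarrow> expo \<Rightarrow> 'p) \<Rightarrow> expo \<Rightarrow> nat \<Rightarrow> expo \<Rightarrow> 'p" where
  "shift_sum P \<Delta> T \<alpha> i \<beta> = (\<Oplus>\<^bsub>P\<^esub>\<gamma>\<in>\<Delta>. T \<alpha> \<gamma> \<otimes>\<^bsub>P\<^esub> T (\<gamma> + unit_expo i) \<beta>)"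

definition rel_step ::
    "('p, 'm) ring_scheme \<Rightarrow> nat \<Rightarrow> expo set \<Rightarrow> expo set \<Rightarrow> (expo \<Rightarrow> expo \<Rightarrow> 'p) \<Rightarrow> 'p set" where
  "rel_step P n \<Delta> M T =
    {T (\<alpha> + unit_expo i) \<beta> \<ominus>\<^bsub>P\<^esub> shift_sum P \<Delta> T \<alpha> i \<beta> | \<alpha> i \<beta>.
       \<alpha> \<in> M \<and> i < n \<and> \<alpha> + unit_expo i \<in> M \<and> \<beta> \<in> \<Delta>}"

definition rel_comm ::
    "('p, 'm) ring_scheme \<Rightarrow> nat \<Rightarrow> expo set \<Rightarrow> expo set \<Rightarrow> (expo \<Rightarrow> expo \<Rightarrow> 'p) \<Rightarrow> 'p set" where
  "rel_comm P n \<Delta> N T =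
    {shift_sum P \<Delta> T \<alpha> i \<beta> \<ominus>\<^bsub>P\<^esub> shift_sum P \<Delta> T \<alpha>' j \<beta> | \<alpha> \<alpha>' i j \<beta>.
       \<alpha> \<in> border n N \<and> \<alpha>' \<in> border n N \<and> i < n \<and> j < n \<and>
       \<alpha> + unit_expo i = \<alpha>' + unit_expo j \<and>
       \<alpha> + unit_expo i \<in> border n (N \<union> border n N) \<and> \<beta> \<in> \<Delta>}"

definition rel_edge ::
    "('p, 'm) ring_scheme \<Rightarrow> nat \<Rightarrow> expo set \<Rightarrow> (expo \<Rightarrow> expo \<Rightarrow> 'p) \<Rightarrow> 'p set" where
  "rel_edge P n \<Delta> T =
    {shift_sum P \<Delta> T (\<epsilon> + unit_expo j) i \<beta> \<ominus>\<^bsub>P\<^esub> shift_sum P \<Delta> T (\<epsilon> + unit_expo i) j \<beta> | \<epsilon> i j \<beta>.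
       edge_triple n \<Delta> \<epsilon> i j \<and> \<beta> \<in> \<Delta>}"

abbreviation Tring :: "('k, 'm) ring_scheme \<Rightarrow> (expo \<times> expo) set \<Rightarrow> ((expo \<times> expo \<Rightarrow>\<^sub>0 nat) \<Rightarrow> 'k) ring" where
  "Tring k V \<equiv> mpoly_ring k V"

definition Tvar :: "('k, 'm) ring_scheme \<Rightarrow> expo \<Rightarrow> expo \<Rightarrow> (expo \<times> expo \<Rightarrow>\<^sub>0 nat) \<Rightarrow> 'k" where
  "Tvar k \<alpha> \<beta> = mvar k (\<alpha>, \<beta>)"

text \<open>The relations \<open>T\<^sub>\<alpha>\<^sub>,\<^sub>\<beta> = \<delta>\<^sub>\<alpha>\<^sub>,\<^sub>\<beta>\<close> are imposed for \<open>\<alpha> \<in> \<Delta>\<close> only. For \<open>\<alpha> \<in> N - \<Delta>\<close> they would say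
  that \<open>x\<^sup>\<alpha>\<close> vanishes, and the ring would not represent the functor.\<close>

definition ideal_border ::
    "('k, 'm) ring_scheme \<Rightarrow> nat \<Rightarrow> expo set \<Rightarrow> expo set \<Rightarrow> ((expo \<times> expo \<Rightarrow>\<^sub>0 nat) \<Rightarrow> 'k) set" where
  "ideal_border k n \<Delta> N =
    (let P = Tring k ((N \<union> border n N) \<times> \<Delta>) in
     Idl\<^bsub>P\<^esub> (rel_delta P \<Delta> (Tvar k) \<union> rel_step P n \<Delta> (N \<union> border n N) (Tvar k) \<union>
           rel_comm P n \<Delta> N (Tvar k)))"

text \<open>These relations need not imply that the matrices of multiplication by the variables commute: they
  fail to do so for \<open>k = \<rat>\<close>, \<open>n = 3\<close> and \<open>\<Delta> = {1, x, y, z, y\<^sup>2, z\<^sup>2}\<close> (written as monomials). So the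
  quotient by this ideal is not the coordinate ring of the Hilbert scheme in all cases.\<close>

definition ideal_edge ::
    "('k, 'm) ring_scheme \<Rightarrow> nat \<Rightarrow> expo set \<Rightarrow> ((expo \<times> expo \<Rightarrow>\<^sub>0 nat) \<Rightarrow> 'k) set" where
  "ideal_edge k n \<Delta> =
    (let P = Tring k ((\<Delta> \<union> border n \<Delta>) \<times> \<Delta>) in
     Idl\<^bsub>P\<^esub> (rel_delta P \<Delta> (Tvar k) \<union> rel_step P n \<Delta> (border n \<Delta>) (Tvar k) \<union>
           rel_edge P n \<Delta> (Tvar k)))"

definition ideal_lt ::
    "('k, 'm) ring_scheme \<Rightarrow> nat \<Rightarrow> (expo \<Rightarrow> expo \<Rightarrow> bool) \<Rightarrow> expo set \<Rightarrow> expo set \<Rightarrow>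
     ((expo \<times> expo \<Rightarrow>\<^sub>0 nat) \<Rightarrow> 'k) set" where
  "ideal_lt k n lt \<Delta> N =
    Idl\<^bsub>Tring k ((N \<union> border n N) \<times> \<Delta>)\<^esub>
      (ideal_border k n \<Delta> N \<union> {Tvar k \<alpha> \<beta> | \<alpha> \<beta>. \<alpha> \<in> N \<union> border n N \<and> \<beta> \<in> \<Delta> \<and> lt \<alpha> \<beta>})"

definition Tring_corner ::
    "('k, 'm) ring_scheme \<Rightarrow> nat \<Rightarrow> (expo \<Rightarrow> expo \<Rightarrow> bool) \<Rightarrow> expo set \<Rightarrow>
     ((expo \<times> expo \<Rightarrow>\<^sub>0 nat) \<Rightarrow> 'k) ring" where
  "Tring_corner k n lt \<Delta> = Tring k {(\<alpha>, \<beta>). \<alpha> \<in> corners n \<Delta> \<and> \<beta> \<in> \<Delta> \<and> lt \<beta> \<alpha>}"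

text \<open>The elements \<open>T\<^sub>\<alpha>\<^sub>,\<^sub>\<beta> \<in> R\<^sub>m\<close> for \<open>\<alpha> \<in> \<Delta> \<union> \<B>(\<Delta>)\<close>, after the replacements of \<open>T\<^sub>\<alpha>\<^sub>,\<^sub>\<beta>\<close> by
  \<open>\<delta>\<^sub>\<alpha>\<^sub>,\<^sub>\<beta>\<close> for \<open>\<alpha> \<in> \<Delta>\<close> and by \<open>0\<close> for \<open>\<alpha> \<prec> \<beta>\<close>. The index \<open>\<nu> \<alpha>\<close> is the direction chosen at
  \<open>\<alpha>\<close>. The sum includes \<open>\<gamma> + \<nu> = \<beta>\<close>, which is the only case in which the convention
  \<open>T\<^sub>\<gamma>\<^sub>+\<^sub>\<nu>\<^sub>,\<^sub>\<beta> = \<delta>\<^sub>\<gamma>\<^sub>+\<^sub>\<nu>\<^sub>,\<^sub>\<beta>\<close> for \<open>\<gamma> + \<nu> \<in> \<Delta>\<close> contributes.\<close>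

definition Tfam_corner ::
    "('k, 'm) ring_scheme \<Rightarrow> nat \<Rightarrow> (expo \<Rightarrow> expo \<Rightarrow> bool) \<Rightarrow> expo set \<Rightarrow> (expo \<Rightarrow> nat) \<Rightarrow>
     expo \<Rightarrow> expo \<Rightarrow> (expo \<times> expo \<Rightarrow>\<^sub>0 nat) \<Rightarrow> 'k" where
  "Tfam_corner k n lt \<Delta> \<nu> =
    (let P = Tring_corner k n lt \<Delta> in
     wfrec {(\<alpha>', \<alpha>). \<alpha>' \<in> expos n \<and> \<alpha> \<in> expos n \<and> lt \<alpha>' \<alpha>}
      (\<lambda>T \<alpha> \<beta>.
        if \<alpha> \<in> \<Delta> then (if \<alpha> = \<beta> then \<one>\<^bsub>P\<^esub> else \<zero>\<^bsub>P\<^esub>)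
        else if lt \<alpha> \<beta> then \<zero>\<^bsub>P\<^esub>
        else if \<alpha> \<in> corners n \<Delta> then Tvar k \<alpha> \<beta>
        else (\<Oplus>\<^bsub>P\<^esub>\<gamma>\<in>{\<gamma>\<in>\<Delta>. lt (\<gamma> + unit_expo (\<nu> \<alpha>)) \<alpha> \<and>
                          (lt \<beta> (\<gamma> + unit_expo (\<nu> \<alpha>)) \<or> \<beta> = \<gamma> + unit_expo (\<nu> \<alpha>))}.
               T (\<alpha> - unit_expo (\<nu> \<alpha>)) \<gamma> \<otimes>\<^bsub>P\<^esub> T (\<gamma> + unit_expo (\<nu> \<alpha>)) \<beta>)))"

definition admissible_dir :: "nat \<Rightarrow> expo set \<Rightarrow> (expo \<Rightarrow> nat) \<Rightarrow> bool" where
  "admissible_dir n \<Delta> \<nu> \<longleftrightarrow>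
    (\<forall>\<alpha>\<in>border n \<Delta> - corners n \<Delta>. \<nu> \<alpha> < n \<and> (\<exists>\<alpha>'\<in>border n \<Delta>. \<alpha>' + unit_expo (\<nu> \<alpha>) = \<alpha>))"

definition ideal_corner ::
    "('k, 'm) ring_scheme \<Rightarrow> nat \<Rightarrow> (expo \<Rightarrow> expo \<Rightarrow> bool) \<Rightarrow> expo set \<Rightarrow> (expo \<Rightarrow> nat) \<Rightarrow>
     ((expo \<times> expo \<Rightarrow>\<^sub>0 nat) \<Rightarrow> 'k) set" where
  "ideal_corner k n lt \<Delta> \<nu> =
    (let P = Tring_corner k n lt \<Delta>; T = Tfam_corner k n lt \<Delta> \<nu> in
     Idl\<^bsub>P\<^esub> (rel_delta P \<Delta> T \<union> rel_step P n \<Delta> (\<Delta> \<union> border n \<Delta>) T \<union> rel_comm P n \<Delta> \<Delta> T))"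


section \<open>The ideals of the families \<open>U\<^sup>\<Delta>\<close> and \<open>U\<^sup>\<prec>\<^sup>\<Delta>\<close>\<close>

definition idealU ::
    "nat \<Rightarrow> expo set \<Rightarrow> expo set \<Rightarrow> ('a, 'm) ring_scheme \<Rightarrow> (expo \<Rightarrow> expo \<Rightarrow> 'a) \<Rightarrow> (expo \<Rightarrow> 'a) set" where
  "idealU n \<Delta> M A T = Idl\<^bsub>xring n A\<^esub> (rewrite_poly n A \<Delta> T ` M)"

definition idealU_lt ::
    "nat \<Rightarrow> (expo \<Rightarrow> expo \<Rightarrow> bool) \<Rightarrow> expo set \<Rightarrow> ('a, 'm) ring_scheme \<Rightarrow> (expo \<Rightarrow> expo \<Rightarrow> 'a) \<Rightarrow>
     (expo \<Rightarrow> 'a) set" where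
  "idealU_lt n lt \<Delta> A T =
    Idl\<^bsub>xring n A\<^esub> ((\<lambda>\<alpha>. rewrite_poly n A {\<beta>\<in>\<Delta>. lt \<beta> \<alpha>} T \<alpha>) ` corners n \<Delta>)"

end

theory Submission imports Defs
begin

text \<open>
  An ideal \<open>I\<close> of \<open>B[x]\<close> for which the \<open>x\<^sup>\<beta>\<close>, \<open>\<beta> \<in> \<Delta>\<close>, form a basis of \<open>B[x]/I\<close> is determined by the
  coefficients \<open>T\<^sub>\<alpha>\<^sub>,\<^sub>\<beta>\<close> in \<open>x\<^sup>\<alpha> \<equiv> \<Sum>\<^sub>\<beta> T\<^sub>\<alpha>\<^sub>,\<^sub>\<beta> x\<^sup>\<beta>\<close>, \<open>\<alpha> \<in> N \<union> \<B>(N)\<close>. A family \<open>T\<close> arises in this way iff it is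
  the identity on \<open>\<Delta>\<close>, is compatible with the multiplication by variables, and the multiplication
  matrices commute: in this case the monomials act on row vectors, and applying \<open>x\<^sup>\<alpha>\<close> to the row of
  \<open>1\<close> gives a linear map on \<open>B[x]\<close> whose kernel is an ideal with the required basis, generated by
  the \<open>x\<^sup>\<alpha> - \<Sum>\<^sub>\<beta> T\<^sub>\<alpha>\<^sub>,\<^sub>\<beta> x\<^sup>\<beta>\<close>. Base change of the ideal amounts to applying the homomorphism to \<open>T\<close>. So a
  ring carrying a universal family \<open>T\<close> carries the universal object. The relations of (P1), (P3) and (P4)
  make the variables such a family; for (P2), this follows from the assumed representability.

  With a monomial order, the ideal has a reduced Groebner basis of the required form iff
  \<open>T\<^sub>\<alpha>\<^sub>,\<^sub>\<beta> = 0\<close> for \<open>\<alpha> \<prec> \<beta>\<close>. If it has one, then the basis elements reduce every monomial outside of \<open>\<Delta>\<close> to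
  smaller monomials in \<open>\<Delta>\<close>. Conversely, the vanishing propagates to the expansions of all monomials,
  so no leading exponent of the ideal lies in \<open>\<Delta>\<close>.
\<close>

section \<open>Polynomial rings\<close>

text \<open>Spanning modulo the generated ideal is cheap: it suffices to reduce x_i x^\<gamma> for
  \<gamma> in \<Delta>. Independence is the obstacle, since a set of generators gives no control
  over the elements of the ideal with support in \<Delta>. The kernel of the coordinate map supplies
  an ideal that contains the generators and meets the span of \<Delta> only in 0. From there on,
  equality of ideals is obtained from an inclusion: two comparable ideals for which \<Delta> gives a
  basis of the quotient coincide. This identifies the generated ideal with the kernel, gives
  uniqueness of the ideal that belongs to a family, and replaces all rewriting polynomials by those
  at the corners.

  The universal property is proved once, for families with a prescribed pattern of vanishing
  coefficients. A presentation has to provide three facts: its relations vanish on every family, its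
  variables determine the family, and the quotient carries one. The zero ring has to be kept among
  the test algebras, which calls for a separate look at Groebner bases over it.\<close>

lemma finite_add_pairs: "finite {ab. fst ab + snd ab = (m :: 'v \<Rightarrow>\<^sub>0 nat)}"
proof -
  let ?S = "{ab. fst ab + snd ab = m}"
  \<comment> \<open>The first component vanishes off the keys of m and is bounded by the largest
    exponent in m, so it lies in a finite set of functions. The second component is then determined
    by cancellation.\<close>
  let ?F = "{f. \<forall>v. (v \<in> Poly_Mapping.keys m \<longrightarrow> f v \<in> {..Max (Poly_Mapping.lookup m ` Poly_Mapping.keys m)}) \<and> (v \<notin> Poly_Mapping.keys m \<longrightarrow> f v = 0)}"
  have "finite ?F" by (rule finite_set_of_finite_funs) simp_all
  moreover have "(Poly_Mapping.lookup \<circ> fst) ` ?S \<subseteq> ?F"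
  proof (clarsimp, intro conjI impI)
    fix a b :: "'v \<Rightarrow>\<^sub>0 nat" and v
    show "v \<in> Poly_Mapping.keys (a + b) \<Longrightarrow> Poly_Mapping.lookup a v \<le> Max (Poly_Mapping.lookup (a + b) ` Poly_Mapping.keys (a + b))"
      by (rule order_trans[of _ "Poly_Mapping.lookup (a + b) v"]) (auto simp: lookup_add intro!: Max_ge)
    show "v \<notin> Poly_Mapping.keys (a + b) \<Longrightarrow> Poly_Mapping.lookup a v = 0"
      by (simp add: in_keys_iff lookup_add)
  qed
  ultimately have "finite ((Poly_Mapping.lookup \<circ> fst) ` ?S)" by (rule finite_subset[rotated])
  moreover have "inj_on (Poly_Mapping.lookup \<circ> fst) ?S"
    by (rule inj_onI) (auto simp: lookup_inject prod_eq_iff)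
  ultimately show ?thesis by (rule finite_imageD)
qed

lemma add_pairs_swap: "prod.swap ` {ab. fst ab + snd ab = (m :: 'v \<Rightarrow>\<^sub>0 nat)} = {ab. fst ab + snd ab = m}"
  by (auto simp: image_iff prod_eq_iff add.commute)

text \<open>Both sides list the ways to split m into three summands, nested in the first component
  on the left and in the second on the right; the map regroups them. It carries the associativity of
  the Cauchy product.\<close>

lemma add_pairs_assoc:
  "(SIGMA x:{ab. fst ab + snd ab = m}. {ab. fst ab + snd ab = fst x}) =
    (\<lambda>z. ((fst (fst z) + fst (snd z), snd (snd z)), (fst (fst z), fst (snd z)))) `
      (SIGMA x:{ab. fst ab + snd ab = (m :: 'v \<Rightarrow>\<^sub>0 nat)}. {ab. fst ab + snd ab = snd x})"
    (is "?L = ?h ` ?R")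
proof (intro Set.set_eqI iffI)
  fix z assume "z \<in> ?L"
  then show "z \<in> ?h ` ?R"
    by (intro image_eqI[of _ _ "((fst (snd z), snd (snd z) + snd (fst z)), (snd (snd z), snd (fst z)))"])
      (auto simp: prod_eq_iff add.assoc[symmetric])
qed (auto simp: add.assoc)

text \<open>Natural exponents cannot cancel, so the keys of a sum are the union of the keys of its
  summands.\<close>

lemma monomials_add: "a + b \<in> monomials V \<longleftrightarrow> a \<in> monomials V \<and> (b :: 'v \<Rightarrow>\<^sub>0 nat) \<in> monomials V"
proof -
  have "Poly_Mapping.keys (a + b) = Poly_Mapping.keys a \<union> Poly_Mapping.keys b" by (auto simp: in_keys_iff lookup_add)
  then show ?thesis by (simp add: monomials_def)
qed

lemma monomials_zero [simp]: "0 \<in> monomials V"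
  by (simp add: monomials_def)

lemma monomials_single: "v \<in> V \<Longrightarrow> Poly_Mapping.single v (k :: nat) \<in> monomials V"
  by (simp add: monomials_def)

text \<open>Induction on the total degree, a variable that occurs being removed once. It serves
  wherever a claim propagates by multiplication with a single variable.\<close>

lemma monomials_induct [consumes 1, case_names zero add]:
  fixes m :: "'v \<Rightarrow>\<^sub>0 nat"
  assumes "m \<in> monomials V" "Q 0"
    and step: "\<And>m v. m \<in> monomials V \<Longrightarrow> v \<in> V \<Longrightarrow> Q m \<Longrightarrow> Q (m + Poly_Mapping.single v 1)"
  shows "Q m"
  using assms(1)
proof (induction "sum (Poly_Mapping.lookup m) (Poly_Mapping.keys m)" arbitrary: m rule: less_induct)
  case less
  show ?case
  proof (cases "m = 0")
    case True then show ?thesis using assms(2) by simp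
  next
    case False
    then obtain v where v: "v \<in> Poly_Mapping.keys m" by fastforce
    define m' where "m' = m - Poly_Mapping.single v 1"
    have m: "m = m' + Poly_Mapping.single v 1"
      by (rule poly_mapping_eqI) (use v in \<open>auto simp: m'_def lookup_add lookup_minus lookup_single when_def in_keys_iff\<close>)
    have V: "m' \<in> monomials V" "v \<in> V"
      using less.prems v unfolding m monomials_add by (auto simp: m[symmetric] monomials_def)
    \<comment> \<open>Removing a variable may drop it from the keys. Summing m' over the keys of m
      keeps the comparison termwise, with strictness at v.\<close>
    have "sum (Poly_Mapping.lookup m') (Poly_Mapping.keys m') \<le> sum (Poly_Mapping.lookup m') (Poly_Mapping.keys m)"
      by (rule sum_mono2) (auto simp: m lookup_add in_keys_iff)
    also have "\<dots> < sum (Poly_Mapping.lookup m) (Poly_Mapping.keys m)"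
      by (rule sum_strict_mono_ex1) (use v in \<open>auto simp: m lookup_add lookup_single intro!: bexI[of _ v]\<close>)
    finally show ?thesis using less.hyps[of m'] V step[of m' v] m by simp
  qed
qed

section \<open>Rearranging finite sums\<close>

lemma (in abelian_monoid) finsum_Sigma:
  assumes "finite A" "\<And>x. x \<in> A \<Longrightarrow> finite (B x)" "\<And>x y. x \<in> A \<Longrightarrow> y \<in> B x \<Longrightarrow> f (x, y) \<in> carrier G"
  shows "(\<Oplus>x\<in>A. \<Oplus>y\<in>B x. f (x, y)) = (\<Oplus>z\<in>Sigma A B. f z)"
  using assms
proof (induction A)
  case empty then show ?case by simp
next
  case (insert a A)
  have fin: "finite (Sigma A B)" using insert by auto
  have eq: "Sigma (insert a A) B = Pair a ` B a \<union> Sigma A B" by auto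
  have "(\<Oplus>z\<in>Sigma (insert a A) B. f z) = (\<Oplus>z\<in>Pair a ` B a. f z) \<oplus> (\<Oplus>z\<in>Sigma A B. f z)"
    unfolding eq by (rule finsum_Un_disjoint) (use insert fin in auto)
  also have "(\<Oplus>z\<in>Pair a ` B a. f z) = (\<Oplus>y\<in>B a. f (a, y))"
    by (rule finsum_reindex) (use insert in \<open>auto simp: inj_on_def\<close>)
  finally show ?case using insert by (simp add: Pi_def)
qed

lemma (in abelian_monoid) finsum_swap:
  assumes "finite A" "finite B" "\<And>x y. x \<in> A \<Longrightarrow> y \<in> B \<Longrightarrow> f x y \<in> carrier G"
  shows "(\<Oplus>x\<in>A. \<Oplus>y\<in>B. f x y) = (\<Oplus>y\<in>B. \<Oplus>x\<in>A. f x y)"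
proof -
  have "(\<Oplus>x\<in>A. \<Oplus>y\<in>B. f x y) = (\<Oplus>z\<in>A \<times> B. f (fst z) (snd z))"
    using finsum_Sigma[of A "\<lambda>_. B" "\<lambda>z. f (fst z) (snd z)"] assms by simp
  also have "A \<times> B = prod.swap ` (B \<times> A)" by auto
  also have "(\<Oplus>z\<in>prod.swap ` (B \<times> A). f (fst z) (snd z)) = (\<Oplus>z\<in>B \<times> A. f (snd z) (fst z))"
    by (subst finsum_reindex) (use assms in auto)
  also have "\<dots> = (\<Oplus>y\<in>B. \<Oplus>x\<in>A. f x y)"
    using finsum_Sigma[of B "\<lambda>_. A" "\<lambda>z. f (snd z) (fst z)"] assms by simp
  finally show ?thesis .
qed

lemma (in abelian_monoid) finsum_single:
  assumes "finite A" "a \<in> A" "f a \<in> carrier G" "\<And>x. x \<in> A \<Longrightarrow> x \<noteq> a \<Longrightarrow> f x = \<zero>"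
  shows "finsum G f A = f a"
proof -
  have "f x \<in> carrier G" if "x \<in> A" for x
    using assms(3,4) that by (cases "x = a") auto
  then have "finsum G f A = finsum G f {a}"
    by (intro add.finprod_mono_neutral_cong_right) (use assms in auto)
  then show ?thesis using assms by simp
qed

lemma (in abelian_monoid) finsum_eq_zero: "(\<And>x. x \<in> A \<Longrightarrow> f x = \<zero>) \<Longrightarrow> finsum G f A = \<zero>"
  by (rule add.finprod_one_eqI)

section \<open>The ring axioms for the Cauchy product\<close>

lemma mpoly_ring_simps:
  "\<zero>\<^bsub>mpoly_ring R V\<^esub> = (\<lambda>m. \<zero>\<^bsub>R\<^esub>)"
  "\<one>\<^bsub>mpoly_ring R V\<^esub> = (\<lambda>m. if m = 0 then \<one>\<^bsub>R\<^esub> else \<zero>\<^bsub>R\<^esub>)"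
  "p \<oplus>\<^bsub>mpoly_ring R V\<^esub> q = (\<lambda>m. p m \<oplus>\<^bsub>R\<^esub> q m)"
  by (simp_all add: mpoly_ring_def)

lemma mpoly_mult:
  "p \<otimes>\<^bsub>mpoly_ring R V\<^esub> q = (\<lambda>m. \<Oplus>\<^bsub>R\<^esub>ab\<in>{ab. fst ab + snd ab = m}. p (fst ab) \<otimes>\<^bsub>R\<^esub> q (snd ab))"
  by (simp add: mpoly_ring_def)

lemma mpoly_carrier:
  "p \<in> carrier (mpoly_ring R V) \<longleftrightarrow>
    (\<forall>m. p m \<in> carrier R) \<and> (\<forall>m. p m \<noteq> \<zero>\<^bsub>R\<^esub> \<longrightarrow> m \<in> monomials V) \<and> finite {m. p m \<noteq> \<zero>\<^bsub>R\<^esub>}"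
  by (auto simp: mpoly_ring_def)

text \<open>The support of a product lies in the sumset \<open>?S\<close> of the two supports, which
  is finite and consists of monomials in V.\<close>

lemma (in cring) mpoly_mult_closed:
  assumes p: "p \<in> carrier (mpoly_ring R V)" and q: "q \<in> carrier (mpoly_ring R V)"
  shows "p \<otimes>\<^bsub>mpoly_ring R V\<^esub> q \<in> carrier (mpoly_ring R V)"
proof -
  let ?S = "(\<lambda>ab. fst ab + snd ab) ` ({m. p m \<noteq> \<zero>} \<times> {m. q m \<noteq> \<zero>})"
  have c: "p m \<in> carrier R" "q m \<in> carrier R" for m using p q by (auto simp: mpoly_carrier)
  have z: "(p \<otimes>\<^bsub>mpoly_ring R V\<^esub> q) m = \<zero>" if "m \<notin> ?S" for m
    unfolding mpoly_mult
  proof (rule finsum_eq_zero)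
    fix ab assume "ab \<in> {ab. fst ab + snd ab = m}"
    with that have "p (fst ab) = \<zero> \<or> q (snd ab) = \<zero>" by (auto simp: image_iff)
    then show "p (fst ab) \<otimes> q (snd ab) = \<zero>" using c by auto
  qed
  have S: "{m. (p \<otimes>\<^bsub>mpoly_ring R V\<^esub> q) m \<noteq> \<zero>} \<subseteq> ?S" using z by blast
  have "finite ?S" using p q by (auto simp: mpoly_carrier)
  moreover have "?S \<subseteq> monomials V" using p q by (auto simp: mpoly_carrier monomials_add)
  moreover have "(p \<otimes>\<^bsub>mpoly_ring R V\<^esub> q) m \<in> carrier R" for m
    unfolding mpoly_mult by (auto intro!: finsum_closed c)
  ultimately show ?thesis using S finite_subset[OF S] by (auto simp: mpoly_carrier)
qed

text \<open>Both products are sums over the decompositions of m into three exponents. They are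
  written as sums over \<open>Sigma\<close> sets and matched by the regrouping of
  \<open>add_pairs_assoc\<close>.\<close>

lemma (in cring) mpoly_mult_assoc:
  fixes p q r :: "('v \<Rightarrow>\<^sub>0 nat) \<Rightarrow> 'a"
  assumes p: "p \<in> carrier (mpoly_ring R V)" and q: "q \<in> carrier (mpoly_ring R V)"
    and r: "r \<in> carrier (mpoly_ring R V)"
  shows "(p \<otimes>\<^bsub>mpoly_ring R V\<^esub> q) \<otimes>\<^bsub>mpoly_ring R V\<^esub> r = p \<otimes>\<^bsub>mpoly_ring R V\<^esub> (q \<otimes>\<^bsub>mpoly_ring R V\<^esub> r)"
proof
  fix m :: "'v \<Rightarrow>\<^sub>0 nat"
  let ?D = "\<lambda>m :: 'v \<Rightarrow>\<^sub>0 nat. {ab. fst ab + snd ab = m}"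
  have c: "p m \<in> carrier R" "q m \<in> carrier R" "r m \<in> carrier R" for m
    using p q r by (auto simp: mpoly_carrier)
  let ?L = "\<lambda>z. p (fst (snd z)) \<otimes> q (snd (snd z)) \<otimes> r (snd (fst z))"
  let ?R = "\<lambda>z. p (fst (fst z)) \<otimes> (q (fst (snd z)) \<otimes> r (snd (snd z)))"
  let ?h = "\<lambda>z. ((fst (fst z) + fst (snd z), snd (snd z)), (fst (fst z), fst (snd z)))"
  let ?SL = "SIGMA x:?D m. ?D (fst x)" and ?SR = "SIGMA x:?D m. ?D (snd x)"
  have "((p \<otimes>\<^bsub>mpoly_ring R V\<^esub> q) \<otimes>\<^bsub>mpoly_ring R V\<^esub> r) m
      = (\<Oplus>x\<in>?D m. \<Oplus>y\<in>?D (fst x). ?L (x, y))"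
    unfolding mpoly_mult
    by (rule finsum_cong') (auto simp: c finsum_ldistr finite_add_pairs intro!: finsum_closed)
  also have "\<dots> = (\<Oplus>z\<in>?SL. ?L z)"
    by (rule finsum_Sigma) (auto simp: c finite_add_pairs)
  also have "?SL = ?h ` ?SR" by (rule add_pairs_assoc)
  also have "(\<Oplus>z\<in>?h ` ?SR. ?L z) = (\<Oplus>z\<in>?SR. ?L (?h z))"
    by (rule finsum_reindex) (auto simp: c inj_on_def prod_eq_iff)
  also have "\<dots> = (\<Oplus>z\<in>?SR. ?R z)"
    by (rule finsum_cong') (auto simp: c m_assoc)
  also have "\<dots> = (\<Oplus>x\<in>?D m. \<Oplus>y\<in>?D (snd x). ?R (x, y))"
    by (rule finsum_Sigma[symmetric]) (auto simp: c finite_add_pairs)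
  also have "\<dots> = (p \<otimes>\<^bsub>mpoly_ring R V\<^esub> (q \<otimes>\<^bsub>mpoly_ring R V\<^esub> r)) m"
    unfolding mpoly_mult
    by (rule finsum_cong') (auto simp: c finsum_rdistr finite_add_pairs intro!: finsum_closed)
  finally show "((p \<otimes>\<^bsub>mpoly_ring R V\<^esub> q) \<otimes>\<^bsub>mpoly_ring R V\<^esub> r) m
      = (p \<otimes>\<^bsub>mpoly_ring R V\<^esub> (q \<otimes>\<^bsub>mpoly_ring R V\<^esub> r)) m" .
qed

lemma (in cring) mpoly_mult_comm:
  fixes p q :: "('v \<Rightarrow>\<^sub>0 nat) \<Rightarrow> 'a"
  assumes p: "p \<in> carrier (mpoly_ring R V)" and q: "q \<in> carrier (mpoly_ring R V)"
  shows "p \<otimes>\<^bsub>mpoly_ring R V\<^esub> q = q \<otimes>\<^bsub>mpoly_ring R V\<^esub> p"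
proof
  fix m :: "'v \<Rightarrow>\<^sub>0 nat"
  let ?D = "{ab. fst ab + snd ab = m}"
  have c: "p m \<in> carrier R" "q m \<in> carrier R" for m using p q by (auto simp: mpoly_carrier)
  have "(p \<otimes>\<^bsub>mpoly_ring R V\<^esub> q) m = (\<Oplus>ab\<in>prod.swap ` ?D. p (fst ab) \<otimes> q (snd ab))"
    by (simp add: mpoly_mult add_pairs_swap)
  also have "\<dots> = (\<Oplus>ab\<in>?D. p (snd ab) \<otimes> q (fst ab))"
    by (subst finsum_reindex) (auto simp: c)
  also have "\<dots> = (q \<otimes>\<^bsub>mpoly_ring R V\<^esub> p) m"
    unfolding mpoly_mult by (rule finsum_cong') (auto simp: c m_comm)
  finally show "(p \<otimes>\<^bsub>mpoly_ring R V\<^esub> q) m = (q \<otimes>\<^bsub>mpoly_ring R V\<^esub> p) m" .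
qed

lemma (in cring) mpoly_add_closed:
  assumes p: "p \<in> carrier (mpoly_ring R V)" and q: "q \<in> carrier (mpoly_ring R V)"
  shows "p \<oplus>\<^bsub>mpoly_ring R V\<^esub> q \<in> carrier (mpoly_ring R V)"
proof -
  have "{m. p m \<oplus> q m \<noteq> \<zero>} \<subseteq> {m. p m \<noteq> \<zero>} \<union> {m. q m \<noteq> \<zero>}" by auto
  then have "finite {m. p m \<oplus> q m \<noteq> \<zero>}"
    by (rule finite_subset) (use p q in \<open>auto simp: mpoly_carrier\<close>)
  moreover have "p m \<noteq> \<zero> \<or> q m \<noteq> \<zero>" if "p m \<oplus> q m \<noteq> \<zero>" for m using that by auto
  ultimately show ?thesis using p q unfolding mpoly_carrier mpoly_ring_simps by (metis a_closed)
qed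

lemma (in cring) mpoly_one_mult:
  fixes p :: "('v \<Rightarrow>\<^sub>0 nat) \<Rightarrow> 'a"
  assumes p: "p \<in> carrier (mpoly_ring R V)"
  shows "\<one>\<^bsub>mpoly_ring R V\<^esub> \<otimes>\<^bsub>mpoly_ring R V\<^esub> p = p"
proof
  fix m :: "'v \<Rightarrow>\<^sub>0 nat"
  have c: "p m \<in> carrier R" for m using p by (auto simp: mpoly_carrier)
  let ?f = "\<lambda>ab :: ('v \<Rightarrow>\<^sub>0 nat) \<times> ('v \<Rightarrow>\<^sub>0 nat). \<one>\<^bsub>mpoly_ring R V\<^esub> (fst ab) \<otimes> p (snd ab)"
  have "finsum R ?f {ab. fst ab + snd ab = m} = ?f (0, m)"
    by (rule finsum_single) (use c in \<open>auto simp: finite_add_pairs mpoly_ring_simps\<close>)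
  then show "(\<one>\<^bsub>mpoly_ring R V\<^esub> \<otimes>\<^bsub>mpoly_ring R V\<^esub> p) m = p m"
    using c by (simp add: mpoly_mult) (simp add: mpoly_ring_simps)
qed

lemma (in cring) mpoly_add_mult:
  fixes p q r :: "('v \<Rightarrow>\<^sub>0 nat) \<Rightarrow> 'a"
  assumes p: "p \<in> carrier (mpoly_ring R V)" and q: "q \<in> carrier (mpoly_ring R V)"
    and r: "r \<in> carrier (mpoly_ring R V)"
  shows "(p \<oplus>\<^bsub>mpoly_ring R V\<^esub> q) \<otimes>\<^bsub>mpoly_ring R V\<^esub> r
    = p \<otimes>\<^bsub>mpoly_ring R V\<^esub> r \<oplus>\<^bsub>mpoly_ring R V\<^esub> q \<otimes>\<^bsub>mpoly_ring R V\<^esub> r"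
proof -
  have c: "p m \<in> carrier R" "q m \<in> carrier R" "r m \<in> carrier R" for m
    using p q r by (auto simp: mpoly_carrier)
  show ?thesis
    unfolding mpoly_mult mpoly_ring_simps
    by (rule ext, subst finsum_addf[symmetric]) (auto simp: c l_distr intro!: finsum_cong')
qed

lemma (in cring) mpoly_cring: "cring (mpoly_ring R V)"
proof (rule cringI)
  show "abelian_group (mpoly_ring R V)"
  proof (rule abelian_groupI)
    show "\<zero>\<^bsub>mpoly_ring R V\<^esub> \<in> carrier (mpoly_ring R V)"
      by (simp add: mpoly_carrier mpoly_ring_simps)
    fix p assume p: "p \<in> carrier (mpoly_ring R V)"
    then show "\<exists>q\<in>carrier (mpoly_ring R V). q \<oplus>\<^bsub>mpoly_ring R V\<^esub> p = \<zero>\<^bsub>mpoly_ring R V\<^esub>"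
    proof (intro bexI[of _ "\<lambda>m. \<ominus> p m"])
      have "{m. \<ominus> p m \<noteq> \<zero>} = {m. p m \<noteq> \<zero>}"
        using p by (force simp: mpoly_carrier)
      then show "(\<lambda>m. \<ominus> p m) \<in> carrier (mpoly_ring R V)"
        using p by (auto simp: mpoly_carrier)
    qed (auto simp: mpoly_carrier mpoly_ring_simps l_neg)
  qed (auto simp: mpoly_add_closed, auto simp: mpoly_carrier mpoly_ring_simps a_ac)
  show "comm_monoid (mpoly_ring R V)"
  proof (rule comm_monoidI)
    show "\<one>\<^bsub>mpoly_ring R V\<^esub> \<in> carrier (mpoly_ring R V)"
      by (auto simp: mpoly_carrier mpoly_ring_simps intro: finite_subset[of _ "{0}"])
  qed (simp_all add: mpoly_mult_closed mpoly_mult_assoc mpoly_one_mult, rule mpoly_mult_comm)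
qed (simp add: mpoly_add_mult)

section \<open>Terms, monomials and coefficients\<close>

lemma mterm_apply: "mterm R c m m' = (if m' = m then c else \<zero>\<^bsub>R\<^esub>)"
  by (simp add: mterm_def)

locale mpoly_over = cring R for R :: "('a, 'm) ring_scheme" (structure) + fixes V :: "'v set"
begin

abbreviation P :: "(('v \<Rightarrow>\<^sub>0 nat) \<Rightarrow> 'a) ring" where "P \<equiv> mpoly_ring R V"

sublocale P: cring P by (rule mpoly_cring)

lemma coeff_closed [simp]: "p \<in> carrier P \<Longrightarrow> p m \<in> carrier R"
  by (simp add: mpoly_carrier)

lemma coeff_outside: "p \<in> carrier P \<Longrightarrow> m \<notin> monomials V \<Longrightarrow> p m = \<zero>"
  by (auto simp: mpoly_carrier)

lemma finite_support: "p \<in> carrier P \<Longrightarrow> finite {m. p m \<noteq> \<zero>}"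
  by (simp add: mpoly_carrier)

lemma P_add_apply: "(p \<oplus>\<^bsub>P\<^esub> q) m = p m \<oplus> q m"
  by (simp add: mpoly_ring_simps)

lemma P_zero_apply: "\<zero>\<^bsub>P\<^esub> m = \<zero>"
  by (simp add: mpoly_ring_simps)

text \<open>The ring record has no field for negation; it is the inverse in the additive monoid. Its
  coefficients therefore come from the uniqueness of inverses in R.\<close>

lemma P_neg_apply:
  assumes "p \<in> carrier P" shows "(\<ominus>\<^bsub>P\<^esub> p) m = \<ominus> p m"
proof -
  have "p m \<oplus> (\<ominus>\<^bsub>P\<^esub> p) m = \<zero>"
    using P.r_neg[OF assms] by (metis P_add_apply P_zero_apply)
  then show ?thesis using assms by (metis P.a_inv_closed coeff_closed minus_equality a_comm)
qed

lemma P_minus_apply: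
  assumes "p \<in> carrier P" "q \<in> carrier P" shows "(p \<ominus>\<^bsub>P\<^esub> q) m = p m \<ominus> q m"
  using assms by (simp add: a_minus_def P_add_apply P_neg_apply)

text \<open>Induction on A. For infinite A both sums are 0 by convention.\<close>

lemma P_finsum_apply:
  assumes "f \<in> A \<rightarrow> carrier P"
  shows "finsum P f A m = (\<Oplus>i\<in>A. f i m)"
proof (cases "finite A")
  case True
  then show ?thesis using assms
  proof (induction A)
    case empty then show ?case by (simp add: P_zero_apply)
  next
    case (insert a A)
    then have "finsum P f (insert a A) m = f a m \<oplus> finsum P f A m"
      by (simp add: P_add_apply)
    also have "\<dots> = (\<Oplus>i\<in>insert a A. f i m)"
      using insert by (subst finsum_insert) (auto simp: Pi_def)
    finally show ?case .
  qed
qed (simp add: P.finsum_infinite finsum_infinite P_zero_apply)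

lemma mterm_closed [simp]:
  "c \<in> carrier R \<Longrightarrow> m \<in> monomials V \<Longrightarrow> mterm R c m \<in> carrier P"
  by (auto simp: mpoly_carrier mterm_apply intro: finite_subset[of _ "{m}"])

lemma mpower_closed [simp]: "m \<in> monomials V \<Longrightarrow> mpower R m \<in> carrier P"
  by (simp add: mpower_def)

lemma mconst_closed [simp]: "c \<in> carrier R \<Longrightarrow> mconst R c \<in> carrier P"
  by (simp add: mconst_def)

lemma mvar_closed [simp]: "v \<in> V \<Longrightarrow> mvar R v \<in> carrier P"
  by (simp add: mvar_def monomials_single)

text \<open>By cancellation, (a, m) is the one pair with sum a + m whose first component is
  a.\<close>

lemma mterm_mult_apply:
  assumes "c \<in> carrier R" "p \<in> carrier P"
  shows "(mterm R c a \<otimes>\<^bsub>P\<^esub> p) (a + m) = c \<otimes> p m"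
proof -
  let ?f = "\<lambda>ab. mterm R c a (fst ab) \<otimes> p (snd ab)"
  have "finsum R ?f {ab. fst ab + snd ab = a + m} = ?f (a, m)"
    by (rule finsum_single) (use assms in \<open>auto simp: finite_add_pairs mterm_apply\<close>)
  then show ?thesis by (simp add: mpoly_mult mterm_apply)
qed

lemma mterm_mult_apply_0:
  assumes "p \<in> carrier P" "\<And>m'. m \<noteq> a + m'"
  shows "(mterm R c a \<otimes>\<^bsub>P\<^esub> p) m = \<zero>"
  unfolding mpoly_mult by (rule finsum_eq_zero) (use assms in \<open>auto simp: mterm_apply\<close>)

lemma mterm_mult:
  assumes "c \<in> carrier R" "d \<in> carrier R" "b \<in> monomials V"
  shows "mterm R c a \<otimes>\<^bsub>P\<^esub> mterm R d b = mterm R (c \<otimes> d) (a + b)"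
proof
  fix m
  show "(mterm R c a \<otimes>\<^bsub>P\<^esub> mterm R d b) m = mterm R (c \<otimes> d) (a + b) m"
  proof (cases "\<exists>m'. m = a + m'")
    case True
    then obtain m' where "m = a + m'" by blast
    then show ?thesis using assms by (simp add: mterm_mult_apply) (simp add: mterm_apply)
  next
    case False
    then show ?thesis using assms by (subst mterm_mult_apply_0) (auto simp: mterm_apply)
  qed
qed

lemma mterm_eq: "c \<in> carrier R \<Longrightarrow> m \<in> monomials V \<Longrightarrow> mterm R c m = mconst R c \<otimes>\<^bsub>P\<^esub> mpower R m"
  by (simp add: mconst_def mpower_def mterm_mult)

lemma mpower_add:
  "b \<in> monomials V \<Longrightarrow> mpower R (a + b) = mpower R a \<otimes>\<^bsub>P\<^esub> mpower R b"
  by (simp add: mpower_def mterm_mult)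

lemma mpower_zero: "mpower R 0 = \<one>\<^bsub>P\<^esub>"
  by (simp add: mpower_def mterm_def mpoly_ring_simps)

lemma mterm_add:
  "c \<in> carrier R \<Longrightarrow> d \<in> carrier R \<Longrightarrow> mterm R c m \<oplus>\<^bsub>P\<^esub> mterm R d m = mterm R (c \<oplus> d) m"
  by (rule ext) (simp add: P_add_apply mterm_apply)

lemma mconst_hom: "mconst R \<in> ring_hom R P"
  by (rule ring_hom_memI)
    (auto simp: mconst_def mterm_mult mterm_add, simp add: mterm_def mpoly_ring_simps)

text \<open>Induction on the support, one term being split off at a time. The zero polynomial is
  covered as the term with coefficient 0 at the exponent 0.\<close>

lemma mpoly_induct [consumes 1, case_names mterm add]:
  assumes p: "p \<in> carrier P"
    and mterm: "\<And>c m. c \<in> carrier R \<Longrightarrow> m \<in> monomials V \<Longrightarrow> Q (mterm R c m)"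
    and add: "\<And>p q. p \<in> carrier P \<Longrightarrow> q \<in> carrier P \<Longrightarrow> Q p \<Longrightarrow> Q q \<Longrightarrow> Q (p \<oplus>\<^bsub>P\<^esub> q)"
  shows "Q p"
proof -
  have "finite {m. p m \<noteq> \<zero>}" using p by (rule finite_support)
  then show ?thesis using p
  proof (induction "{m. p m \<noteq> \<zero>}" arbitrary: p rule: finite_psubset_induct)
    case psubset
    show ?case
    proof (cases "\<exists>m. p m \<noteq> \<zero>")
      case False
      then have "p = mterm R \<zero> 0" by (auto simp: mterm_apply)
      then show ?thesis using mterm[of \<zero> 0] by simp
    next
      case True
      then obtain m where m: "p m \<noteq> \<zero>" by blast
      let ?q = "p(m := \<zero>)"
      have q: "?q \<in> carrier P" using psubset.prems by (auto simp: mpoly_carrier elim: rev_finite_subset)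
      have mV: "m \<in> monomials V" using m psubset.prems by (auto simp: mpoly_carrier)
      have "p = ?q \<oplus>\<^bsub>P\<^esub> mterm R (p m) m"
        using psubset.prems by (auto simp: P_add_apply mterm_apply)
      moreover have "Q ?q" by (rule psubset.hyps(2)) (use m q in auto)
      moreover have "Q (mterm R (p m) m)" using psubset.prems mV by (intro mterm) auto
      moreover have "mterm R (p m) m \<in> carrier P" using psubset.prems mV by simp
      ultimately show ?thesis using add[OF q] by metis
    qed
  qed
qed

lemma finsum_mterm:
  assumes "finite D" "D \<subseteq> monomials V" "\<And>m. m \<in> D \<Longrightarrow> c m \<in> carrier R"
  shows "(\<Oplus>\<^bsub>P\<^esub>m\<in>D. mterm R (c m) m) = (\<lambda>m. if m \<in> D then c m else \<zero>)"
proof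
  fix m
  have "(\<Oplus>\<^bsub>P\<^esub>m\<in>D. mterm R (c m) m) m = (\<Oplus>i\<in>D. mterm R (c i) i m)"
    by (rule P_finsum_apply) (use assms in auto)
  also have "\<dots> = (if m \<in> D then c m else \<zero>)"
  proof (cases "m \<in> D")
    case True
    have "(\<Oplus>i\<in>D. mterm R (c i) i m) = mterm R (c m) m m"
      by (rule finsum_single) (use assms True in \<open>auto simp: mterm_apply\<close>)
    then show ?thesis using True by (simp add: mterm_apply)
  next
    case False
    then show ?thesis by (auto simp: mterm_apply intro!: finsum_eq_zero)
  qed
  finally show "(\<Oplus>\<^bsub>P\<^esub>m\<in>D. mterm R (c m) m) m = (if m \<in> D then c m else \<zero>)" .
qed

text \<open>Uniqueness in the universal property of R[V]: constants and variables determine the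
  values on monomials, then on terms, then on sums.\<close>

lemma ring_hom_eqI:
  assumes f: "f \<in> ring_hom P S" and g: "g \<in> ring_hom P S" and S: "cring S"
    and const: "\<And>c. c \<in> carrier R \<Longrightarrow> f (mconst R c) = g (mconst R c)"
    and var: "\<And>v. v \<in> V \<Longrightarrow> f (mvar R v) = g (mvar R v)"
    and p: "p \<in> carrier P"
  shows "f p = g p"
proof -
  have mono: "f (mpower R m) = g (mpower R m)" if "m \<in> monomials V" for m
    using that
  proof (induction rule: monomials_induct)
    case zero
    then show ?case using const[of \<one>] by (simp add: mpower_def mconst_def)
  next
    case (add m v)
    have "mpower R (m + Poly_Mapping.single v 1) = mpower R m \<otimes>\<^bsub>P\<^esub> mvar R v"
      unfolding mvar_def by (rule mpower_add) (simp add: add monomials_single)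
    then show ?case
      using add var f g by (simp add: ring_hom_mult)
  qed
  show ?thesis using p
  proof (induction rule: mpoly_induct)
    case (mterm c m)
    then show ?case
      using const mono f g by (simp add: mterm_eq ring_hom_mult)
  next
    case (add p q)
    then show ?case using f g by (simp add: ring_hom_add)
  qed
qed

end

section \<open>Linear extension of maps on monomials\<close>

text \<open>Used in two roles: as an evaluation homomorphism, where w is multiplicative and h is a
  structure map, and as a coordinate functional, where h is the identity and w gives one coordinate
  of each monomial.\<close>

definition lin_ext ::
    "('a, 'm) ring_scheme \<Rightarrow> ('b, 'l) ring_scheme \<Rightarrow> ('a \<Rightarrow> 'b) \<Rightarrow> ('c \<Rightarrow> 'b) \<Rightarrow> ('c \<Rightarrow> 'a) \<Rightarrow> 'b" where
  "lin_ext R S h w p = (\<Oplus>\<^bsub>S\<^esub>m\<in>{m. p m \<noteq> \<zero>\<^bsub>R\<^esub>}. h (p m) \<otimes>\<^bsub>S\<^esub> w m)"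

locale mpoly_lin = mpoly_over R V + S: cring S for R :: "('a, 'm) ring_scheme" (structure)
    and V :: "'v set" and S :: "('b, 'l) ring_scheme" +
  fixes h :: "'a \<Rightarrow> 'b" and w :: "('v \<Rightarrow>\<^sub>0 nat) \<Rightarrow> 'b"
  assumes hom: "h \<in> ring_hom R S" and w_closed: "\<And>m. m \<in> monomials V \<Longrightarrow> w m \<in> carrier S"
begin

sublocale h: ring_hom_cring R S h
  by unfold_locales (rule hom)

text \<open>Lets two polynomials be summed over a common finite set of exponents, as additivity
  requires.\<close>

lemma lin_ext_superset:
  assumes "p \<in> carrier P" "finite F" "{m. p m \<noteq> \<zero>} \<subseteq> F" "F \<subseteq> monomials V"
  shows "lin_ext R S h w p = (\<Oplus>\<^bsub>S\<^esub>m\<in>F. h (p m) \<otimes>\<^bsub>S\<^esub> w m)"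
  unfolding lin_ext_def
proof (rule S.add.finprod_mono_neutral_cong_left)
  show "h (p i) \<otimes>\<^bsub>S\<^esub> w i = \<zero>\<^bsub>S\<^esub>" if "i \<in> F - {m. p m \<noteq> \<zero>}" for i
    using that assms w_closed by (auto simp: subset_iff)
  show "(\<lambda>m. h (p m) \<otimes>\<^bsub>S\<^esub> w m) \<in> F \<rightarrow> carrier S"
    using assms w_closed by (auto simp: subset_iff)
qed (use assms in auto)

lemma support_monomials: "p \<in> carrier P \<Longrightarrow> {m. p m \<noteq> \<zero>} \<subseteq> monomials V"
  using coeff_outside by blast

lemma lin_ext_closed: "p \<in> carrier P \<Longrightarrow> lin_ext R S h w p \<in> carrier S"
  unfolding lin_ext_def using support_monomials w_closed
  by (intro S.finsum_closed) (auto simp: subset_iff)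

lemma lin_ext_mterm:
  assumes "c \<in> carrier R" "m \<in> monomials V"
  shows "lin_ext R S h w (mterm R c m) = h c \<otimes>\<^bsub>S\<^esub> w m"
proof -
  have "lin_ext R S h w (mterm R c m) = (\<Oplus>\<^bsub>S\<^esub>i\<in>{m}. h (mterm R c m i) \<otimes>\<^bsub>S\<^esub> w i)"
    by (rule lin_ext_superset) (use assms in \<open>auto simp: mterm_apply\<close>)
  then show ?thesis using assms w_closed by (simp add: mterm_apply)
qed

lemma lin_ext_add:
  assumes p: "p \<in> carrier P" and q: "q \<in> carrier P"
  shows "lin_ext R S h w (p \<oplus>\<^bsub>P\<^esub> q) = lin_ext R S h w p \<oplus>\<^bsub>S\<^esub> lin_ext R S h w q"
proof -
  let ?F = "{m. p m \<noteq> \<zero>} \<union> {m. q m \<noteq> \<zero>}"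
  have F: "finite ?F" "?F \<subseteq> monomials V"
    using p q support_monomials finite_support by auto
  have "lin_ext R S h w (p \<oplus>\<^bsub>P\<^esub> q) = (\<Oplus>\<^bsub>S\<^esub>m\<in>?F. h ((p \<oplus>\<^bsub>P\<^esub> q) m) \<otimes>\<^bsub>S\<^esub> w m)"
    by (rule lin_ext_superset) (use p q F in \<open>auto simp: P_add_apply\<close>)
  also have "\<dots> = (\<Oplus>\<^bsub>S\<^esub>m\<in>?F. h (p m) \<otimes>\<^bsub>S\<^esub> w m \<oplus>\<^bsub>S\<^esub> h (q m) \<otimes>\<^bsub>S\<^esub> w m)"
    by (rule S.finsum_cong') (use p q F w_closed in \<open>auto simp: P_add_apply S.l_distr subset_iff\<close>)
  also have "\<dots> = (\<Oplus>\<^bsub>S\<^esub>m\<in>?F. h (p m) \<otimes>\<^bsub>S\<^esub> w m) \<oplus>\<^bsub>S\<^esub> (\<Oplus>\<^bsub>S\<^esub>m\<in>?F. h (q m) \<otimes>\<^bsub>S\<^esub> w m)"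
    by (rule S.finsum_addf) (use p q F w_closed in \<open>auto simp: subset_iff\<close>)
  also have "\<dots> = lin_ext R S h w p \<oplus>\<^bsub>S\<^esub> lin_ext R S h w q"
    using lin_ext_superset[OF p F(1) _ F(2)] lin_ext_superset[OF q F(1) _ F(2)] by simp
  finally show ?thesis .
qed

text \<open>Multiplication by a term shifts the exponents of p injectively, so the shift can be
  moved from p to w.\<close>

lemma lin_ext_mterm_mult:
  assumes c: "c \<in> carrier R" and a: "a \<in> monomials V" and p: "p \<in> carrier P"
  shows "lin_ext R S h w (mterm R c a \<otimes>\<^bsub>P\<^esub> p) = h c \<otimes>\<^bsub>S\<^esub> lin_ext R S h (\<lambda>m. w (a + m)) p"
proof -
  let ?F = "{m. p m \<noteq> \<zero>}"
  have F: "finite ?F" "?F \<subseteq> monomials V"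
    using p support_monomials finite_support by auto
  have wF: "w m \<in> carrier S" "w (a + m) \<in> carrier S" if "p m \<noteq> \<zero>" for m
    using that F(2) a w_closed by (auto simp: monomials_add)
  have F': "(+) a ` ?F \<subseteq> monomials V" using F(2) a by (auto simp: monomials_add)
  have "lin_ext R S h w (mterm R c a \<otimes>\<^bsub>P\<^esub> p)
      = (\<Oplus>\<^bsub>S\<^esub>m\<in>(+) a ` ?F. h ((mterm R c a \<otimes>\<^bsub>P\<^esub> p) m) \<otimes>\<^bsub>S\<^esub> w m)"
  proof (rule lin_ext_superset)
    show "{m. (mterm R c a \<otimes>\<^bsub>P\<^esub> p) m \<noteq> \<zero>} \<subseteq> (+) a ` ?F"
    proof
      fix m assume m: "m \<in> {m. (mterm R c a \<otimes>\<^bsub>P\<^esub> p) m \<noteq> \<zero>}"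
      then obtain m' where m': "m = a + m'"
        using mterm_mult_apply_0[OF p, of m a c] by blast
      with m have "p m' \<noteq> \<zero>" using c p by (auto simp: mterm_mult_apply)
      with m' show "m \<in> (+) a ` ?F" by blast
    qed
  qed (use c a p F F' in auto)
  also have "\<dots> = (\<Oplus>\<^bsub>S\<^esub>m\<in>?F. h ((mterm R c a \<otimes>\<^bsub>P\<^esub> p) (a + m)) \<otimes>\<^bsub>S\<^esub> w (a + m))"
    by (rule S.finsum_reindex) (use c a p wF in \<open>auto simp: inj_on_def\<close>)
  also have "\<dots> = (\<Oplus>\<^bsub>S\<^esub>m\<in>?F. h c \<otimes>\<^bsub>S\<^esub> (h (p m) \<otimes>\<^bsub>S\<^esub> w (a + m)))"
    by (rule S.finsum_cong') (use c a p wF in \<open>auto simp: mterm_mult_apply S.m_assoc\<close>)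
  also have "\<dots> = h c \<otimes>\<^bsub>S\<^esub> (\<Oplus>\<^bsub>S\<^esub>m\<in>?F. h (p m) \<otimes>\<^bsub>S\<^esub> w (a + m))"
    by (rule S.finsum_rdistr[symmetric]) (use c a p wF F in auto)
  finally show ?thesis by (simp add: lin_ext_def)
qed

text \<open>By additivity in p, the product rule is reduced to a term as first factor, where
  multiplicativity turns the shift of w into the factor \<open>w a\<close>.\<close>

lemma lin_ext_ring_hom:
  assumes w0: "w 0 = \<one>\<^bsub>S\<^esub>"
    and wadd: "\<And>a b. a \<in> monomials V \<Longrightarrow> b \<in> monomials V \<Longrightarrow> w (a + b) = w a \<otimes>\<^bsub>S\<^esub> w b"
  shows "lin_ext R S h w \<in> ring_hom P S"
proof (rule ring_hom_memI)
  fix p assume p: "p \<in> carrier P"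
  then show "lin_ext R S h w p \<in> carrier S" by (rule lin_ext_closed)
  fix q assume q: "q \<in> carrier P"
  show "lin_ext R S h w (p \<oplus>\<^bsub>P\<^esub> q) = lin_ext R S h w p \<oplus>\<^bsub>S\<^esub> lin_ext R S h w q"
    by (rule lin_ext_add[OF p q])
  show "lin_ext R S h w (p \<otimes>\<^bsub>P\<^esub> q) = lin_ext R S h w p \<otimes>\<^bsub>S\<^esub> lin_ext R S h w q"
    using p
  proof (induction rule: mpoly_induct)
    case (mterm c a)
    have wq: "w m \<in> carrier S" "m \<in> monomials V" if "q m \<noteq> \<zero>" for m
      using that q support_monomials[OF q] w_closed by auto
    have "lin_ext R S h (\<lambda>m. w (a + m)) q = (\<Oplus>\<^bsub>S\<^esub>m\<in>{m. q m \<noteq> \<zero>}. w a \<otimes>\<^bsub>S\<^esub> (h (q m) \<otimes>\<^bsub>S\<^esub> w m))"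
      unfolding lin_ext_def
      by (rule S.finsum_cong') (use q wq mterm w_closed in \<open>auto simp: wadd S.m_ac\<close>)
    also have "\<dots> = w a \<otimes>\<^bsub>S\<^esub> lin_ext R S h w q"
      unfolding lin_ext_def
      by (rule S.finsum_rdistr[symmetric]) (use q wq mterm w_closed finite_support in auto)
    finally show ?case
      using mterm q w_closed lin_ext_closed[OF q]
      by (simp add: lin_ext_mterm_mult lin_ext_mterm S.m_assoc)
  next
    case (add p p')
    then show ?case using q lin_ext_closed
      by (simp add: P.l_distr lin_ext_add S.l_distr)
  qed
next
  have "\<one>\<^bsub>P\<^esub> = mterm R \<one> 0" by (simp add: mterm_def mpoly_ring_simps)
  then show "lin_ext R S h w \<one>\<^bsub>P\<^esub> = \<one>\<^bsub>S\<^esub>"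
    by (simp add: lin_ext_mterm w0)
qed

end

definition mono_val :: "('b, 'l) ring_scheme \<Rightarrow> ('v \<Rightarrow> 'b) \<Rightarrow> ('v \<Rightarrow>\<^sub>0 nat) \<Rightarrow> 'b" where
  "mono_val S a m = (\<Otimes>\<^bsub>S\<^esub>v\<in>Poly_Mapping.keys m. a v [^]\<^bsub>S\<^esub> Poly_Mapping.lookup m v)"

context cring
begin

lemma mono_val_superset:
  assumes "finite F" "Poly_Mapping.keys m \<subseteq> F" "a \<in> F \<rightarrow> carrier R"
  shows "mono_val R a m = (\<Otimes>v\<in>F. a v [^] Poly_Mapping.lookup m v)"
  unfolding mono_val_def
  by (rule finprod_mono_neutral_cong_left) (use assms in \<open>auto simp: in_keys_iff\<close>)

lemma mono_val_add:
  assumes "m \<in> monomials V" "m' \<in> monomials V" "a \<in> V \<rightarrow> carrier R"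
  shows "mono_val R a (m + m') = mono_val R a m \<otimes> mono_val R a m'"
proof -
  let ?F = "Poly_Mapping.keys m \<union> Poly_Mapping.keys m'"
  have F: "finite ?F" "Poly_Mapping.keys (m + m') \<subseteq> ?F" "a \<in> ?F \<rightarrow> carrier R"
    using assms Poly_Mapping.keys_add[of m m'] by (auto simp: monomials_def)
  have "mono_val R a (m + m') = (\<Otimes>v\<in>?F. a v [^] Poly_Mapping.lookup (m + m') v)"
    using F by (intro mono_val_superset)
  also have "\<dots> = (\<Otimes>v\<in>?F. a v [^] Poly_Mapping.lookup m v \<otimes> a v [^] Poly_Mapping.lookup m' v)"
    by (rule finprod_cong') (use F in \<open>auto simp: lookup_add nat_pow_mult Pi_iff\<close>)
  also have "\<dots> = (\<Otimes>v\<in>?F. a v [^] Poly_Mapping.lookup m v) \<otimes> (\<Otimes>v\<in>?F. a v [^] Poly_Mapping.lookup m' v)"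
    by (rule finprod_multf) (use F in \<open>auto simp: Pi_iff\<close>)
  also have "\<dots> = mono_val R a m \<otimes> mono_val R a m'"
    using F by (subst (1 2) mono_val_superset[of ?F]) auto
  finally show ?thesis .
qed

lemma mono_val_zero [simp]: "mono_val R a 0 = \<one>"
  by (simp add: mono_val_def)

lemma mono_val_single [simp]: "a v \<in> carrier R \<Longrightarrow> mono_val R a (Poly_Mapping.single v 1) = a v"
  by (simp add: mono_val_def)

lemma mono_val_closed:
  "m \<in> monomials V \<Longrightarrow> a \<in> V \<rightarrow> carrier R \<Longrightarrow> mono_val R a m \<in> carrier R"
  unfolding mono_val_def by (rule finprod_closed) (auto simp: monomials_def Pi_iff)

end

section \<open>Universal properties of polynomial rings and quotients\<close>

text \<open>Existence in the universal property of R[V], the counterpart of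
  \<open>ring_hom_eqI\<close>. A monomial is sent to the product of the powers of the values
  \<open>a v\<close>.\<close>

lemma (in mpoly_over) mpoly_eval:
  assumes S: "cring S" and h: "h \<in> ring_hom R S" and a: "a \<in> V \<rightarrow> carrier S"
  obtains f where "f \<in> ring_hom P S" "\<And>c. c \<in> carrier R \<Longrightarrow> f (mconst R c) = h c"
    "\<And>v. v \<in> V \<Longrightarrow> f (mvar R v) = a v"
proof -
  interpret S: cring S by (rule S)
  interpret mpoly_lin R V S h "mono_val S a"
    by unfold_locales (use h a S.mono_val_closed in auto)
  show thesis
  proof (rule that[of "lin_ext R S h (mono_val S a)"])
    show "lin_ext R S h (mono_val S a) \<in> ring_hom P S"
      by (rule lin_ext_ring_hom) (use a S.mono_val_add in auto)
    show "lin_ext R S h (mono_val S a) (mconst R c) = h c" if "c \<in> carrier R" for c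
      using that by (simp add: mconst_def lin_ext_mterm)
    show "lin_ext R S h (mono_val S a) (mvar R v) = a v" if "v \<in> V" for v
    proof -
      have v: "a v \<in> carrier S" using that a by auto
      have "lin_ext R S h (mono_val S a) (mvar R v) = h \<one> \<otimes>\<^bsub>S\<^esub> mono_val S a (Poly_Mapping.single v 1)"
        unfolding mvar_def mpower_def by (rule lin_ext_mterm) (use that in \<open>auto simp: monomials_single\<close>)
      also have "\<dots> = a v" unfolding S.mono_val_single[of a v, OF v] using v by simp
      finally show ?thesis .
    qed
  qed
qed

lemma (in mpoly_over) map_coeff_hom:
  assumes S: "cring S" and h: "h \<in> ring_hom R S"
  shows "(\<lambda>p m. h (p m)) \<in> ring_hom P (mpoly_ring S V)"
proof -
  interpret S: mpoly_over S V by (intro mpoly_over.intro S)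
  interpret h: ring_hom_cring R S h by unfold_locales (rule h)
  show ?thesis
  proof (rule ring_hom_memI)
    fix p q assume p: "p \<in> carrier P" and q: "q \<in> carrier P"
    show "(\<lambda>m. h (p m)) \<in> carrier (mpoly_ring S V)"
      using p by (auto simp: mpoly_carrier elim: rev_finite_subset) (metis h.hom_zero)
    show "(\<lambda>m. h ((p \<oplus>\<^bsub>P\<^esub> q) m)) = (\<lambda>m. h (p m)) \<oplus>\<^bsub>mpoly_ring S V\<^esub> (\<lambda>m. h (q m))"
      using p q by (simp add: mpoly_ring_simps)
    show "(\<lambda>m. h ((p \<otimes>\<^bsub>P\<^esub> q) m)) = (\<lambda>m. h (p m)) \<otimes>\<^bsub>mpoly_ring S V\<^esub> (\<lambda>m. h (q m))"
      using p q by (auto simp: mpoly_mult fun_eq_iff Pi_iff intro!: S.finsum_cong')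
  qed (auto simp: mpoly_ring_simps)
qed

lemma (in cring) quotient_lift:
  assumes I: "ideal I R" and S: "cring S" and h: "h \<in> ring_hom R S"
    and ker: "\<And>p. p \<in> I \<Longrightarrow> h p = \<zero>\<^bsub>S\<^esub>"
  obtains f where "f \<in> ring_hom (R Quot I) S \<inter> extensional (carrier (R Quot I))"
    "\<And>p. p \<in> carrier R \<Longrightarrow> f (I +> p) = h p"
proof -
  interpret S: cring S by (rule S)
  interpret I: ideal I R by (rule I)
  interpret h: ring_hom_cring R S h by unfold_locales (rule h)
  interpret Q: cring "R Quot I" by (rule I.quotient_is_cring) (rule is_cring)
  have eq: "h p = h q" if "p \<in> carrier R" "q \<in> carrier R" "I +> p = I +> q" for p q
  proof -
    have "p \<ominus> q \<in> I" using that quotient_eq_iff_same_a_r_cos[OF I] by blast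
    then have "h p \<ominus>\<^bsub>S\<^esub> h q = \<zero>\<^bsub>S\<^esub>" using ker that by (metis h.hom_a_inv h.hom_add a_minus_def a_inv_closed)
    then show ?thesis using that by simp
  qed
  \<comment> \<open>The value is read off an arbitrary representative, and \<open>eq\<close> makes
    it independent of the choice. The restriction puts the map among the extensional ones, as
    \<open>alg_homs\<close> demands.\<close>
  let ?f = "restrict (\<lambda>C. h (SOME p. p \<in> carrier R \<and> I +> p = C)) (carrier (R Quot I))"
  have carr: "I +> p \<in> carrier (R Quot I)" if "p \<in> carrier R" for p
    using that by (auto simp: FactRing_simps)
  have f: "?f (I +> p) = h p" if "p \<in> carrier R" for p
  proof -
    have "(SOME q. q \<in> carrier R \<and> I +> q = I +> p) \<in> carrier R
        \<and> I +> (SOME q. q \<in> carrier R \<and> I +> q = I +> p) = I +> p"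
      by (rule someI_ex) (use that in auto)
    then show ?thesis using eq[OF _ that] carr[OF that] by auto
  qed
  have rep: "\<exists>p\<in>carrier R. C = I +> p" if "C \<in> carrier (R Quot I)" for C
    using that by (auto simp: FactRing_simps)
  have rc: "((+>) I) \<in> ring_hom R (R Quot I)" by (rule I.rcos_ring_hom)
  have "?f \<in> ring_hom (R Quot I) S"
  proof (rule ring_hom_memI)
    fix C D assume "C \<in> carrier (R Quot I)" "D \<in> carrier (R Quot I)"
    then obtain p q where pq: "p \<in> carrier R" "C = I +> p" "q \<in> carrier R" "D = I +> q"
      using rep by meson
    show "?f C \<in> carrier S" using f pq by simp
    show "?f (C \<otimes>\<^bsub>R Quot I\<^esub> D) = ?f C \<otimes>\<^bsub>S\<^esub> ?f D"
      using ring_hom_mult[OF rc pq(1,3)] f[of "p \<otimes> q"] f pq by simp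
    show "?f (C \<oplus>\<^bsub>R Quot I\<^esub> D) = ?f C \<oplus>\<^bsub>S\<^esub> ?f D"
      using ring_hom_add[OF rc pq(1,3)] f[of "p \<oplus> q"] f pq by simp
  next
    show "?f \<one>\<^bsub>R Quot I\<^esub> = \<one>\<^bsub>S\<^esub>"
      using ring_hom_one[OF rc] f[of \<one>] by simp
  qed
  then show thesis using f by (intro that[of ?f]) auto
qed

section \<open>Ideals with a monomial basis of the quotient\<close>

lemma ex1_unique: "\<exists>!x. Q x \<Longrightarrow> Q a \<Longrightarrow> Q b \<Longrightarrow> a = b"
  by blast

text \<open>Spanning and independence of the monomials of \<Delta> modulo I, expressed within B[x]
  through remainders supported in \<Delta>. No target ring occurs, which makes ideals over different
  rings comparable in the same terms as points of the functor.\<close>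

definition basis_ideal :: "nat \<Rightarrow> expo set \<Rightarrow> ('b, 'm) ring_scheme \<Rightarrow> (expo \<Rightarrow> 'b) set \<Rightarrow> bool" where
  "basis_ideal n \<Delta> B I \<longleftrightarrow> ideal I (xring n B) \<and>
    (\<forall>p\<in>carrier (xring n B). \<exists>r\<in>carrier (xring n B).
      {m. r m \<noteq> \<zero>\<^bsub>B\<^esub>} \<subseteq> \<Delta> \<and> p \<ominus>\<^bsub>xring n B\<^esub> r \<in> I) \<and>
    (\<forall>r\<in>I. {m. r m \<noteq> \<zero>\<^bsub>B\<^esub>} \<subseteq> \<Delta> \<longrightarrow> r = \<zero>\<^bsub>xring n B\<^esub>)"

text \<open>\<open>T \<alpha> \<beta>\<close> stands for the coefficient of \<open>x\<^sup>\<beta>\<close> in the expansion of \<open>x\<^sup>\<alpha>\<close>; by the last condition, the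
  matrices of multiplication by the variables commute.\<close>

definition mult_family ::
    "nat \<Rightarrow> expo set \<Rightarrow> expo set \<Rightarrow> ('b, 'm) ring_scheme \<Rightarrow> (expo \<Rightarrow> expo \<Rightarrow> 'b) \<Rightarrow> bool" where
  "mult_family n \<Delta> M B T \<longleftrightarrow>
    (\<forall>\<alpha>\<in>M. \<forall>\<beta>\<in>\<Delta>. T \<alpha> \<beta> \<in> carrier B) \<and>
    (\<forall>\<alpha>\<in>\<Delta>. \<forall>\<beta>\<in>\<Delta>. T \<alpha> \<beta> = (if \<alpha> = \<beta> then \<one>\<^bsub>B\<^esub> else \<zero>\<^bsub>B\<^esub>)) \<and>
    (\<forall>\<alpha>\<in>M. \<forall>i<n. \<alpha> + unit_expo i \<in> M \<longrightarrow>
      (\<forall>\<beta>\<in>\<Delta>. T (\<alpha> + unit_expo i) \<beta> = shift_sum B \<Delta> T \<alpha> i \<beta>)) \<and>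
    (\<forall>\<alpha>\<in>\<Delta>. \<forall>i<n. \<forall>j<n. \<forall>\<beta>\<in>\<Delta>.
      shift_sum B \<Delta> T (\<alpha> + unit_expo i) j \<beta> = shift_sum B \<Delta> T (\<alpha> + unit_expo j) i \<beta>)"

text \<open>M stands for the union of N and its border. It enters the arguments through two
  properties: it is closed under passing to divisors, and it contains \<Delta> with all its one-step
  shifts.\<close>

locale hilb_data =
  fixes n :: nat and \<Delta> M :: "expo set"
  assumes finite_\<Delta>: "finite \<Delta>" and zero_\<Delta>: "0 \<in> \<Delta>" and \<Delta>_expos: "\<Delta> \<subseteq> expos n"
    and M_std: "standard_set n M" and \<Delta>_M: "\<Delta> \<subseteq> M"
    and \<Delta>_step: "\<And>\<alpha> i. \<alpha> \<in> \<Delta> \<Longrightarrow> i < n \<Longrightarrow> \<alpha> + unit_expo i \<in> M"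
begin

lemma M_expos: "M \<subseteq> expos n"
  using M_std by (simp add: standard_set_def)

lemma M_down: "\<alpha> \<in> expos n \<Longrightarrow> \<gamma> \<in> expos n \<Longrightarrow> \<alpha> + \<gamma> \<in> M \<Longrightarrow> \<alpha> \<in> M"
  using M_std unfolding standard_set_def by blast

end

lemma unit_expo_expos: "i < n \<Longrightarrow> unit_expo i \<in> expos n"
  by (simp add: unit_expo_def monomials_single)

locale hilb_ring = hilb_data n \<Delta> M + mpoly_over R "{..<n}"
  for n :: nat and \<Delta> M :: "expo set" and R :: "('a, 'm) ring_scheme" (structure)
begin

text \<open>The closed form of the sums of terms in \<open>rewrite_poly\<close>. As an explicit
  function it has coefficients that can be read off directly.\<close>

definition trunc :: "expo set \<Rightarrow> (expo \<Rightarrow> 'a) \<Rightarrow> expo \<Rightarrow> 'a" where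
  "trunc D c m = (if m \<in> D then c m else \<zero>)"

lemma trunc_closed:
  assumes "D \<subseteq> \<Delta>" "\<And>m. m \<in> D \<Longrightarrow> c m \<in> carrier R"
  shows "trunc D c \<in> carrier P"
proof -
  have "finite {m. trunc D c m \<noteq> \<zero>}"
    by (rule finite_subset[OF _ finite_\<Delta>]) (use assms(1) in \<open>auto simp: trunc_def\<close>)
  then show ?thesis using assms \<Delta>_expos by (auto simp: mpoly_carrier trunc_def)
qed

lemma trunc_restrict: "{m. r m \<noteq> \<zero>} \<subseteq> \<Delta> \<Longrightarrow> trunc \<Delta> (restrict r \<Delta>) = r"
proof
  fix m assume "{m. r m \<noteq> \<zero>} \<subseteq> \<Delta>"
  then have "m \<notin> \<Delta> \<Longrightarrow> r m = \<zero>" by blast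
  then show "trunc \<Delta> (restrict r \<Delta>) m = r m" by (simp add: trunc_def)
qed

lemma trunc_finsum:
  assumes "D \<subseteq> \<Delta>" "\<And>m. m \<in> D \<Longrightarrow> c m \<in> carrier R"
  shows "(\<Oplus>\<^bsub>P\<^esub>m\<in>D. mterm R (c m) m) = trunc D c"
  unfolding trunc_def
  by (rule finsum_mterm) (use assms finite_\<Delta> \<Delta>_expos finite_subset in auto)

lemma rewrite_poly_trunc:
  assumes "D \<subseteq> \<Delta>" "\<And>\<beta>. \<beta> \<in> D \<Longrightarrow> T \<alpha> \<beta> \<in> carrier R"
  shows "rewrite_poly n R D T \<alpha> = mpower R \<alpha> \<ominus>\<^bsub>P\<^esub> trunc D (T \<alpha>)"
  unfolding rewrite_poly_def using assms by (subst trunc_finsum) auto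

lemma rewrite_poly_closed:
  assumes "D \<subseteq> \<Delta>" "\<And>\<beta>. \<beta> \<in> D \<Longrightarrow> T \<alpha> \<beta> \<in> carrier R" "\<alpha> \<in> expos n"
  shows "rewrite_poly n R D T \<alpha> \<in> carrier P"
  using assms by (simp add: rewrite_poly_trunc trunc_closed)

lemma rewrite_poly_apply:
  assumes "D \<subseteq> \<Delta>" "\<And>\<beta>. \<beta> \<in> D \<Longrightarrow> T \<alpha> \<beta> \<in> carrier R" "\<alpha> \<in> expos n"
  shows "rewrite_poly n R D T \<alpha> m = (if m = \<alpha> then \<one> else \<zero>) \<ominus> (if m \<in> D then T \<alpha> m else \<zero>)"
  using assms by (simp add: rewrite_poly_trunc trunc_closed P_minus_apply) (simp add: mpower_def mterm_apply trunc_def)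

text \<open>Translates the linear combinations in \<open>hilb_point\<close> into images of
  polynomials supported in \<Delta>, so that statements about bases of Q become statements about the
  kernel.\<close>

lemma hom_trunc:
  assumes Q: "cring Q" and hom: "\<phi> \<in> ring_hom P Q" and c: "\<And>\<beta>. \<beta> \<in> \<Delta> \<Longrightarrow> c \<beta> \<in> carrier R"
  shows "(\<Oplus>\<^bsub>Q\<^esub>\<beta>\<in>\<Delta>. \<phi> (mconst R (c \<beta>)) \<otimes>\<^bsub>Q\<^esub> \<phi> (mpower R \<beta>)) = \<phi> (trunc \<Delta> c)"
proof -
  interpret Q: cring Q by (rule Q)
  interpret \<phi>: ring_hom_cring P Q \<phi> by unfold_locales (rule hom)
  have "\<phi> (trunc \<Delta> c) = \<phi> (\<Oplus>\<^bsub>P\<^esub>\<beta>\<in>\<Delta>. mterm R (c \<beta>) \<beta>)"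
    using c by (simp add: trunc_finsum)
  also have "\<dots> = (\<Oplus>\<^bsub>Q\<^esub>\<beta>\<in>\<Delta>. \<phi> (mterm R (c \<beta>) \<beta>))"
    using c \<Delta>_expos by (subst \<phi>.hom_finsum) (auto simp: comp_def)
  also have "\<dots> = (\<Oplus>\<^bsub>Q\<^esub>\<beta>\<in>\<Delta>. \<phi> (mconst R (c \<beta>)) \<otimes>\<^bsub>Q\<^esub> \<phi> (mpower R \<beta>))"
    by (rule Q.finsum_cong') (use c \<Delta>_expos in \<open>auto simp: mterm_eq subset_iff\<close>)
  finally show ?thesis ..
qed

lemma basis_ideal_unique:
  assumes "basis_ideal n \<Delta> R I" "r \<in> carrier P" "s \<in> carrier P"
    "{m. r m \<noteq> \<zero>} \<subseteq> \<Delta>" "{m. s m \<noteq> \<zero>} \<subseteq> \<Delta>" "r \<ominus>\<^bsub>P\<^esub> s \<in> I"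
  shows "r = s"
proof -
  have "{m. (r \<ominus>\<^bsub>P\<^esub> s) m \<noteq> \<zero>} \<subseteq> \<Delta>"
  proof (intro subsetI, rule ccontr)
    fix m assume m: "m \<in> {m. (r \<ominus>\<^bsub>P\<^esub> s) m \<noteq> \<zero>}" "m \<notin> \<Delta>"
    then have "r m = \<zero>" "s m = \<zero>" using assms(4,5) by auto
    then show False using m assms(2,3) by (simp add: P_minus_apply)
  qed
  then have "r \<ominus>\<^bsub>P\<^esub> s = \<zero>\<^bsub>P\<^esub>" using assms by (auto simp: basis_ideal_def)
  then show ?thesis using assms by simp
qed

text \<open>Spanning modulo the smaller ideal moves p to some r supported in \<Delta>; this r stays
  in the larger ideal and vanishes by independence there.\<close>

lemma basis_ideal_eq:
  assumes I: "basis_ideal n \<Delta> R I" and J: "basis_ideal n \<Delta> R J" and "I \<subseteq> J"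
  shows "I = J"
proof
  interpret I: ideal I P using I by (simp add: basis_ideal_def)
  interpret J: ideal J P using J by (simp add: basis_ideal_def)
  show "J \<subseteq> I"
  proof
    fix p assume p: "p \<in> J"
    then have pc: "p \<in> carrier P" by (rule J.Icarr)
    obtain r where r: "r \<in> carrier P" "{m. r m \<noteq> \<zero>} \<subseteq> \<Delta>" "p \<ominus>\<^bsub>P\<^esub> r \<in> I"
      using I pc unfolding basis_ideal_def by blast
    have "p \<oplus>\<^bsub>P\<^esub> (\<ominus>\<^bsub>P\<^esub> (p \<ominus>\<^bsub>P\<^esub> r)) \<in> J" using p r(3) \<open>I \<subseteq> J\<close> by auto
    also have "p \<oplus>\<^bsub>P\<^esub> (\<ominus>\<^bsub>P\<^esub> (p \<ominus>\<^bsub>P\<^esub> r)) = r"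
      using pc r(1) by (simp add: P.minus_eq P.minus_add P.r_neg2)
    finally have "r \<in> J" .
    then have "r = \<zero>\<^bsub>P\<^esub>" using J r(2) by (simp add: basis_ideal_def)
    then show "p \<in> I" using r(3) pc by (simp add: P.minus_eq)
  qed
qed fact

lemma hilb_point_basis_ideal:
  assumes "hilb_point n \<Delta> R Q \<phi>"
  shows "basis_ideal n \<Delta> R (a_kernel P Q \<phi>)"
proof -
  interpret Q: cring Q using assms unfolding hilb_point_def by blast
  have hom: "\<phi> \<in> ring_hom P Q" using assms unfolding hilb_point_def by blast
  interpret \<phi>: ring_hom_cring P Q \<phi> by unfold_locales (rule hom)
  have uniq: "\<exists>!c. c \<in> \<Delta> \<rightarrow>\<^sub>E carrier R \<and>
       q = (\<Oplus>\<^bsub>Q\<^esub>\<beta>\<in>\<Delta>. \<phi> (mconst R (c \<beta>)) \<otimes>\<^bsub>Q\<^esub> \<phi> (mpower R \<beta>))" if "q \<in> carrier Q" for q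
    using assms that unfolding hilb_point_def by blast
  note sum = hom_trunc[OF Q.is_cring hom]
  show ?thesis
    unfolding basis_ideal_def
  proof (intro conjI ballI impI)
    show "ideal (a_kernel P Q \<phi>) P"
      by (rule ring_hom_ring.kernel_is_ideal) (rule ring_hom_ringI2[OF P.ring_axioms Q.ring_axioms hom])
    fix p assume p: "p \<in> carrier P"
    then obtain c where c: "c \<in> \<Delta> \<rightarrow>\<^sub>E carrier R"
        "\<phi> p = (\<Oplus>\<^bsub>Q\<^esub>\<beta>\<in>\<Delta>. \<phi> (mconst R (c \<beta>)) \<otimes>\<^bsub>Q\<^esub> \<phi> (mpower R \<beta>))"
      using ex1_implies_ex[OF uniq[OF \<phi>.hom_closed]] by blast
    have cc: "c \<beta> \<in> carrier R" if "\<beta> \<in> \<Delta>" for \<beta> using c(1) that by (auto simp: PiE_iff)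
    have t: "trunc \<Delta> c \<in> carrier P" using cc by (intro trunc_closed) auto
    have "\<phi> p = \<phi> (trunc \<Delta> c)" using c(2) sum[of c, OF cc] by simp
    then have "\<phi> (p \<ominus>\<^bsub>P\<^esub> trunc \<Delta> c) = \<zero>\<^bsub>Q\<^esub>"
      using p t by (simp only: a_minus_def \<phi>.hom_add \<phi>.hom_a_inv P.a_inv_closed \<phi>.hom_closed Q.r_neg)
    then have "p \<ominus>\<^bsub>P\<^esub> trunc \<Delta> c \<in> a_kernel P Q \<phi>"
      using P.minus_closed[OF p t] unfolding a_kernel_def' by blast
    then show "\<exists>r\<in>carrier P. {m. r m \<noteq> \<zero>} \<subseteq> \<Delta> \<and> p \<ominus>\<^bsub>P\<^esub> r \<in> a_kernel P Q \<phi>"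
      using t by (intro bexI[of _ "trunc \<Delta> c"]) (auto simp: trunc_def)
  next
    fix r assume r: "r \<in> a_kernel P Q \<phi>" and supp: "{m. r m \<noteq> \<zero>} \<subseteq> \<Delta>"
    have rc: "r \<in> carrier P" and r0: "\<phi> r = \<zero>\<^bsub>Q\<^esub>" using r unfolding a_kernel_def' by blast+
    have "(\<Oplus>\<^bsub>Q\<^esub>\<beta>\<in>\<Delta>. \<phi> (mconst R (restrict r \<Delta> \<beta>)) \<otimes>\<^bsub>Q\<^esub> \<phi> (mpower R \<beta>))
        = \<phi> (trunc \<Delta> (restrict r \<Delta>))"
      by (rule sum) (use rc in simp)
    then have 1: "\<zero>\<^bsub>Q\<^esub> = (\<Oplus>\<^bsub>Q\<^esub>\<beta>\<in>\<Delta>. \<phi> (mconst R (restrict r \<Delta> \<beta>)) \<otimes>\<^bsub>Q\<^esub> \<phi> (mpower R \<beta>))"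
      unfolding trunc_restrict[OF supp] r0 by (rule sym)
    have "(\<Oplus>\<^bsub>Q\<^esub>\<beta>\<in>\<Delta>. \<phi> (mconst R (restrict (\<lambda>_. \<zero>) \<Delta> \<beta>)) \<otimes>\<^bsub>Q\<^esub> \<phi> (mpower R \<beta>))
        = \<phi> (trunc \<Delta> (restrict (\<lambda>_. \<zero>) \<Delta>))"
      by (rule sum) simp
    also have "trunc \<Delta> (restrict (\<lambda>_. \<zero>) \<Delta>) = \<zero>\<^bsub>P\<^esub>" by (rule ext) (simp add: trunc_def P_zero_apply)
    finally have 2: "\<zero>\<^bsub>Q\<^esub> = (\<Oplus>\<^bsub>Q\<^esub>\<beta>\<in>\<Delta>. \<phi> (mconst R (restrict (\<lambda>_. \<zero>) \<Delta> \<beta>)) \<otimes>\<^bsub>Q\<^esub> \<phi> (mpower R \<beta>))"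
      by simp
    \<comment> \<open>Two families of coordinates represent the zero of Q: the coefficients of r and
      the zero family. Uniqueness of coordinates makes them equal.\<close>
    have "restrict r \<Delta> = restrict (\<lambda>_. \<zero>) \<Delta>"
      by (rule ex1_unique[OF uniq[OF Q.zero_closed]], intro conjI, rule restrict_PiE_iff[THEN iffD2], use rc 1 in simp, rule 1,
          intro conjI, rule restrict_PiE_iff[THEN iffD2], simp, rule 2)
    then have "r m = \<zero>" if "m \<in> \<Delta>" for m using that by (auto dest: fun_cong[of _ _ m])
    then show "r = \<zero>\<^bsub>P\<^esub>" using supp by (intro ext) (auto simp: P_zero_apply)
  qed
qed

text \<open>Coordinates of \<phi>(p) are the coefficients of a remainder of p. A second family of
  coordinates yields a second remainder, equal to the first by independence modulo I.\<close>

lemma hilb_pointI: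
  assumes I: "basis_ideal n \<Delta> R I" and Q: "cring Q" and hom: "\<phi> \<in> ring_hom P Q"
    and surj: "\<phi> ` carrier P = carrier Q"
    and eq: "\<And>p q. p \<in> carrier P \<Longrightarrow> q \<in> carrier P \<Longrightarrow> \<phi> p = \<phi> q \<longleftrightarrow> p \<ominus>\<^bsub>P\<^esub> q \<in> I"
  shows "hilb_point n \<Delta> R Q \<phi>"
  unfolding hilb_point_def
proof (intro conjI ballI)
  show "cring Q" by (rule Q)
  show "\<phi> \<in> ring_hom P Q" by (rule hom)
  show "\<phi> ` carrier P = carrier Q" by (rule surj)
next
  fix q assume "q \<in> carrier Q"
  then obtain p where p: "p \<in> carrier P" "q = \<phi> p" using surj by blast
  obtain r where r: "r \<in> carrier P" "{m. r m \<noteq> \<zero>} \<subseteq> \<Delta>" "p \<ominus>\<^bsub>P\<^esub> r \<in> I"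
    using I p(1) unfolding basis_ideal_def by blast
  note sum = hom_trunc[OF Q hom]
  have tr: "trunc \<Delta> (restrict r \<Delta>) = r" by (rule trunc_restrict[OF r(2)])
  have pr: "\<phi> p = \<phi> r" using eq[OF p(1) r(1)] r(3) by simp
  show "\<exists>!c. c \<in> \<Delta> \<rightarrow>\<^sub>E carrier R \<and>
      q = (\<Oplus>\<^bsub>Q\<^esub>\<beta>\<in>\<Delta>. \<phi> (mconst R (c \<beta>)) \<otimes>\<^bsub>Q\<^esub> \<phi> (mpower R \<beta>))"
  proof (intro ex1I[of _ "restrict r \<Delta>"] conjI)
    show "restrict r \<Delta> \<in> \<Delta> \<rightarrow>\<^sub>E carrier R" using r(1) by auto
    have "(\<Oplus>\<^bsub>Q\<^esub>\<beta>\<in>\<Delta>. \<phi> (mconst R (restrict r \<Delta> \<beta>)) \<otimes>\<^bsub>Q\<^esub> \<phi> (mpower R \<beta>))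
        = \<phi> (trunc \<Delta> (restrict r \<Delta>))"
      by (rule sum) (use r(1) in simp)
    then show "q = (\<Oplus>\<^bsub>Q\<^esub>\<beta>\<in>\<Delta>. \<phi> (mconst R (restrict r \<Delta> \<beta>)) \<otimes>\<^bsub>Q\<^esub> \<phi> (mpower R \<beta>))"
      unfolding tr p(2) pr by (rule sym)
    fix c assume c: "c \<in> \<Delta> \<rightarrow>\<^sub>E carrier R \<and>
      q = (\<Oplus>\<^bsub>Q\<^esub>\<beta>\<in>\<Delta>. \<phi> (mconst R (c \<beta>)) \<otimes>\<^bsub>Q\<^esub> \<phi> (mpower R \<beta>))"
    have cc: "c \<beta> \<in> carrier R" if "\<beta> \<in> \<Delta>" for \<beta> using conjunct1[OF c] that by (rule PiE_mem)
    have t: "trunc \<Delta> c \<in> carrier P" using cc by (intro trunc_closed) auto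
    have "\<phi> (trunc \<Delta> c) = \<phi> r" using trans[OF trans[OF p(2)[symmetric] conjunct2[OF c]] sum[of c, OF cc]] pr by simp
    then have "trunc \<Delta> c \<ominus>\<^bsub>P\<^esub> r \<in> I" using eq[OF t r(1)] by simp
    then have "trunc \<Delta> c = r"
      by (rule basis_ideal_unique[OF I t r(1) _ r(2), rotated]) (auto simp: trunc_def)
    then have "c \<beta> = restrict r \<Delta> \<beta>" if "\<beta> \<in> \<Delta>" for \<beta>
      using that by (auto simp: trunc_def)
    moreover have "c \<in> extensional \<Delta>" using conjunct1[OF c] by (simp add: PiE_iff)
    ultimately show "c = restrict r \<Delta>"
      by (intro extensionalityI[of _ \<Delta>]) simp_all
  qed
qed

lemma basis_ideal_hilb_point:
  assumes "basis_ideal n \<Delta> R I"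
  shows "hilb_point n \<Delta> R (P Quot I) (\<lambda>p. I +>\<^bsub>P\<^esub> p)" "a_kernel P (P Quot I) (\<lambda>p. I +>\<^bsub>P\<^esub> p) = I"
proof -
  interpret I: ideal I P using assms by (simp add: basis_ideal_def)
  note eq = P.quotient_eq_iff_same_a_r_cos[OF I.is_ideal, symmetric]
  have "(\<lambda>p. I +>\<^bsub>P\<^esub> p) ` carrier P = carrier (P Quot I)"
    unfolding FactRing_simps by auto
  then show "hilb_point n \<Delta> R (P Quot I) (\<lambda>p. I +>\<^bsub>P\<^esub> p)"
    by (rule hilb_pointI[OF assms I.quotient_is_cring[OF P.is_cring] I.rcos_ring_hom _ eq])
  have "p \<in> I" if "p \<in> carrier P" "I +>\<^bsub>P\<^esub> p = I" for p
    using I.rcos_const_imp_mem that by blast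
  then have "p \<in> carrier P \<and> I +>\<^bsub>P\<^esub> p = I \<longleftrightarrow> p \<in> I" for p
    using P.a_rcos_zero[OF I.is_ideal, of p] I.Icarr[of p] by fast
  moreover have "\<zero>\<^bsub>P Quot I\<^esub> = I" by (simp add: FactRing_def)
  ultimately show "a_kernel P (P Quot I) (\<lambda>p. I +>\<^bsub>P\<^esub> p) = I"
    unfolding a_kernel_def' by simp
qed

end

text \<open>Removes the quantified target and map from the functor. The quotient by I itself serves
  as target, and its elements have the type fixed in \<open>Hilb\<close>.\<close>

lemma hilb_ring_Hilb:
  fixes B :: "'b ring"
  assumes "hilb_ring n \<Delta> M B"
  shows "I \<in> Hilb n \<Delta> B \<longleftrightarrow> basis_ideal n \<Delta> B I"
proof -
  interpret hilb_ring n \<Delta> M B by fact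
  show ?thesis
  proof
    assume "I \<in> Hilb n \<Delta> B"
    then obtain Q :: "(expo \<Rightarrow> 'b) set ring" and \<phi> where Q: "hilb_point n \<Delta> B Q \<phi>" "I = a_kernel P Q \<phi>"
      unfolding Hilb_def by blast
    show "basis_ideal n \<Delta> B I" unfolding Q(2) by (rule hilb_point_basis_ideal[OF Q(1)])
  next
    assume I: "basis_ideal n \<Delta> B I"
    show "I \<in> Hilb n \<Delta> B"
      unfolding Hilb_def mem_Collect_eq
      by (intro exI conjI) (rule basis_ideal_hilb_point(2)[OF I, symmetric], rule basis_ideal_hilb_point(1)[OF I])
  qed
qed

section \<open>Families of structure constants\<close>

context hilb_ring
begin

text \<open>D records where the remainder lives: all of \<Delta> for spanning, the part of \<Delta>
  below an exponent for arguments with the monomial order.\<close>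

definition reducible :: "(expo \<Rightarrow> 'a) set \<Rightarrow> expo set \<Rightarrow> (expo \<Rightarrow> 'a) set" where
  "reducible J D = {p \<in> carrier P. \<exists>r\<in>carrier P. {m. r m \<noteq> \<zero>} \<subseteq> D \<and> p \<ominus>\<^bsub>P\<^esub> r \<in> J}"

lemma reducibleI:
  "p \<in> carrier P \<Longrightarrow> r \<in> carrier P \<Longrightarrow> (\<And>m. r m \<noteq> \<zero> \<Longrightarrow> m \<in> D) \<Longrightarrow> p \<ominus>\<^bsub>P\<^esub> r \<in> J \<Longrightarrow> p \<in> reducible J D"
  unfolding reducible_def by blast

lemma reducibleE:
  assumes "p \<in> reducible J D"
  obtains r where "p \<in> carrier P" "r \<in> carrier P" "\<And>m. r m \<noteq> \<zero> \<Longrightarrow> m \<in> D" "p \<ominus>\<^bsub>P\<^esub> r \<in> J"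
  using assms unfolding reducible_def by blast

lemma reducible_mono: "p \<in> reducible J D \<Longrightarrow> D \<subseteq> D' \<Longrightarrow> p \<in> reducible J D'"
  unfolding reducible_def by blast

lemma mconst_mult_apply:
  "c \<in> carrier R \<Longrightarrow> p \<in> carrier P \<Longrightarrow> (mconst R c \<otimes>\<^bsub>P\<^esub> p) m = c \<otimes> p m"
  using mterm_mult_apply[of c p 0 m] by (simp add: mconst_def)

lemma mult_mpower_support:
  assumes r: "r \<in> carrier P" and a: "a \<in> expos n" and m: "(mpower R a \<otimes>\<^bsub>P\<^esub> r) m \<noteq> \<zero>"
  obtains m' where "m = a + m'" "r m' \<noteq> \<zero>"
proof -
  obtain m' where m': "m = a + m'"
    using mterm_mult_apply_0[OF r, of m a \<one>] m unfolding mpower_def by blast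
  then have "r m' \<noteq> \<zero>" using m r mterm_mult_apply[of \<one> r a m'] by (auto simp: mpower_def)
  with m' show thesis by (rule that)
qed

context
  fixes J assumes J: "ideal J P"
begin

interpretation J: ideal J P by (rule J)

lemma reducible_self:
  assumes "p \<in> carrier P" "\<And>m. p m \<noteq> \<zero> \<Longrightarrow> m \<in> D" shows "p \<in> reducible J D"
  using assms by (intro reducibleI[of p p]) (auto simp: P.minus_eq P.r_neg)

lemma reducible_add:
  assumes "p \<in> reducible J D" "q \<in> reducible J D" shows "p \<oplus>\<^bsub>P\<^esub> q \<in> reducible J D"
proof -
  obtain r where r: "p \<in> carrier P" "r \<in> carrier P" "\<And>m. r m \<noteq> \<zero> \<Longrightarrow> m \<in> D" "p \<ominus>\<^bsub>P\<^esub> r \<in> J"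
    using assms(1) by (rule reducibleE) blast
  obtain s where s: "q \<in> carrier P" "s \<in> carrier P" "\<And>m. s m \<noteq> \<zero> \<Longrightarrow> m \<in> D" "q \<ominus>\<^bsub>P\<^esub> s \<in> J"
    using assms(2) by (rule reducibleE) blast
  show ?thesis
  proof (rule reducibleI[of _ "r \<oplus>\<^bsub>P\<^esub> s"])
    have "(p \<ominus>\<^bsub>P\<^esub> r) \<oplus>\<^bsub>P\<^esub> (q \<ominus>\<^bsub>P\<^esub> s) \<in> J" using r s by auto
    also have "(p \<ominus>\<^bsub>P\<^esub> r) \<oplus>\<^bsub>P\<^esub> (q \<ominus>\<^bsub>P\<^esub> s) = (p \<oplus>\<^bsub>P\<^esub> q) \<ominus>\<^bsub>P\<^esub> (r \<oplus>\<^bsub>P\<^esub> s)"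
      using r s by (simp add: P.minus_eq P.minus_add P.a_ac)
    finally show "(p \<oplus>\<^bsub>P\<^esub> q) \<ominus>\<^bsub>P\<^esub> (r \<oplus>\<^bsub>P\<^esub> s) \<in> J" .
    fix m assume "(r \<oplus>\<^bsub>P\<^esub> s) m \<noteq> \<zero>"
    then have "r m \<noteq> \<zero> \<or> s m \<noteq> \<zero>" by (auto simp: P_add_apply)
    then show "m \<in> D" using r(3) s(3) by blast
  qed (use r s in auto)
qed

lemma reducible_const_mult:
  assumes c: "c \<in> carrier R" and p: "p \<in> reducible J D"
  shows "mconst R c \<otimes>\<^bsub>P\<^esub> p \<in> reducible J D"
proof -
  obtain r where r: "p \<in> carrier P" "r \<in> carrier P" "\<And>m. r m \<noteq> \<zero> \<Longrightarrow> m \<in> D" "p \<ominus>\<^bsub>P\<^esub> r \<in> J"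
    using p by (rule reducibleE) blast
  show ?thesis
  proof (rule reducibleI[of _ "mconst R c \<otimes>\<^bsub>P\<^esub> r"])
    have "mconst R c \<otimes>\<^bsub>P\<^esub> (p \<ominus>\<^bsub>P\<^esub> r) \<in> J" using r c by (simp add: J.I_l_closed)
    also have "mconst R c \<otimes>\<^bsub>P\<^esub> (p \<ominus>\<^bsub>P\<^esub> r) = mconst R c \<otimes>\<^bsub>P\<^esub> p \<ominus>\<^bsub>P\<^esub> mconst R c \<otimes>\<^bsub>P\<^esub> r"
      using r c by (simp add: P.minus_eq P.r_distr P.r_minus)
    finally show "mconst R c \<otimes>\<^bsub>P\<^esub> p \<ominus>\<^bsub>P\<^esub> mconst R c \<otimes>\<^bsub>P\<^esub> r \<in> J" .
    fix m assume "(mconst R c \<otimes>\<^bsub>P\<^esub> r) m \<noteq> \<zero>"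
    then have "r m \<noteq> \<zero>" using c r by (auto simp: mconst_mult_apply)
    then show "m \<in> D" using r(3) by blast
  qed (use r c in auto)
qed

lemma reducible_cong:
  assumes "p \<in> carrier P" "q \<in> reducible J D" "p \<ominus>\<^bsub>P\<^esub> q \<in> J"
  shows "p \<in> reducible J D"
proof -
  obtain r where r: "q \<in> carrier P" "r \<in> carrier P" "\<And>m. r m \<noteq> \<zero> \<Longrightarrow> m \<in> D" "q \<ominus>\<^bsub>P\<^esub> r \<in> J"
    using assms(2) by (rule reducibleE) blast
  have "(p \<ominus>\<^bsub>P\<^esub> q) \<oplus>\<^bsub>P\<^esub> (q \<ominus>\<^bsub>P\<^esub> r) \<in> J" using r assms by auto
  also have "(p \<ominus>\<^bsub>P\<^esub> q) \<oplus>\<^bsub>P\<^esub> (q \<ominus>\<^bsub>P\<^esub> r) = p \<ominus>\<^bsub>P\<^esub> r"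
    using r assms(1) by (simp add: P.minus_eq P.a_assoc P.r_neg1)
  finally show ?thesis using r assms(1) by (intro reducibleI[of p r])
qed

lemma reducible_poly:
  assumes q: "q \<in> carrier P" and mono: "\<And>m. q m \<noteq> \<zero> \<Longrightarrow> mpower R m \<in> reducible J D"
  shows "q \<in> reducible J D"
proof -
  let ?F = "{m. q m \<noteq> \<zero>}"
  have fin: "finite ?F" and F: "?F \<subseteq> expos n"
    using q finite_support coeff_outside by blast+
  have *: "(\<Oplus>\<^bsub>P\<^esub>m\<in>F. mterm R (q m) m) \<in> reducible J D" if "F \<subseteq> ?F" for F
    using finite_subset[OF that fin] that
  proof (induction F)
    case empty
    show ?case unfolding P.finsum_empty
      by (rule reducible_self) (rule P.zero_closed, simp add: P_zero_apply)
  next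
    case (insert a F)
    have "mterm R (q a) a \<in> reducible J D"
      using reducible_const_mult[of "q a" "mpower R a"] mono[of a] q insert F
      by (subst mterm_eq) auto
    then show ?case using insert q F by (subst P.finsum_insert) (auto intro!: reducible_add)
  qed
  have "(\<Oplus>\<^bsub>P\<^esub>m\<in>?F. mterm R (q m) m) = (\<lambda>m. if m \<in> ?F then q m else \<zero>)"
    by (rule finsum_mterm[OF fin F]) (use q in simp)
  also have "\<dots> = q" by (rule ext) simp
  finally show ?thesis using *[OF subset_refl] by (simp only:)
qed

text \<open>Modulo J, x^a p agrees with x^a r for a remainder r of p, and the exponents of x^a r
  have the form a + \<gamma> with \<gamma> in D. The sets D and D' may differ, so that remainders
  can be confined below a growing bound.\<close>

lemma reducible_mpower_mult:
  assumes a: "a \<in> expos n" and p: "p \<in> reducible J D"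
    and D: "\<And>\<gamma>. \<gamma> \<in> D \<Longrightarrow> mpower R (a + \<gamma>) \<in> reducible J D'"
  shows "mpower R a \<otimes>\<^bsub>P\<^esub> p \<in> reducible J D'"
proof -
  obtain r where r: "p \<in> carrier P" "r \<in> carrier P" "\<And>m. r m \<noteq> \<zero> \<Longrightarrow> m \<in> D" "p \<ominus>\<^bsub>P\<^esub> r \<in> J"
    using p by (rule reducibleE) blast
  show ?thesis
  proof (rule reducible_cong[of _ "mpower R a \<otimes>\<^bsub>P\<^esub> r"])
    have "mpower R a \<otimes>\<^bsub>P\<^esub> (p \<ominus>\<^bsub>P\<^esub> r) \<in> J" using r a by (simp add: J.I_l_closed)
    also have "mpower R a \<otimes>\<^bsub>P\<^esub> (p \<ominus>\<^bsub>P\<^esub> r) = mpower R a \<otimes>\<^bsub>P\<^esub> p \<ominus>\<^bsub>P\<^esub> mpower R a \<otimes>\<^bsub>P\<^esub> r"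
      using r a by (simp add: P.minus_eq P.r_distr P.r_minus)
    finally show "mpower R a \<otimes>\<^bsub>P\<^esub> p \<ominus>\<^bsub>P\<^esub> mpower R a \<otimes>\<^bsub>P\<^esub> r \<in> J" .
    show "mpower R a \<otimes>\<^bsub>P\<^esub> r \<in> reducible J D'"
    proof (rule reducible_poly)
      fix m assume "(mpower R a \<otimes>\<^bsub>P\<^esub> r) m \<noteq> \<zero>"
      then obtain m' where "m = a + m'" "r m' \<noteq> \<zero>" using mult_mpower_support[OF r(2) a] by blast
      then show "mpower R m \<in> reducible J D'" using D r(3) by simp
    qed (use r a in auto)
  qed (use r a in auto)
qed

text \<open>A variable applied to a remainder supported in \<Delta> produces one-step shifts of
  \<Delta>, which reduce by assumption. Induction on monomials does the rest.\<close>

lemma reducible_all: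
  assumes step: "\<And>\<gamma> i. \<gamma> \<in> \<Delta> \<Longrightarrow> i < n \<Longrightarrow> mpower R (\<gamma> + unit_expo i) \<in> reducible J \<Delta>"
    and p: "p \<in> carrier P"
  shows "p \<in> reducible J \<Delta>"
proof (rule reducible_poly[OF p])
  fix m assume "p m \<noteq> \<zero>"
  then have "m \<in> expos n" using p coeff_outside by blast
  then show "mpower R m \<in> reducible J \<Delta>"
  proof (induction rule: monomials_induct)
    case zero
    show ?case using zero_\<Delta>
      by (intro reducible_self mpower_closed) (auto simp: mpower_def mterm_apply split: if_splits)
  next
    case (add m i)
    have "mpower R (m + Poly_Mapping.single i 1) = mpower R (unit_expo i) \<otimes>\<^bsub>P\<^esub> mpower R m"
      using add mpower_add[of m "unit_expo i"] by (simp add: unit_expo_def add.commute)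
    also have "\<dots> \<in> reducible J \<Delta>"
      by (rule reducible_mpower_mult) (use add step in \<open>auto simp: unit_expo_expos ab_semigroup_add_class.add.commute\<close>)
    finally show ?case .
  qed
qed

lemma reducible_rewrite_poly:
  assumes "D \<subseteq> \<Delta>" "\<And>\<beta>. \<beta> \<in> D \<Longrightarrow> T \<alpha> \<beta> \<in> carrier R" "\<alpha> \<in> expos n"
    "rewrite_poly n R D T \<alpha> \<in> J"
  shows "mpower R \<alpha> \<in> reducible J D"
  using assms rewrite_poly_trunc[of D T \<alpha>] trunc_closed[of D "T \<alpha>"]
  by (intro reducibleI[of _ "trunc D (T \<alpha>)"]) (auto simp: trunc_def split: if_splits)

lemma basis_idealI:
  assumes "\<And>\<gamma> i. \<gamma> \<in> \<Delta> \<Longrightarrow> i < n \<Longrightarrow> mpower R (\<gamma> + unit_expo i) \<in> reducible J \<Delta>"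
    and "\<And>r. r \<in> J \<Longrightarrow> {m. r m \<noteq> \<zero>} \<subseteq> \<Delta> \<Longrightarrow> r = \<zero>\<^bsub>P\<^esub>"
  shows "basis_ideal n \<Delta> R J"
  unfolding basis_ideal_def using J reducible_all[OF assms(1)] assms(2)
  unfolding reducible_def by blast

end

end

section \<open>Commuting operators on coordinate vectors\<close>

text \<open>The operator of a monomial, with the directions taken in a fixed order, the largest one
  acting first. Operators are total functions, so that the laws of an action are equations between
  functions.\<close>

primrec iterate_dirs :: "(nat \<Rightarrow> 'r \<Rightarrow> 'r) \<Rightarrow> nat \<Rightarrow> expo \<Rightarrow> 'r \<Rightarrow> 'r" where
  "iterate_dirs A 0 \<alpha> = id"
| "iterate_dirs A (Suc k) \<alpha> = iterate_dirs A k \<alpha> \<circ> (A k ^^ Poly_Mapping.lookup \<alpha> k)"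

lemma funpow_commute:
  assumes "f \<circ> g = g \<circ> f" shows "(f ^^ a) \<circ> g = g \<circ> (f ^^ a)"
proof (induction a)
  case (Suc a)
  then show ?case using assms by (simp add: fun_eq_iff)
qed simp

lemma iterate_dirs_commute:
  assumes "\<And>i. f \<circ> A i = A i \<circ> f"
  shows "f \<circ> iterate_dirs A k \<alpha> = iterate_dirs A k \<alpha> \<circ> f"
proof (induction k)
  case (Suc k)
  have "f \<circ> (A k ^^ Poly_Mapping.lookup \<alpha> k) = (A k ^^ Poly_Mapping.lookup \<alpha> k) \<circ> f"
    using funpow_commute[of "A k" f] assms by metis
  then show ?case using Suc by (simp add: fun_eq_iff)
qed simp

text \<open>Commuting operators give an action of the monoid of exponents. The powers of the k-th
  operator for \<alpha> have to be moved past the operators of smaller index for \<beta>.\<close>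

lemma iterate_dirs_add:
  assumes comm: "\<And>i j. A i \<circ> A j = A j \<circ> A i"
  shows "iterate_dirs A k (\<alpha> + \<beta>) = iterate_dirs A k \<alpha> \<circ> iterate_dirs A k \<beta>"
proof (induction k)
  case (Suc k)
  let ?f = "A k ^^ Poly_Mapping.lookup \<alpha> k"
  have "?f \<circ> A i = A i \<circ> ?f" for i using funpow_commute comm by metis
  then have "?f \<circ> iterate_dirs A k \<beta> = iterate_dirs A k \<beta> \<circ> ?f" by (rule iterate_dirs_commute)
  then show ?case using Suc by (simp add: lookup_add funpow_add fun_eq_iff)
qed simp

lemma iterate_dirs_zero: "iterate_dirs A k 0 = id"
  by (induction k) auto

lemma iterate_dirs_unit: "iterate_dirs A k (unit_expo i) = (if i < k then A i else id)"
  by (induction k) (auto simp: unit_expo_def lookup_single when_def less_Suc_eq fun_eq_iff)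

locale mult_family_ring = hilb_ring +
  fixes T :: "expo \<Rightarrow> expo \<Rightarrow> 'a"
  assumes family: "mult_family n \<Delta> M R T"
begin

lemma T_closed [simp]: "\<alpha> \<in> M \<Longrightarrow> \<beta> \<in> \<Delta> \<Longrightarrow> T \<alpha> \<beta> \<in> carrier R"
  using family by (simp add: mult_family_def)

lemma T_delta: "\<alpha> \<in> \<Delta> \<Longrightarrow> \<beta> \<in> \<Delta> \<Longrightarrow> T \<alpha> \<beta> = (if \<alpha> = \<beta> then \<one> else \<zero>)"
  using family unfolding mult_family_def by blast

lemma T_step: "\<alpha> \<in> M \<Longrightarrow> i < n \<Longrightarrow> \<alpha> + unit_expo i \<in> M \<Longrightarrow> \<beta> \<in> \<Delta> \<Longrightarrow>
    T (\<alpha> + unit_expo i) \<beta> = (\<Oplus>\<gamma>\<in>\<Delta>. T \<alpha> \<gamma> \<otimes> T (\<gamma> + unit_expo i) \<beta>)"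
  using family unfolding mult_family_def shift_sum_def by blast

lemma T_comm: "\<alpha> \<in> \<Delta> \<Longrightarrow> i < n \<Longrightarrow> j < n \<Longrightarrow> \<beta> \<in> \<Delta> \<Longrightarrow>
    (\<Oplus>\<gamma>\<in>\<Delta>. T (\<alpha> + unit_expo i) \<gamma> \<otimes> T (\<gamma> + unit_expo j) \<beta>) =
    (\<Oplus>\<gamma>\<in>\<Delta>. T (\<alpha> + unit_expo j) \<gamma> \<otimes> T (\<gamma> + unit_expo i) \<beta>)"
  using family unfolding mult_family_def shift_sum_def by blast

text \<open>Multiplication by \<open>x\<^sub>i\<close> on coordinate vectors with respect to \<open>\<Delta>\<close>. The junk case makes these maps
  commute unconditionally.\<close>

definition act :: "nat \<Rightarrow> (expo \<Rightarrow> 'a) \<Rightarrow> expo \<Rightarrow> 'a" where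
  "act i r = (if i < n \<and> (\<forall>\<delta>. r \<delta> \<in> carrier R)
    then trunc \<Delta> (\<lambda>\<beta>. \<Oplus>\<gamma>\<in>\<Delta>. r \<gamma> \<otimes> T (\<gamma> + unit_expo i) \<beta>) else r)"

lemma act_closed: "(\<forall>\<delta>. r \<delta> \<in> carrier R) \<Longrightarrow> act i r \<delta> \<in> carrier R"
  unfolding act_def trunc_def using \<Delta>_step by (auto intro!: finsum_closed)

lemma act_apply: "(\<forall>\<delta>. r \<delta> \<in> carrier R) \<Longrightarrow> i < n \<Longrightarrow> \<beta> \<in> \<Delta> \<Longrightarrow>
    act i r \<beta> = (\<Oplus>\<gamma>\<in>\<Delta>. r \<gamma> \<otimes> T (\<gamma> + unit_expo i) \<beta>)"
  by (simp add: act_def trunc_def)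

text \<open>The double sum is exchanged so that the inner sum becomes an entry of the product of two
  multiplication matrices, to which \<open>T_comm\<close> applies.\<close>

lemma act_act:
  assumes r: "\<forall>\<delta>. r \<delta> \<in> carrier R" and i: "i < n" and j: "j < n" and \<beta>: "\<beta> \<in> \<Delta>"
  shows "act j (act i r) \<beta> = (\<Oplus>\<delta>\<in>\<Delta>. r \<delta> \<otimes> (\<Oplus>\<gamma>\<in>\<Delta>. T (\<delta> + unit_expo i) \<gamma> \<otimes> T (\<gamma> + unit_expo j) \<beta>))"
proof -
  have "act j (act i r) \<beta> = (\<Oplus>\<gamma>\<in>\<Delta>. act i r \<gamma> \<otimes> T (\<gamma> + unit_expo j) \<beta>)"
    using act_closed[OF r] j \<beta> by (intro act_apply) auto
  also have "\<dots> = (\<Oplus>\<gamma>\<in>\<Delta>. \<Oplus>\<delta>\<in>\<Delta>. r \<delta> \<otimes> (T (\<delta> + unit_expo i) \<gamma> \<otimes> T (\<gamma> + unit_expo j) \<beta>))"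
  proof (rule finsum_cong')
    fix \<gamma> assume \<gamma>: "\<gamma> \<in> \<Delta>"
    have "act i r \<gamma> \<otimes> T (\<gamma> + unit_expo j) \<beta> = (\<Oplus>\<delta>\<in>\<Delta>. r \<delta> \<otimes> T (\<delta> + unit_expo i) \<gamma> \<otimes> T (\<gamma> + unit_expo j) \<beta>)"
      unfolding act_apply[OF r i \<gamma>]
      by (rule finsum_ldistr) (use finite_\<Delta> r i j \<beta> \<gamma> \<Delta>_step in auto)
    also have "\<dots> = (\<Oplus>\<delta>\<in>\<Delta>. r \<delta> \<otimes> (T (\<delta> + unit_expo i) \<gamma> \<otimes> T (\<gamma> + unit_expo j) \<beta>))"
      by (rule finsum_cong') (use r i j \<beta> \<gamma> \<Delta>_step in \<open>auto simp: m_assoc\<close>)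
    finally show "act i r \<gamma> \<otimes> T (\<gamma> + unit_expo j) \<beta> =
        (\<Oplus>\<delta>\<in>\<Delta>. r \<delta> \<otimes> (T (\<delta> + unit_expo i) \<gamma> \<otimes> T (\<gamma> + unit_expo j) \<beta>))" .
  qed (use r i j \<beta> \<Delta>_step in \<open>auto intro!: finsum_closed\<close>)
  also have "\<dots> = (\<Oplus>\<delta>\<in>\<Delta>. \<Oplus>\<gamma>\<in>\<Delta>. r \<delta> \<otimes> (T (\<delta> + unit_expo i) \<gamma> \<otimes> T (\<gamma> + unit_expo j) \<beta>))"
    by (rule finsum_swap) (use finite_\<Delta> r i j \<beta> \<Delta>_step in auto)
  also have "\<dots> = (\<Oplus>\<delta>\<in>\<Delta>. r \<delta> \<otimes> (\<Oplus>\<gamma>\<in>\<Delta>. T (\<delta> + unit_expo i) \<gamma> \<otimes> T (\<gamma> + unit_expo j) \<beta>))"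
    by (rule finsum_cong') (use finite_\<Delta> r i j \<beta> \<Delta>_step in \<open>auto intro!: finsum_rdistr[symmetric] finsum_closed\<close>)
  finally show ?thesis .
qed

lemma act_commute: "act i \<circ> act j = act j \<circ> act i"
proof
  fix r :: "expo \<Rightarrow> 'a"
  show "(act i \<circ> act j) r = (act j \<circ> act i) r"
  proof (cases "i < n \<and> j < n \<and> (\<forall>\<delta>. r \<delta> \<in> carrier R)")
    case True
    then have r: "\<forall>\<delta>. r \<delta> \<in> carrier R" and i: "i < n" and j: "j < n" by auto
    have "act i (act j r) \<beta> = act j (act i r) \<beta>" for \<beta>
    proof (cases "\<beta> \<in> \<Delta>")
      case True
      have "act i (act j r) \<beta> = (\<Oplus>\<delta>\<in>\<Delta>. r \<delta> \<otimes> (\<Oplus>\<gamma>\<in>\<Delta>. T (\<delta> + unit_expo j) \<gamma> \<otimes> T (\<gamma> + unit_expo i) \<beta>))"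
        by (rule act_act[OF r j i True])
      also have "\<dots> = (\<Oplus>\<delta>\<in>\<Delta>. r \<delta> \<otimes> (\<Oplus>\<gamma>\<in>\<Delta>. T (\<delta> + unit_expo i) \<gamma> \<otimes> T (\<gamma> + unit_expo j) \<beta>))"
        by (rule finsum_cong') (use r i j True \<Delta>_step T_comm[of _ j i \<beta>] in \<open>auto intro!: finsum_closed\<close>)
      also have "\<dots> = act j (act i r) \<beta>" by (rule act_act[OF r i j True, symmetric])
      finally show ?thesis .
    next
      case False
      \<comment> \<open>Outside of \<Delta> the truncation in \<open>act\<close> makes both sides
        vanish.\<close>
      have "act k s \<beta> = \<zero>" if "k < n" "\<forall>\<delta>. s \<delta> \<in> carrier R" for k s
        using that False by (simp add: act_def trunc_def)
      then show ?thesis using act_closed[OF r] i j by simp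
    qed
    then show ?thesis by (simp add: fun_eq_iff)
  next
    case False
    \<comment> \<open>An operator with a direction out of range is the identity, and every operator
      fixes a vector with some value outside of the carrier.\<close>
    show ?thesis
    proof (cases "\<forall>\<delta>. r \<delta> \<in> carrier R")
      case True
      then have "\<not> i < n \<or> \<not> j < n" using False by blast
      then show ?thesis by (auto simp: act_def)
    next
      case no: False
      have "act k r = r" for k unfolding act_def using no by metis
      then show ?thesis by simp
    qed
  qed
qed

section \<open>Coordinates of monomials and the kernel they define\<close>

definition nf :: "expo \<Rightarrow> expo \<Rightarrow> 'a" where
  "nf \<alpha> = iterate_dirs act n \<alpha> (\<lambda>\<beta>. if \<beta> = 0 then \<one> else \<zero>)"

lemma nf_zero: "nf 0 = (\<lambda>\<beta>. if \<beta> = 0 then \<one> else \<zero>)"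
  by (simp add: nf_def iterate_dirs_zero)

lemma nf_step: "i < n \<Longrightarrow> nf (unit_expo i + \<alpha>) = act i (nf \<alpha>)"
  by (simp add: nf_def iterate_dirs_add[OF act_commute] iterate_dirs_unit)

lemma nf_closed: "\<alpha> \<in> expos n \<Longrightarrow> \<forall>\<beta>. nf \<alpha> \<beta> \<in> carrier R"
proof (induction rule: monomials_induct)
  case (add m i)
  then show ?case using nf_step[of i m] act_closed[of "nf m" i]
    by (simp add: unit_expo_def add.commute ab_semigroup_add_class.add.commute)
qed (simp add: nf_zero)

lemma nf_apply:
  "\<alpha> \<in> expos n \<Longrightarrow> i < n \<Longrightarrow> \<beta> \<in> \<Delta> \<Longrightarrow>
    nf (unit_expo i + \<alpha>) \<beta> = (\<Oplus>\<gamma>\<in>\<Delta>. nf \<alpha> \<gamma> \<otimes> T (\<gamma> + unit_expo i) \<beta>)"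
  using nf_closed by (simp add: nf_step act_apply)

text \<open>Induction on monomials stays within M because M contains the divisors of its elements.
  It starts with T being the identity at 0, and each step is the recursion
  \<open>T_step\<close>.\<close>

lemma nf_eq_T:
  assumes "\<alpha> \<in> M" "\<beta> \<in> \<Delta>" shows "nf \<alpha> \<beta> = T \<alpha> \<beta>"
proof -
  have "\<alpha> \<in> expos n" using assms M_expos by blast
  then show ?thesis using assms
  proof (induction arbitrary: \<beta> rule: monomials_induct)
    case zero
    then show ?case using zero_\<Delta> T_delta[of 0 \<beta>] by (auto simp: nf_zero)
  next
    case (add m i)
    have i: "i < n" using add by simp
    have mM: "m \<in> M"
      using M_down[of m "Poly_Mapping.single i 1"] add unit_expo_expos[of i n] by (simp add: unit_expo_def)
    have "nf (m + Poly_Mapping.single i 1) \<beta> = (\<Oplus>\<gamma>\<in>\<Delta>. nf m \<gamma> \<otimes> T (\<gamma> + unit_expo i) \<beta>)"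
      using nf_apply[of m i \<beta>] add i by (simp add: unit_expo_def ab_semigroup_add_class.add.commute)
    also have "\<dots> = (\<Oplus>\<gamma>\<in>\<Delta>. T m \<gamma> \<otimes> T (\<gamma> + unit_expo i) \<beta>)"
      by (rule finsum_cong') (use add mM i \<Delta>_step in auto)
    also have "\<dots> = T (m + unit_expo i) \<beta>"
      using T_step[of m i \<beta>] mM i add by (simp add: unit_expo_def)
    finally show ?case by (simp add: unit_expo_def)
  qed
qed

text \<open>One scalar functional for each \<beta> in \<Delta>, in place of one map into a free
  module: the target of \<open>lin_ext\<close> is then R itself.\<close>

abbreviation nf_coeff :: "expo \<Rightarrow> (expo \<Rightarrow> 'a) \<Rightarrow> 'a" where
  "nf_coeff \<beta> \<equiv> lin_ext R R id (\<lambda>\<alpha>. nf \<alpha> \<beta>)"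

lemma nf_lin: "mpoly_lin R {..<n} R id (\<lambda>\<alpha>. nf \<alpha> \<beta>)"
  using nf_closed by unfold_locales (auto intro: ring_hom_memI)

lemmas nf_coeff_add = mpoly_lin.lin_ext_add[OF nf_lin]
  and nf_coeff_closed = mpoly_lin.lin_ext_closed[OF nf_lin]
  and nf_coeff_superset = mpoly_lin.lin_ext_superset[OF nf_lin]
  and nf_coeff_mterm = mpoly_lin.lin_ext_mterm[OF nf_lin]
  and nf_coeff_mterm_mult = mpoly_lin.lin_ext_mterm_mult[OF nf_lin]

definition nf_ker :: "(expo \<Rightarrow> 'a) set" where
  "nf_ker = {p \<in> carrier P. \<forall>\<beta>\<in>\<Delta>. nf_coeff \<beta> p = \<zero>}"

text \<open>The row of coordinates of x_i p is the row of p times the i-th multiplication matrix, by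
  exchanging the sums over \<Delta> and over the support of p. So it vanishes along with the row of
  p.\<close>

lemma nf_ker_var_mult:
  assumes p: "p \<in> nf_ker" and i: "i < n"
  shows "mpower R (unit_expo i) \<otimes>\<^bsub>P\<^esub> p \<in> nf_ker"
proof -
  have pc: "p \<in> carrier P" using p by (simp add: nf_ker_def)
  let ?F = "{m. p m \<noteq> \<zero>}"
  have F: "finite ?F" "\<And>m. p m \<noteq> \<zero> \<Longrightarrow> m \<in> expos n" using pc coeff_outside finite_support by blast+
  have nfc: "nf m \<gamma> \<in> carrier R" if "p m \<noteq> \<zero>" for m \<gamma> using nf_closed F(2) that by blast
  have "nf_coeff \<beta> (mpower R (unit_expo i) \<otimes>\<^bsub>P\<^esub> p) = \<zero>" if \<beta>: "\<beta> \<in> \<Delta>" for \<beta>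
  proof -
    have Tc: "T (\<gamma> + unit_expo i) \<beta> \<in> carrier R" if "\<gamma> \<in> \<Delta>" for \<gamma> using that \<Delta>_step i \<beta> by simp
    have "nf_coeff \<beta> (mpower R (unit_expo i) \<otimes>\<^bsub>P\<^esub> p)
        = \<one> \<otimes> lin_ext R R id (\<lambda>m. nf (unit_expo i + m) \<beta>) p"
      unfolding mpower_def using nf_coeff_mterm_mult[of \<one> "unit_expo i" p \<beta>] pc i
      by (simp add: unit_expo_expos)
    also have "lin_ext R R id (\<lambda>m. nf (unit_expo i + m) \<beta>) p
        = (\<Oplus>m\<in>?F. \<Oplus>\<gamma>\<in>\<Delta>. p m \<otimes> nf m \<gamma> \<otimes> T (\<gamma> + unit_expo i) \<beta>)"
      unfolding lin_ext_def id_apply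
    proof (rule finsum_cong')
      fix m assume "m \<in> ?F"
      then have m: "p m \<noteq> \<zero>" "m \<in> expos n" using F by auto
      have "p m \<otimes> nf (unit_expo i + m) \<beta> = (\<Oplus>\<gamma>\<in>\<Delta>. p m \<otimes> (nf m \<gamma> \<otimes> T (\<gamma> + unit_expo i) \<beta>))"
        unfolding nf_apply[OF m(2) i \<beta>]
        by (rule finsum_rdistr) (use finite_\<Delta> pc nfc[OF m(1)] Tc in auto)
      also have "\<dots> = (\<Oplus>\<gamma>\<in>\<Delta>. p m \<otimes> nf m \<gamma> \<otimes> T (\<gamma> + unit_expo i) \<beta>)"
        by (rule finsum_cong') (use pc nfc[OF m(1)] Tc in \<open>auto simp: m_assoc\<close>)
      finally show "p m \<otimes> nf (unit_expo i + m) \<beta> = (\<Oplus>\<gamma>\<in>\<Delta>. p m \<otimes> nf m \<gamma> \<otimes> T (\<gamma> + unit_expo i) \<beta>)" .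
    qed (use pc nfc Tc in \<open>auto intro!: finsum_closed\<close>)
    also have "\<dots> = (\<Oplus>\<gamma>\<in>\<Delta>. \<Oplus>m\<in>?F. p m \<otimes> nf m \<gamma> \<otimes> T (\<gamma> + unit_expo i) \<beta>)"
      by (rule finsum_swap) (use pc nfc Tc finite_\<Delta> F in auto)
    also have "\<dots> = (\<Oplus>\<gamma>\<in>\<Delta>. nf_coeff \<gamma> p \<otimes> T (\<gamma> + unit_expo i) \<beta>)"
    proof (rule finsum_cong')
      fix \<gamma> assume \<gamma>: "\<gamma> \<in> \<Delta>"
      show "(\<Oplus>m\<in>?F. p m \<otimes> nf m \<gamma> \<otimes> T (\<gamma> + unit_expo i) \<beta>) = nf_coeff \<gamma> p \<otimes> T (\<gamma> + unit_expo i) \<beta>"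
        unfolding lin_ext_def id_apply
        by (rule finsum_ldistr[symmetric]) (use pc nfc Tc F \<gamma> in auto)
    qed (use nf_coeff_closed pc Tc in auto)
    also have "\<dots> = \<zero>"
      by (rule finsum_eq_zero) (use p Tc in \<open>auto simp: nf_ker_def\<close>)
    also have "\<one> \<otimes> \<zero> = \<zero>" by simp
    finally show ?thesis .
  qed
  then show ?thesis using pc i by (simp add: nf_ker_def unit_expo_expos)
qed

lemma nf_ker_add: "p \<in> nf_ker \<Longrightarrow> q \<in> nf_ker \<Longrightarrow> p \<oplus>\<^bsub>P\<^esub> q \<in> nf_ker"
  by (simp add: nf_ker_def nf_coeff_add)

lemma nf_ker_const_mult:
  assumes "p \<in> nf_ker" "c \<in> carrier R" shows "mconst R c \<otimes>\<^bsub>P\<^esub> p \<in> nf_ker"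
  using assms nf_coeff_mterm_mult[of c 0 p] by (auto simp: nf_ker_def mconst_def)

lemma nf_ker_mult:
  assumes p: "p \<in> nf_ker" and q: "q \<in> carrier P" shows "q \<otimes>\<^bsub>P\<^esub> p \<in> nf_ker"
proof -
  have pc: "p \<in> carrier P" using p by (simp add: nf_ker_def)
  have mono: "mpower R m \<otimes>\<^bsub>P\<^esub> p \<in> nf_ker" if "m \<in> expos n" for m
    using that
  proof (induction rule: monomials_induct)
    case zero
    then show ?case using p pc by (simp add: mpower_zero)
  next
    case (add m i)
    have "mpower R (m + Poly_Mapping.single i 1) = mpower R (unit_expo i) \<otimes>\<^bsub>P\<^esub> mpower R m"
      using add mpower_add[of m "unit_expo i"] by (simp add: unit_expo_def ab_semigroup_add_class.add.commute)
    then have "mpower R (m + Poly_Mapping.single i 1) \<otimes>\<^bsub>P\<^esub> p = mpower R (unit_expo i) \<otimes>\<^bsub>P\<^esub> (mpower R m \<otimes>\<^bsub>P\<^esub> p)"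
      using add pc by (simp add: P.m_assoc unit_expo_expos)
    then show ?case using nf_ker_var_mult[OF add(3)] add by simp
  qed
  show ?thesis using q
  proof (induction rule: mpoly_induct)
    case (mterm c m)
    have "mterm R c m \<otimes>\<^bsub>P\<^esub> p = mconst R c \<otimes>\<^bsub>P\<^esub> (mpower R m \<otimes>\<^bsub>P\<^esub> p)"
      using mterm pc by (simp add: mterm_eq P.m_assoc)
    then show ?case using nf_ker_const_mult[OF mono] mterm by simp
  next
    case (add q q')
    then show ?case using pc by (simp add: P.l_distr nf_ker_add)
  qed
qed

lemma nf_ker_ideal: "ideal nf_ker P"
proof (rule idealI)
  have sub: "nf_ker \<subseteq> carrier P" by (auto simp: nf_ker_def)
  have zero: "\<zero>\<^bsub>P\<^esub> \<in> nf_ker" by (simp add: nf_ker_def lin_ext_def P_zero_apply)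
  have neg: "\<ominus>\<^bsub>P\<^esub> p \<in> nf_ker" if "p \<in> nf_ker" for p
    using nf_ker_mult[OF that, of "\<ominus>\<^bsub>P\<^esub> \<one>\<^bsub>P\<^esub>"] that sub by (auto simp: P.l_minus)
  show "subgroup nf_ker (add_monoid P)"
    by (rule P.add.subgroupI) (use sub zero neg nf_ker_add in \<open>auto simp: a_inv_def\<close>)
  show "ring P" by (rule P.ring_axioms)
  show "q \<otimes>\<^bsub>P\<^esub> p \<in> nf_ker" if "p \<in> nf_ker" "q \<in> carrier P" for p q
    using nf_ker_mult that by blast
  show "p \<otimes>\<^bsub>P\<^esub> q \<in> nf_ker" if "p \<in> nf_ker" "q \<in> carrier P" for p q
    using nf_ker_mult[OF that] P.m_comm[of p q] that sub by auto
qed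

text \<open>Since T is the identity on \<Delta>, the functional reads off a coefficient.
  Independence modulo \<open>nf_ker\<close> rests on this.\<close>

lemma nf_coeff_basis:
  assumes r: "r \<in> carrier P" "{m. r m \<noteq> \<zero>} \<subseteq> \<Delta>" and \<beta>: "\<beta> \<in> \<Delta>"
  shows "nf_coeff \<beta> r = r \<beta>"
proof -
  have "nf_coeff \<beta> r = (\<Oplus>m\<in>\<Delta>. r m \<otimes> nf m \<beta>)"
    using nf_coeff_superset[OF r(1) finite_\<Delta> r(2) \<Delta>_expos] by simp
  also have "\<dots> = r \<beta> \<otimes> nf \<beta> \<beta>"
  proof (rule finsum_single)
    show "r m \<otimes> nf m \<beta> = \<zero>" if "m \<in> \<Delta>" "m \<noteq> \<beta>" for m
      using that \<beta> r \<Delta>_M by (subst nf_eq_T) (auto simp: T_delta)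
  qed (use \<beta> finite_\<Delta> r nf_closed \<Delta>_expos in auto)
  also have "\<dots> = r \<beta>" using \<beta> r \<Delta>_M by (subst nf_eq_T) (auto simp: T_delta)
  finally show ?thesis .
qed

text \<open>The monomial x^\<alpha> and the polynomial subtracted from it have the same coordinates,
  namely \<open>T \<alpha> \<beta>\<close>.\<close>

lemma rewrite_poly_nf_ker:
  assumes "\<alpha> \<in> M" shows "rewrite_poly n R \<Delta> T \<alpha> \<in> nf_ker"
proof -
  have \<alpha>: "\<alpha> \<in> expos n" using assms M_expos by blast
  have t: "trunc \<Delta> (T \<alpha>) \<in> carrier P" by (rule trunc_closed) (use assms in auto)
  have rw: "rewrite_poly n R \<Delta> T \<alpha> = mpower R \<alpha> \<ominus>\<^bsub>P\<^esub> trunc \<Delta> (T \<alpha>)"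
    by (rule rewrite_poly_trunc) (use assms in auto)
  have rc: "rewrite_poly n R \<Delta> T \<alpha> \<in> carrier P" unfolding rw using \<alpha> t by simp
  have "nf_coeff \<beta> (rewrite_poly n R \<Delta> T \<alpha>) = \<zero>" if \<beta>: "\<beta> \<in> \<Delta>" for \<beta>
  proof -
    have "mpower R \<alpha> = rewrite_poly n R \<Delta> T \<alpha> \<oplus>\<^bsub>P\<^esub> trunc \<Delta> (T \<alpha>)"
      unfolding rw using \<alpha> t by (simp add: P.minus_eq P.a_assoc P.l_neg)
    then have "nf_coeff \<beta> (mpower R \<alpha>) = nf_coeff \<beta> (rewrite_poly n R \<Delta> T \<alpha>) \<oplus> nf_coeff \<beta> (trunc \<Delta> (T \<alpha>))"
      using nf_coeff_add[OF rc t] by simp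
    moreover have "nf_coeff \<beta> (mpower R \<alpha>) = T \<alpha> \<beta>"
      using nf_coeff_mterm[of \<one> \<alpha> \<beta>] \<alpha> nf_eq_T assms \<beta> by (simp add: mpower_def)
    moreover have "{m. trunc \<Delta> (T \<alpha>) m \<noteq> \<zero>} \<subseteq> \<Delta>"
      by (auto simp: trunc_def)
    then have "nf_coeff \<beta> (trunc \<Delta> (T \<alpha>)) = T \<alpha> \<beta>"
      using nf_coeff_basis[OF t _ \<beta>] \<beta> by (simp add: trunc_def)
    ultimately show ?thesis using nf_coeff_closed[OF rc] assms \<beta>
      by (metis T_closed add.l_cancel_one a_comm)
  qed
  then show ?thesis using rc by (simp add: nf_ker_def)
qed

lemma idealU_gens: "rewrite_poly n R \<Delta> T ` M \<subseteq> carrier P"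
  using rewrite_poly_nf_ker by (auto simp: nf_ker_def)

lemma idealU_ideal: "ideal (idealU n \<Delta> M R T) P"
  unfolding idealU_def by (rule P.genideal_ideal[OF idealU_gens])

lemma idealU_gen: "\<alpha> \<in> M \<Longrightarrow> rewrite_poly n R \<Delta> T \<alpha> \<in> idealU n \<Delta> M R T"
  unfolding idealU_def using P.genideal_self[OF idealU_gens] by blast

lemma idealU_corresponds: "corresponds n \<Delta> M R T (idealU n \<Delta> M R T)"
  unfolding corresponds_def using idealU_gen by blast

lemma nf_ker_basis: "basis_ideal n \<Delta> R nf_ker"
proof (rule basis_idealI[OF nf_ker_ideal])
  show "mpower R (\<gamma> + unit_expo i) \<in> reducible nf_ker \<Delta>" if "\<gamma> \<in> \<Delta>" "i < n" for \<gamma> i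
    using that \<Delta>_step M_expos rewrite_poly_nf_ker
    by (intro reducible_rewrite_poly[OF nf_ker_ideal, of \<Delta> T]) auto
  fix r assume r: "r \<in> nf_ker" "{m. r m \<noteq> \<zero>} \<subseteq> \<Delta>"
  then have "r \<beta> = \<zero>" if "\<beta> \<in> \<Delta>" for \<beta>
    using that nf_coeff_basis[of r \<beta>] by (simp add: nf_ker_def)
  then show "r = \<zero>\<^bsub>P\<^esub>" using r(2) by (intro ext) (auto simp: P_zero_apply)
qed

text \<open>The generators give spanning; independence is inherited from the larger ideal
  \<open>nf_ker\<close>.\<close>

lemma idealU_basis: "basis_ideal n \<Delta> R (idealU n \<Delta> M R T)"
proof (rule basis_idealI[OF idealU_ideal])
  show "mpower R (\<gamma> + unit_expo i) \<in> reducible (idealU n \<Delta> M R T) \<Delta>" if "\<gamma> \<in> \<Delta>" "i < n" for \<gamma> i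
    using that \<Delta>_step M_expos idealU_gen
    by (intro reducible_rewrite_poly[OF idealU_ideal, of \<Delta> T]) auto
  have "idealU n \<Delta> M R T \<subseteq> nf_ker"
    unfolding idealU_def using rewrite_poly_nf_ker by (intro P.genideal_minimal nf_ker_ideal) auto
  then show "r = \<zero>\<^bsub>P\<^esub>" if "r \<in> idealU n \<Delta> M R T" "{m. r m \<noteq> \<zero>} \<subseteq> \<Delta>" for r
    using that nf_ker_basis unfolding basis_ideal_def by blast
qed

lemma idealU_nf_ker: "idealU n \<Delta> M R T = nf_ker"
proof (rule basis_ideal_eq[OF idealU_basis nf_ker_basis])
  show "idealU n \<Delta> M R T \<subseteq> nf_ker"
    unfolding idealU_def using rewrite_poly_nf_ker by (intro P.genideal_minimal nf_ker_ideal) auto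
qed

end

section \<open>Families of coefficients and the ideals they belong to\<close>

lemma (in ideal) finsum_in_ideal:
  assumes "\<And>x. x \<in> A \<Longrightarrow> f x \<in> I" shows "finsum R f A \<in> I"
proof (cases "finite A")
  case True
  then show ?thesis using assms
  proof (induction A)
    case (insert a A)
    then show ?case using Icarr by (subst finsum_insert) (auto simp: Pi_def)
  qed simp
qed (simp add: finsum_infinite)

context hilb_ring
begin

text \<open>If the row a represents x^\<alpha> modulo I, then a times the matrix of x_i represents
  x^\<alpha> x_i. In this way congruences modulo I produce the sums that occur in
  \<open>mult_family\<close>.\<close>

lemma rewrite_mult_var:
  assumes I: "ideal I P"
    and T: "\<And>\<gamma> i \<beta>. \<gamma> \<in> \<Delta> \<Longrightarrow> i < n \<Longrightarrow> \<beta> \<in> \<Delta> \<Longrightarrow> T (\<gamma> + unit_expo i) \<beta> \<in> carrier R"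
    and rw: "\<And>\<gamma> i. \<gamma> \<in> \<Delta> \<Longrightarrow> i < n \<Longrightarrow> mpower R (\<gamma> + unit_expo i) \<ominus>\<^bsub>P\<^esub> trunc \<Delta> (T (\<gamma> + unit_expo i)) \<in> I"
    and a: "\<And>\<gamma>. \<gamma> \<in> \<Delta> \<Longrightarrow> a \<gamma> \<in> carrier R" and \<alpha>: "\<alpha> \<in> expos n" and i: "i < n"
    and rwa: "mpower R \<alpha> \<ominus>\<^bsub>P\<^esub> trunc \<Delta> a \<in> I"
  shows "mpower R (\<alpha> + unit_expo i)
    \<ominus>\<^bsub>P\<^esub> trunc \<Delta> (\<lambda>\<beta>. \<Oplus>\<gamma>\<in>\<Delta>. a \<gamma> \<otimes> T (\<gamma> + unit_expo i) \<beta>) \<in> I"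
proof -
  interpret I: ideal I P by (rule I)
  let ?x = "mpower R (unit_expo i)" and ?s = "\<lambda>\<beta>. \<Oplus>\<gamma>\<in>\<Delta>. a \<gamma> \<otimes> T (\<gamma> + unit_expo i) \<beta>"
  let ?d = "\<lambda>\<gamma>. mpower R (\<gamma> + unit_expo i) \<ominus>\<^bsub>P\<^esub> trunc \<Delta> (T (\<gamma> + unit_expo i))"
  have x: "?x \<in> carrier P" using i by (simp add: unit_expo_expos)
  have t: "trunc \<Delta> (T (\<gamma> + unit_expo i)) \<in> carrier P" if "\<gamma> \<in> \<Delta>" for \<gamma>
    by (rule trunc_closed) (use that T i in auto)
  have ta: "trunc \<Delta> a \<in> carrier P" by (rule trunc_closed) (use a in auto)
  have s: "?s \<beta> \<in> carrier R" if "\<beta> \<in> \<Delta>" for \<beta>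
    by (rule finsum_closed) (use a T i that in auto)
  have ts: "trunc \<Delta> ?s \<in> carrier P" by (rule trunc_closed) (use s in auto)
  have ex: "\<gamma> + unit_expo i \<in> expos n" "\<gamma> \<in> expos n" if "\<gamma> \<in> \<Delta>" for \<gamma>
    using that \<Delta>_expos i by (auto simp: monomials_add unit_expo_expos)
  have d: "?d \<gamma> \<in> carrier P" if "\<gamma> \<in> \<Delta>" for \<gamma> using t ex that by simp
  \<comment> \<open>\<open>E1\<close> is the error of replacing x^\<alpha> by its row,
    \<open>E2\<close> the error of then rewriting every shifted basis monomial. Both lie in I, and
    they make up the whole difference.\<close>
  define E1 where "E1 = ?x \<otimes>\<^bsub>P\<^esub> (mpower R \<alpha> \<ominus>\<^bsub>P\<^esub> trunc \<Delta> a)"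
  define E2 where "E2 = (\<Oplus>\<^bsub>P\<^esub>\<gamma>\<in>\<Delta>. mconst R (a \<gamma>) \<otimes>\<^bsub>P\<^esub> ?d \<gamma>)"
  have E1I: "E1 \<in> I" unfolding E1_def using rwa x by (rule I.I_l_closed)
  have E2I: "E2 \<in> I" unfolding E2_def
    by (rule I.finsum_in_ideal) (use rw i a in \<open>auto intro: I.I_l_closed\<close>)
  have "?x \<otimes>\<^bsub>P\<^esub> mpower R \<alpha> = E1 \<oplus>\<^bsub>P\<^esub> ?x \<otimes>\<^bsub>P\<^esub> trunc \<Delta> a"
    unfolding E1_def using x ta \<alpha> by (simp add: P.minus_eq P.r_distr P.r_minus P.a_assoc P.l_neg)
  moreover have "?x \<otimes>\<^bsub>P\<^esub> mpower R \<alpha> = mpower R (\<alpha> + unit_expo i)"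
    using mpower_add[OF \<alpha>, of "unit_expo i"] by (simp add: ab_semigroup_add_class.add.commute)
  moreover have "?x \<otimes>\<^bsub>P\<^esub> trunc \<Delta> a = E2 \<oplus>\<^bsub>P\<^esub> trunc \<Delta> ?s"
  proof -
    have "?x \<otimes>\<^bsub>P\<^esub> trunc \<Delta> a = ?x \<otimes>\<^bsub>P\<^esub> (\<Oplus>\<^bsub>P\<^esub>\<gamma>\<in>\<Delta>. mterm R (a \<gamma>) \<gamma>)"
      by (subst trunc_finsum) (use a in auto)
    also have "\<dots> = (\<Oplus>\<^bsub>P\<^esub>\<gamma>\<in>\<Delta>. ?x \<otimes>\<^bsub>P\<^esub> mterm R (a \<gamma>) \<gamma>)"
      by (rule P.finsum_rdistr) (use x a ex finite_\<Delta> in auto)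
    also have "\<dots> = (\<Oplus>\<^bsub>P\<^esub>\<gamma>\<in>\<Delta>. mconst R (a \<gamma>) \<otimes>\<^bsub>P\<^esub> ?d \<gamma>
        \<oplus>\<^bsub>P\<^esub> mconst R (a \<gamma>) \<otimes>\<^bsub>P\<^esub> trunc \<Delta> (T (\<gamma> + unit_expo i)))"
    proof (rule P.finsum_cong')
      fix \<gamma> assume \<gamma>: "\<gamma> \<in> \<Delta>"
      have "?x \<otimes>\<^bsub>P\<^esub> mterm R (a \<gamma>) \<gamma> = mterm R (a \<gamma>) (\<gamma> + unit_expo i)"
        unfolding mpower_def using mterm_mult[of \<one> "a \<gamma>" \<gamma> "unit_expo i"] a[OF \<gamma>] ex[OF \<gamma>]
        by (simp add: ab_semigroup_add_class.add.commute)
      also have "\<dots> = mconst R (a \<gamma>) \<otimes>\<^bsub>P\<^esub> mpower R (\<gamma> + unit_expo i)"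
        using a[OF \<gamma>] ex[OF \<gamma>] by (intro mterm_eq)
      also have "mpower R (\<gamma> + unit_expo i) = ?d \<gamma> \<oplus>\<^bsub>P\<^esub> trunc \<Delta> (T (\<gamma> + unit_expo i))"
        using t[OF \<gamma>] ex[OF \<gamma>] by (simp add: P.minus_eq P.a_assoc P.l_neg)
      also have "mconst R (a \<gamma>) \<otimes>\<^bsub>P\<^esub> (?d \<gamma> \<oplus>\<^bsub>P\<^esub> trunc \<Delta> (T (\<gamma> + unit_expo i)))
          = mconst R (a \<gamma>) \<otimes>\<^bsub>P\<^esub> ?d \<gamma> \<oplus>\<^bsub>P\<^esub> mconst R (a \<gamma>) \<otimes>\<^bsub>P\<^esub> trunc \<Delta> (T (\<gamma> + unit_expo i))"
        using d[OF \<gamma>] t[OF \<gamma>] a[OF \<gamma>] by (intro P.r_distr) auto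
      finally show "?x \<otimes>\<^bsub>P\<^esub> mterm R (a \<gamma>) \<gamma> = mconst R (a \<gamma>) \<otimes>\<^bsub>P\<^esub> ?d \<gamma>
        \<oplus>\<^bsub>P\<^esub> mconst R (a \<gamma>) \<otimes>\<^bsub>P\<^esub> trunc \<Delta> (T (\<gamma> + unit_expo i))" .
    qed (use d t a in auto)
    also have "\<dots> = E2 \<oplus>\<^bsub>P\<^esub> (\<Oplus>\<^bsub>P\<^esub>\<gamma>\<in>\<Delta>. mconst R (a \<gamma>) \<otimes>\<^bsub>P\<^esub> trunc \<Delta> (T (\<gamma> + unit_expo i)))"
      unfolding E2_def by (rule P.finsum_addf) (use d t a in auto)
    also have "(\<Oplus>\<^bsub>P\<^esub>\<gamma>\<in>\<Delta>. mconst R (a \<gamma>) \<otimes>\<^bsub>P\<^esub> trunc \<Delta> (T (\<gamma> + unit_expo i))) = trunc \<Delta> ?s"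
    proof
      fix m
      have "(\<Oplus>\<^bsub>P\<^esub>\<gamma>\<in>\<Delta>. mconst R (a \<gamma>) \<otimes>\<^bsub>P\<^esub> trunc \<Delta> (T (\<gamma> + unit_expo i))) m
          = (\<Oplus>\<gamma>\<in>\<Delta>. (mconst R (a \<gamma>) \<otimes>\<^bsub>P\<^esub> trunc \<Delta> (T (\<gamma> + unit_expo i))) m)"
        by (rule P_finsum_apply) (use t a in auto)
      also have "\<dots> = (\<Oplus>\<gamma>\<in>\<Delta>. a \<gamma> \<otimes> trunc \<Delta> (T (\<gamma> + unit_expo i)) m)"
        by (rule finsum_cong') (use t a in \<open>auto simp: mconst_mult_apply\<close>)
      also have "\<dots> = trunc \<Delta> ?s m"
      proof (cases "m \<in> \<Delta>")
        case True
        then show ?thesis by (simp add: trunc_def)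
      next
        case False
        then show ?thesis using a by (auto simp: trunc_def intro!: finsum_eq_zero)
      qed
      finally show "(\<Oplus>\<^bsub>P\<^esub>\<gamma>\<in>\<Delta>. mconst R (a \<gamma>) \<otimes>\<^bsub>P\<^esub> trunc \<Delta> (T (\<gamma> + unit_expo i))) m = trunc \<Delta> ?s m" .
    qed
    finally show ?thesis .
  qed
  ultimately have "mpower R (\<alpha> + unit_expo i) = E1 \<oplus>\<^bsub>P\<^esub> (E2 \<oplus>\<^bsub>P\<^esub> trunc \<Delta> ?s)" by simp
  then have "mpower R (\<alpha> + unit_expo i) \<ominus>\<^bsub>P\<^esub> trunc \<Delta> ?s = E1 \<oplus>\<^bsub>P\<^esub> E2"
    using E1I E2I I.Icarr ts by (simp add: P.minus_eq P.a_assoc P.r_neg)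
  then show ?thesis using E1I E2I by simp
qed

lemma trunc_unique:
  assumes I: "basis_ideal n \<Delta> R I" and p: "p \<in> carrier P"
    and a: "\<And>\<gamma>. \<gamma> \<in> \<Delta> \<Longrightarrow> a \<gamma> \<in> carrier R" and b: "\<And>\<gamma>. \<gamma> \<in> \<Delta> \<Longrightarrow> b \<gamma> \<in> carrier R"
    and pa: "p \<ominus>\<^bsub>P\<^esub> trunc \<Delta> a \<in> I" and pb: "p \<ominus>\<^bsub>P\<^esub> trunc \<Delta> b \<in> I" and \<beta>: "\<beta> \<in> \<Delta>"
  shows "a \<beta> = b \<beta>"
proof -
  interpret I: ideal I P using I by (simp add: basis_ideal_def)
  have t: "trunc \<Delta> a \<in> carrier P" "trunc \<Delta> b \<in> carrier P"
    by (rule trunc_closed; use a b in auto)+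
  have "(p \<ominus>\<^bsub>P\<^esub> trunc \<Delta> b) \<oplus>\<^bsub>P\<^esub> \<ominus>\<^bsub>P\<^esub> (p \<ominus>\<^bsub>P\<^esub> trunc \<Delta> a) \<in> I" using pa pb by auto
  also have "(p \<ominus>\<^bsub>P\<^esub> trunc \<Delta> b) \<oplus>\<^bsub>P\<^esub> \<ominus>\<^bsub>P\<^esub> (p \<ominus>\<^bsub>P\<^esub> trunc \<Delta> a) = trunc \<Delta> a \<ominus>\<^bsub>P\<^esub> trunc \<Delta> b"
    using t p P.r_neg1[of p "trunc \<Delta> a \<oplus>\<^bsub>P\<^esub> \<ominus>\<^bsub>P\<^esub> trunc \<Delta> b"] by (simp add: P.minus_eq P.minus_add P.a_ac P.r_neg2)
  finally have "trunc \<Delta> a = trunc \<Delta> b"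
    by (rule basis_ideal_unique[OF I t, rotated 2]) (auto simp: trunc_def)
  then have "trunc \<Delta> a \<beta> = trunc \<Delta> b \<beta>" by simp
  then show ?thesis using \<beta> by (simp add: trunc_def)
qed

lemma corresponds_trunc:
  assumes "\<And>\<alpha> \<beta>. \<alpha> \<in> M \<Longrightarrow> \<beta> \<in> \<Delta> \<Longrightarrow> T \<alpha> \<beta> \<in> carrier R"
  shows "corresponds n \<Delta> M R T I \<longleftrightarrow> (\<forall>\<alpha>\<in>M. mpower R \<alpha> \<ominus>\<^bsub>P\<^esub> trunc \<Delta> (T \<alpha>) \<in> I)"
  unfolding corresponds_def using assms by (simp add: rewrite_poly_trunc)

text \<open>Every equation of \<open>mult_family\<close> compares two rows that represent the same
  monomial modulo I, so it follows from uniqueness of coordinates. For commutation this monomial is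
  x^\<alpha> x_i x_j.\<close>

lemma mult_familyI:
  assumes I: "basis_ideal n \<Delta> R I"
    and T: "\<And>\<alpha> \<beta>. \<alpha> \<in> M \<Longrightarrow> \<beta> \<in> \<Delta> \<Longrightarrow> T \<alpha> \<beta> \<in> carrier R"
    and corr: "corresponds n \<Delta> M R T I"
  shows "mult_family n \<Delta> M R T"
proof -
  have idl: "ideal I P" using I by (simp add: basis_ideal_def)
  interpret I: ideal I P by (rule idl)
  have rw: "mpower R \<alpha> \<ominus>\<^bsub>P\<^esub> trunc \<Delta> (T \<alpha>) \<in> I" if "\<alpha> \<in> M" for \<alpha>
    using corr corresponds_trunc[of T I] T that by blast
  have ex: "\<alpha> \<in> expos n" if "\<alpha> \<in> M" for \<alpha> using that M_expos by blast
  have step: "mpower R (\<alpha> + unit_expo i) \<ominus>\<^bsub>P\<^esub> trunc \<Delta> (shift_sum R \<Delta> T \<alpha> i) \<in> I"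
    if "\<alpha> \<in> M" "i < n" for \<alpha> i
    unfolding shift_sum_def
    by (rule rewrite_mult_var[OF idl]) (use that T rw ex \<Delta>_step in auto)
  have sc: "shift_sum R \<Delta> T \<alpha> i \<beta> \<in> carrier R" if "\<alpha> \<in> M" "i < n" "\<beta> \<in> \<Delta>" for \<alpha> i \<beta>
    unfolding shift_sum_def by (rule finsum_closed) (use that T \<Delta>_step in auto)
  show ?thesis
    unfolding mult_family_def
  proof (intro conjI ballI allI impI)
    fix \<alpha> \<beta> assume \<alpha>: "\<alpha> \<in> \<Delta>" and \<beta>: "\<beta> \<in> \<Delta>"
    have "mpower R \<alpha> = trunc \<Delta> (\<lambda>\<beta>. if \<alpha> = \<beta> then \<one> else \<zero>)"
      using \<alpha> by (intro ext) (simp add: mpower_def mterm_apply trunc_def)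
    moreover have "mpower R \<alpha> \<in> carrier P" using \<alpha> \<Delta>_expos by auto
    ultimately have "mpower R \<alpha> \<ominus>\<^bsub>P\<^esub> trunc \<Delta> (\<lambda>\<beta>. if \<alpha> = \<beta> then \<one> else \<zero>) \<in> I"
      by (metis I.zero_closed P.r_right_minus_eq)
    then show "T \<alpha> \<beta> = (if \<alpha> = \<beta> then \<one> else \<zero>)"
      using \<alpha> \<beta> \<Delta>_M rw[of \<alpha>] T ex
      by (intro trunc_unique[OF I, of "mpower R \<alpha>" "T \<alpha>" "\<lambda>\<beta>. if \<alpha> = \<beta> then \<one> else \<zero>"]) auto
  next
    fix \<alpha> i \<beta> assume "\<alpha> \<in> M" "i < n" "\<alpha> + unit_expo i \<in> M" "\<beta> \<in> \<Delta>"
    then show "T (\<alpha> + unit_expo i) \<beta> = shift_sum R \<Delta> T \<alpha> i \<beta>"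
      using step rw T sc ex
      by (intro trunc_unique[OF I, of "mpower R (\<alpha> + unit_expo i)" "T (\<alpha> + unit_expo i)" "shift_sum R \<Delta> T \<alpha> i"]) auto
  next
    fix \<alpha> i j \<beta> assume *: "\<alpha> \<in> \<Delta>" "i < n" "j < n" "\<beta> \<in> \<Delta>"
    have M: "\<alpha> + unit_expo i \<in> M" "\<alpha> + unit_expo j \<in> M" using * \<Delta>_step by auto
    have "\<alpha> + unit_expo i + unit_expo j \<in> expos n"
      using ex[OF M(1)] * by (simp add: monomials_add unit_expo_expos)
    moreover have "\<alpha> + unit_expo j + unit_expo i = \<alpha> + unit_expo i + unit_expo j"
      by (simp add: ab_semigroup_add_class.add_ac)
    ultimately show "shift_sum R \<Delta> T (\<alpha> + unit_expo i) j \<beta> = shift_sum R \<Delta> T (\<alpha> + unit_expo j) i \<beta>"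
      using step[OF M(1) *(3)] step[OF M(2) *(2)] sc[OF M(1) *(3)] sc[OF M(2) *(2)] *(4)
      by (intro trunc_unique[OF I, of "mpower R (\<alpha> + unit_expo i + unit_expo j)"
            "shift_sum R \<Delta> T (\<alpha> + unit_expo i) j" "shift_sum R \<Delta> T (\<alpha> + unit_expo j) i"]) auto
  qed (use T in auto)
qed

lemma basis_ideal_corresponds:
  assumes I: "basis_ideal n \<Delta> R I"
  obtains T where "\<And>\<alpha> \<beta>. \<alpha> \<in> M \<Longrightarrow> \<beta> \<in> \<Delta> \<Longrightarrow> T \<alpha> \<beta> \<in> carrier R" "corresponds n \<Delta> M R T I"
proof -
  have "\<exists>r\<in>carrier P. {m. r m \<noteq> \<zero>} \<subseteq> \<Delta> \<and> mpower R \<alpha> \<ominus>\<^bsub>P\<^esub> r \<in> I" if "\<alpha> \<in> M" for \<alpha>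
  proof -
    have "mpower R \<alpha> \<in> carrier P" using that M_expos by auto
    then show ?thesis using I unfolding basis_ideal_def by blast
  qed
  then obtain T where T: "\<And>\<alpha>. \<alpha> \<in> M \<Longrightarrow> T \<alpha> \<in> carrier P \<and> {m. T \<alpha> m \<noteq> \<zero>} \<subseteq> \<Delta> \<and> mpower R \<alpha> \<ominus>\<^bsub>P\<^esub> T \<alpha> \<in> I"
    by metis
  have "trunc \<Delta> (T \<alpha>) = T \<alpha>" if "\<alpha> \<in> M" for \<alpha>
  proof
    fix m
    have "m \<notin> \<Delta> \<Longrightarrow> T \<alpha> m = \<zero>" using T[OF that] by blast
    then show "trunc \<Delta> (T \<alpha>) m = T \<alpha> m" by (simp add: trunc_def)
  qed
  then show thesis
    using T by (intro that[of T]) (auto simp: corresponds_trunc)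
qed

text \<open>Correspondence says that the generators lie in I, and an inclusion between two ideals
  with the same basis of the quotient is an equality.\<close>

lemma idealU_unique:
  assumes I: "basis_ideal n \<Delta> R I" and T: "mult_family n \<Delta> M R T" and corr: "corresponds n \<Delta> M R T I"
  shows "I = idealU n \<Delta> M R T"
proof -
  interpret T: mult_family_ring n \<Delta> M R T by unfold_locales (rule T)
  have "idealU n \<Delta> M R T \<subseteq> I"
    unfolding idealU_def
    by (rule P.genideal_minimal) (use I corr in \<open>auto simp: basis_ideal_def corresponds_def\<close>)
  then show ?thesis using basis_ideal_eq[OF T.idealU_basis I] by simp
qed

text \<open>Together with \<open>idealU_inject\<close>, this parametrizes the points of the functor
  by families, taken as functions on M \<times> \<Delta>.\<close>

lemma basis_ideal_iff:
  "basis_ideal n \<Delta> R I \<longleftrightarrow> (\<exists>T. mult_family n \<Delta> M R T \<and> I = idealU n \<Delta> M R T)"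
proof
  assume I: "basis_ideal n \<Delta> R I"
  obtain T where T: "\<And>\<alpha> \<beta>. \<alpha> \<in> M \<Longrightarrow> \<beta> \<in> \<Delta> \<Longrightarrow> T \<alpha> \<beta> \<in> carrier R" "corresponds n \<Delta> M R T I"
    using basis_ideal_corresponds[OF I] by blast
  have "mult_family n \<Delta> M R T" by (rule mult_familyI[OF I T])
  then show "\<exists>T. mult_family n \<Delta> M R T \<and> I = idealU n \<Delta> M R T"
    using idealU_unique[OF I _ T(2)] by blast
next
  assume "\<exists>T. mult_family n \<Delta> M R T \<and> I = idealU n \<Delta> M R T"
  then obtain T where T: "mult_family n \<Delta> M R T" and I: "I = idealU n \<Delta> M R T" by blast
  interpret T: mult_family_ring n \<Delta> M R T by unfold_locales (rule T)
  show "basis_ideal n \<Delta> R I" unfolding I by (rule T.idealU_basis)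
qed

lemma idealU_inject:
  assumes T: "mult_family n \<Delta> M R T" and T': "mult_family n \<Delta> M R T'"
    and eq: "idealU n \<Delta> M R T = idealU n \<Delta> M R T'" and \<alpha>: "\<alpha> \<in> M" and \<beta>: "\<beta> \<in> \<Delta>"
  shows "T \<alpha> \<beta> = T' \<alpha> \<beta>"
proof -
  interpret T: mult_family_ring n \<Delta> M R T by unfold_locales (rule T)
  interpret T': mult_family_ring n \<Delta> M R T' by unfold_locales (rule T')
  have "mpower R \<alpha> \<ominus>\<^bsub>P\<^esub> trunc \<Delta> (T \<alpha>) \<in> idealU n \<Delta> M R T"
    using T.idealU_gen[OF \<alpha>] rewrite_poly_trunc[of \<Delta> T \<alpha>] \<alpha> by simp
  moreover have "mpower R \<alpha> \<ominus>\<^bsub>P\<^esub> trunc \<Delta> (T' \<alpha>) \<in> idealU n \<Delta> M R T"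
    unfolding eq using T'.idealU_gen[OF \<alpha>] rewrite_poly_trunc[of \<Delta> T' \<alpha>] \<alpha> by simp
  moreover have "mpower R \<alpha> \<in> carrier P" using \<alpha> M_expos by auto
  ultimately show ?thesis
    using \<alpha> \<beta> by (intro trunc_unique[OF T.idealU_basis, of "mpower R \<alpha>" "T \<alpha>" "T' \<alpha>"]) auto
qed

end

section \<open>Homomorphisms, base change and universal objects\<close>

lemma hilb_ringI: "hilb_data n \<Delta> M \<Longrightarrow> cring B \<Longrightarrow> hilb_ring n \<Delta> M B"
  by (intro hilb_ring.intro mpoly_over.intro)

lemma shift_sum_closed:
  assumes "cring P" "\<And>\<gamma>. \<gamma> \<in> \<Delta> \<Longrightarrow> T \<alpha> \<gamma> \<in> carrier P"
    "\<And>\<gamma>. \<gamma> \<in> \<Delta> \<Longrightarrow> T (\<gamma> + unit_expo i) \<beta> \<in> carrier P"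
  shows "shift_sum P \<Delta> T \<alpha> i \<beta> \<in> carrier P"
proof -
  interpret P: cring P by fact
  show ?thesis unfolding shift_sum_def by (rule P.finsum_closed) (use assms in auto)
qed

lemma shift_sum_hom:
  assumes P: "cring P" and Q: "cring Q" and h: "h \<in> ring_hom P Q"
    and T: "\<And>\<gamma>. \<gamma> \<in> \<Delta> \<Longrightarrow> T \<alpha> \<gamma> \<in> carrier P"
      "\<And>\<gamma>. \<gamma> \<in> \<Delta> \<Longrightarrow> T (\<gamma> + unit_expo i) \<beta> \<in> carrier P"
  shows "h (shift_sum P \<Delta> T \<alpha> i \<beta>) = shift_sum Q \<Delta> (\<lambda>\<alpha> \<beta>. h (T \<alpha> \<beta>)) \<alpha> i \<beta>"
proof -
  interpret P: cring P by (rule P)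
  interpret Q: cring Q by (rule Q)
  interpret h: ring_hom_cring P Q h by unfold_locales (rule h)
  have "h (shift_sum P \<Delta> T \<alpha> i \<beta>) = (\<Oplus>\<^bsub>Q\<^esub>\<gamma>\<in>\<Delta>. h (T \<alpha> \<gamma> \<otimes>\<^bsub>P\<^esub> T (\<gamma> + unit_expo i) \<beta>))"
    unfolding shift_sum_def using T by (subst h.hom_finsum) (auto simp: comp_def)
  also have "\<dots> = shift_sum Q \<Delta> (\<lambda>\<alpha> \<beta>. h (T \<alpha> \<beta>)) \<alpha> i \<beta>"
    unfolding shift_sum_def by (rule Q.finsum_cong') (use T in auto)
  finally show ?thesis .
qed

text \<open>The conditions are polynomial equations with integer coefficients, which homomorphisms
  preserve. Keeping \<open>T'\<close> apart from the image family also yields a congruence rule,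
  with the identity as homomorphism.\<close>

lemma mult_family_hom:
  assumes D: "hilb_data n \<Delta> M" and A: "cring A" and B: "cring B" and f: "f \<in> ring_hom A B"
    and T: "mult_family n \<Delta> M A T"
    and T': "\<And>\<alpha> \<beta>. \<alpha> \<in> M \<Longrightarrow> \<beta> \<in> \<Delta> \<Longrightarrow> T' \<alpha> \<beta> = f (T \<alpha> \<beta>)"
  shows "mult_family n \<Delta> M B T'"
proof -
  interpret hilb_data n \<Delta> M by (rule D)
  interpret A: cring A by (rule A)
  interpret B: cring B by (rule B)
  interpret f: ring_hom_cring A B f by unfold_locales (rule f)
  have Tc: "T \<alpha> \<beta> \<in> carrier A" if "\<alpha> \<in> M" "\<beta> \<in> \<Delta>" for \<alpha> \<beta>
    using T that unfolding mult_family_def by blast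
  have ss: "shift_sum B \<Delta> T' \<alpha> i \<beta> = f (shift_sum A \<Delta> T \<alpha> i \<beta>)"
    if "\<alpha> \<in> M" "i < n" "\<beta> \<in> \<Delta>" for \<alpha> i \<beta>
  proof -
    have "f (shift_sum A \<Delta> T \<alpha> i \<beta>) = shift_sum B \<Delta> (\<lambda>\<alpha> \<beta>. f (T \<alpha> \<beta>)) \<alpha> i \<beta>"
      by (rule shift_sum_hom[OF A B f]; rule Tc) (use that \<Delta>_step in auto)
    also have "\<dots> = shift_sum B \<Delta> T' \<alpha> i \<beta>"
      unfolding shift_sum_def by (rule B.finsum_cong') (use that Tc T' \<Delta>_step in auto)
    finally show ?thesis ..
  qed
  show ?thesis
    unfolding mult_family_def
  proof (intro conjI ballI allI impI)
    fix \<alpha> \<beta> assume *: "\<alpha> \<in> \<Delta>" "\<beta> \<in> \<Delta>"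
    then have "T \<alpha> \<beta> = (if \<alpha> = \<beta> then \<one>\<^bsub>A\<^esub> else \<zero>\<^bsub>A\<^esub>)" using T unfolding mult_family_def by blast
    then show "T' \<alpha> \<beta> = (if \<alpha> = \<beta> then \<one>\<^bsub>B\<^esub> else \<zero>\<^bsub>B\<^esub>)" using T' * \<Delta>_M by auto
  next
    fix \<alpha> i \<beta> assume *: "\<alpha> \<in> M" "i < n" "\<alpha> + unit_expo i \<in> M" "\<beta> \<in> \<Delta>"
    then have "T (\<alpha> + unit_expo i) \<beta> = shift_sum A \<Delta> T \<alpha> i \<beta>" using T unfolding mult_family_def by blast
    then show "T' (\<alpha> + unit_expo i) \<beta> = shift_sum B \<Delta> T' \<alpha> i \<beta>" using ss[OF *(1,2,4)] T' * by simp
  next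
    fix \<alpha> i j \<beta> assume *: "\<alpha> \<in> \<Delta>" "i < n" "j < n" "\<beta> \<in> \<Delta>"
    then have "shift_sum A \<Delta> T (\<alpha> + unit_expo i) j \<beta> = shift_sum A \<Delta> T (\<alpha> + unit_expo j) i \<beta>"
      using T unfolding mult_family_def by blast
    then show "shift_sum B \<Delta> T' (\<alpha> + unit_expo i) j \<beta> = shift_sum B \<Delta> T' (\<alpha> + unit_expo j) i \<beta>"
      using ss[OF \<Delta>_step[OF *(1,2)] *(3,4)] ss[OF \<Delta>_step[OF *(1,3)] *(2,4)] by simp
  qed (use Tc T' in auto)
qed

lemma mult_family_cong:
  assumes "hilb_data n \<Delta> M" and B: "cring B" and "mult_family n \<Delta> M B T"
    and "\<And>\<alpha> \<beta>. \<alpha> \<in> M \<Longrightarrow> \<beta> \<in> \<Delta> \<Longrightarrow> T' \<alpha> \<beta> = T \<alpha> \<beta>"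
  shows "mult_family n \<Delta> M B T'"
  by (rule mult_family_hom[OF assms(1) B B _ assms(3), of "\<lambda>x. x"]) (auto intro: ring_hom_memI assms(4))

text \<open>The preimage of the ideal generated by the images of G is an ideal that contains G,
  hence all of the ideal generated by G.\<close>

lemma base_change_genideal:
  assumes A: "cring A" and B: "cring B" and f: "f \<in> ring_hom A B" and G: "G \<subseteq> carrier (xring n A)"
  shows "base_change n B f (Idl\<^bsub>xring n A\<^esub> G) = Idl\<^bsub>xring n B\<^esub> ((\<lambda>p m. f (p m)) ` G)"
proof -
  interpret A: mpoly_over A "{..<n}" by (intro mpoly_over.intro A)
  interpret B: mpoly_over B "{..<n}" by (intro mpoly_over.intro B)
  let ?F = "\<lambda>p m. f (p m)"
  have F: "?F \<in> ring_hom (xring n A) (xring n B)" by (rule A.map_coeff_hom[OF B f])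
  have Fc: "?F ` carrier (xring n A) \<subseteq> carrier (xring n B)" using ring_hom_closed[OF F] by blast
  let ?K = "Idl\<^bsub>xring n B\<^esub> (?F ` G)"
  have K: "ideal ?K (xring n B)" by (rule B.P.genideal_ideal) (use Fc G in blast)
  have rh: "ring_hom_ring (xring n A) (xring n B) ?F"
    by (rule ring_hom_ringI2[OF A.P.ring_axioms B.P.ring_axioms F])
  have pre: "ideal {p \<in> carrier (xring n A). ?F p \<in> ?K} (xring n A)"
    using ring_hom_ring.ideal_vimage[OF rh K] by simp
  have "G \<subseteq> {p \<in> carrier (xring n A). ?F p \<in> ?K}"
    using G B.P.genideal_self[of "?F ` G"] Fc by blast
  then have sub: "Idl\<^bsub>xring n A\<^esub> G \<subseteq> {p \<in> carrier (xring n A). ?F p \<in> ?K}"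
    by (rule A.P.genideal_minimal[OF pre])
  have c: "?F ` (Idl\<^bsub>xring n A\<^esub> G) \<subseteq> carrier (xring n B)" using sub Fc by blast
  show ?thesis
    unfolding base_change_def
  proof
    show "Idl\<^bsub>xring n B\<^esub> (?F ` (Idl\<^bsub>xring n A\<^esub> G)) \<subseteq> ?K"
      by (rule B.P.genideal_minimal[OF K]) (use sub in blast)
    show "?K \<subseteq> Idl\<^bsub>xring n B\<^esub> (?F ` (Idl\<^bsub>xring n A\<^esub> G))"
    proof (rule B.P.genideal_minimal[OF B.P.genideal_ideal[OF c]])
      show "?F ` G \<subseteq> Idl\<^bsub>xring n B\<^esub> (?F ` (Idl\<^bsub>xring n A\<^esub> G))"
        using B.P.genideal_self[OF c] A.P.genideal_self[OF G] by blast
    qed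
  qed
qed

text \<open>Acting on coefficients, f sends each rewriting polynomial of T to that of the image
  family, and it suffices to compare generators.\<close>

lemma base_change_idealU:
  assumes D: "hilb_data n \<Delta> M" and A: "cring A" and B: "cring B" and f: "f \<in> ring_hom A B"
    and T: "mult_family n \<Delta> M A T"
  shows "base_change n B f (idealU n \<Delta> M A T) = idealU n \<Delta> M B (\<lambda>\<alpha> \<beta>. f (T \<alpha> \<beta>))"
proof -
  interpret A: hilb_ring n \<Delta> M A by (rule hilb_ringI[OF D A])
  interpret B: hilb_ring n \<Delta> M B by (rule hilb_ringI[OF D B])
  interpret T: mult_family_ring n \<Delta> M A T by unfold_locales (rule T)
  interpret f: ring_hom_cring A B f by unfold_locales (rule f)
  have rw: "(\<lambda>m. f (rewrite_poly n A \<Delta> T \<alpha> m)) = rewrite_poly n B \<Delta> (\<lambda>\<alpha> \<beta>. f (T \<alpha> \<beta>)) \<alpha>" if "\<alpha> \<in> M" for \<alpha>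
  proof
    fix m
    have \<alpha>: "\<alpha> \<in> expos n" using that A.M_expos by blast
    show "f (rewrite_poly n A \<Delta> T \<alpha> m) = rewrite_poly n B \<Delta> (\<lambda>\<alpha> \<beta>. f (T \<alpha> \<beta>)) \<alpha> m"
      using that \<alpha> by (subst A.rewrite_poly_apply, simp, simp, simp, subst B.rewrite_poly_apply)
        (auto simp: a_minus_def)
  qed
  have "(\<lambda>p m. f (p m)) ` rewrite_poly n A \<Delta> T ` M = rewrite_poly n B \<Delta> (\<lambda>\<alpha> \<beta>. f (T \<alpha> \<beta>)) ` M"
    unfolding image_image by (rule image_cong) (use rw in auto)
  then show ?thesis
    unfolding idealU_def base_change_genideal[OF A B f T.idealU_gens] by simp
qed

text \<open>The set \<open>Z\<close> lists the coefficients required to vanish: it is empty for \<open>Hilb\<^sup>\<Delta>\<close>, and given by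
  \<open>\<alpha> \<prec> \<beta>\<close> for \<open>Hilb\<^sup>\<prec>\<^sup>\<Delta>\<close>.\<close>

definition zero_family ::
    "nat \<Rightarrow> expo set \<Rightarrow> expo set \<Rightarrow> (expo \<Rightarrow> expo \<Rightarrow> bool) \<Rightarrow> ('b, 'm) ring_scheme \<Rightarrow>
      (expo \<Rightarrow> expo \<Rightarrow> 'b) \<Rightarrow> bool" where
  "zero_family n \<Delta> M Z B T \<longleftrightarrow> mult_family n \<Delta> M B T \<and> (\<forall>\<alpha>\<in>M. \<forall>\<beta>\<in>\<Delta>. Z \<alpha> \<beta> \<longrightarrow> T \<alpha> \<beta> = \<zero>\<^bsub>B\<^esub>)"

lemma Hilb_iff:
  fixes B :: "'b ring"
  assumes "hilb_data n \<Delta> M" "cring B"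
  shows "I \<in> Hilb n \<Delta> B \<longleftrightarrow> (\<exists>T. zero_family n \<Delta> M (\<lambda>_ _. False) B T \<and> I = idealU n \<Delta> M B T)"
  unfolding hilb_ring_Hilb[OF hilb_ringI[OF assms]]
  using hilb_ring.basis_ideal_iff[OF hilb_ringI[OF assms], of I] by (simp add: zero_family_def)

lemma zero_family_hom:
  assumes D: "hilb_data n \<Delta> M" and A: "cring A" and B: "cring B" and f: "f \<in> ring_hom A B"
    and T: "zero_family n \<Delta> M Z A T"
  shows "zero_family n \<Delta> M Z B (\<lambda>\<alpha> \<beta>. f (T \<alpha> \<beta>))"
proof -
  interpret A: cring A by (rule A)
  interpret B: cring B by (rule B)
  interpret f: ring_hom_cring A B f by unfold_locales (rule f)
  show ?thesis using T mult_family_hom[OF D A B f, of T] by (auto simp: zero_family_def)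
qed

text \<open>The base change of J along f is the ideal of the family f(T), and the points over B are
  the ideals of families. So bijectivity amounts to this: homomorphisms out of A are determined by
  their values on T, and every family over B occurs as such values.\<close>

lemma universal_objectI:
  fixes A :: "'a ring" and H :: "'b ring \<Rightarrow> (expo \<Rightarrow> 'b) set set"
  assumes D: "hilb_data n \<Delta> M" and A: "k_algebra k A \<iota>" and T: "zero_family n \<Delta> M Z A T"
    and J: "J = idealU n \<Delta> M A T" and HA: "J \<in> HA"
    and H: "\<And>B I. cring B \<Longrightarrow> I \<in> H B \<longleftrightarrow> (\<exists>a. zero_family n \<Delta> M Z B a \<and> I = idealU n \<Delta> M B a)"
    and ex: "\<And>(B :: 'b ring) \<iota>B a. k_algebra k B \<iota>B \<Longrightarrow> zero_family n \<Delta> M Z B a \<Longrightarrow>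
      \<exists>f\<in>alg_homs k A \<iota> B \<iota>B. \<forall>\<alpha>\<in>M. \<forall>\<beta>\<in>\<Delta>. f (T \<alpha> \<beta>) = a \<alpha> \<beta>"
    and uniq: "\<And>(B :: 'b ring) \<iota>B f g. k_algebra k B \<iota>B \<Longrightarrow> f \<in> alg_homs k A \<iota> B \<iota>B \<Longrightarrow>
      g \<in> alg_homs k A \<iota> B \<iota>B \<Longrightarrow> \<forall>\<alpha>\<in>M. \<forall>\<beta>\<in>\<Delta>. f (T \<alpha> \<beta>) = g (T \<alpha> \<beta>) \<Longrightarrow> f = g"
  shows "universal_object k n \<Delta> M A \<iota> T HA H (xring n A Quot J) (\<lambda>p. J +>\<^bsub>xring n A\<^esub> p)"
proof -
  have Ac: "cring A" using A by (simp add: k_algebra_def)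
  have mf: "mult_family n \<Delta> M A T" using T by (simp add: zero_family_def)
  interpret A: hilb_ring n \<Delta> M A by (rule hilb_ringI[OF D Ac])
  interpret T: mult_family_ring n \<Delta> M A T by unfold_locales (rule mf)
  have basis: "basis_ideal n \<Delta> A J" unfolding J by (rule T.idealU_basis)
  have ker: "a_kernel (xring n A) (xring n A Quot J) (\<lambda>p. J +>\<^bsub>xring n A\<^esub> p) = J"
    by (rule A.basis_ideal_hilb_point(2)[OF basis])
  have bij: "bij_betw (\<lambda>f. base_change n B f J) (alg_homs k A \<iota> B \<iota>B) (H B)"
    if B: "k_algebra k B \<iota>B" for B :: "'b ring" and \<iota>B
  proof -
    have Bc: "cring B" using B by (simp add: k_algebra_def)
    interpret B: hilb_ring n \<Delta> M B by (rule hilb_ringI[OF D Bc])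
    have bc: "base_change n B f J = idealU n \<Delta> M B (\<lambda>\<alpha> \<beta>. f (T \<alpha> \<beta>))"
        "zero_family n \<Delta> M Z B (\<lambda>\<alpha> \<beta>. f (T \<alpha> \<beta>))" if "f \<in> alg_homs k A \<iota> B \<iota>B" for f
    proof -
      have f: "f \<in> ring_hom A B" using that by (simp add: alg_homs_def)
      show "base_change n B f J = idealU n \<Delta> M B (\<lambda>\<alpha> \<beta>. f (T \<alpha> \<beta>))"
        unfolding J by (rule base_change_idealU[OF D Ac Bc f mf])
      show "zero_family n \<Delta> M Z B (\<lambda>\<alpha> \<beta>. f (T \<alpha> \<beta>))" by (rule zero_family_hom[OF D Ac Bc f T])
    qed
    show ?thesis
      unfolding bij_betw_def
    proof (intro conjI inj_onI)
      fix f g assume f: "f \<in> alg_homs k A \<iota> B \<iota>B" and g: "g \<in> alg_homs k A \<iota> B \<iota>B"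
        and eq: "base_change n B f J = base_change n B g J"
      have "f (T \<alpha> \<beta>) = g (T \<alpha> \<beta>)" if "\<alpha> \<in> M" "\<beta> \<in> \<Delta>" for \<alpha> \<beta>
        using B.idealU_inject[of "\<lambda>\<alpha> \<beta>. f (T \<alpha> \<beta>)" "\<lambda>\<alpha> \<beta>. g (T \<alpha> \<beta>)" \<alpha> \<beta>] bc[OF f] bc[OF g] eq that
        by (simp add: zero_family_def)
      then show "f = g" using uniq[OF B f g] by blast
    next
      show "(\<lambda>f. base_change n B f J) ` alg_homs k A \<iota> B \<iota>B = H B"
      proof (intro subset_antisym subsetI)
        fix I assume "I \<in> (\<lambda>f. base_change n B f J) ` alg_homs k A \<iota> B \<iota>B"
        then show "I \<in> H B" unfolding H[OF Bc] using bc by blast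
      next
        fix I assume "I \<in> H B"
        then obtain a where a: "zero_family n \<Delta> M Z B a" "I = idealU n \<Delta> M B a"
          unfolding H[OF Bc] by blast
        obtain f where f: "f \<in> alg_homs k A \<iota> B \<iota>B" "\<forall>\<alpha>\<in>M. \<forall>\<beta>\<in>\<Delta>. f (T \<alpha> \<beta>) = a \<alpha> \<beta>"
          using ex[OF B a(1)] by blast
        \<comment> \<open>The families f(T) and a agree on M \<times> \<Delta>, where all entries
          used by the generators lie.\<close>
        have "rewrite_poly n B \<Delta> (\<lambda>\<alpha> \<beta>. f (T \<alpha> \<beta>)) ` M = rewrite_poly n B \<Delta> a ` M"
        proof (rule image_cong[OF refl])
          fix \<alpha> assume \<alpha>: "\<alpha> \<in> M"
          have "a \<alpha> \<beta> \<in> carrier B" if "\<beta> \<in> \<Delta>" for \<beta>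
            using a(1) \<alpha> that unfolding zero_family_def mult_family_def by blast
          moreover have "\<beta> \<in> expos n" if "\<beta> \<in> \<Delta>" for \<beta> using that A.\<Delta>_expos by blast
          ultimately show "rewrite_poly n B \<Delta> (\<lambda>\<alpha> \<beta>. f (T \<alpha> \<beta>)) \<alpha> = rewrite_poly n B \<Delta> a \<alpha>"
            unfolding rewrite_poly_def using f(2) \<alpha>
            by (intro arg_cong2[where f = "\<lambda>p q. p \<ominus>\<^bsub>xring n B\<^esub> q"] refl B.P.finsum_cong') auto
        qed
        then have "I = base_change n B f J" unfolding bc(1)[OF f(1)] a(2) idealU_def by simp
        then show "I \<in> (\<lambda>f. base_change n B f J) ` alg_homs k A \<iota> B \<iota>B" using f(1) by blast
      qed
    qed
  qed
  show ?thesis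
    unfolding universal_object_def ker
    using A A.basis_ideal_hilb_point(1)[OF basis] HA T.idealU_corresponds bij unfolding J by blast
qed

section \<open>Monomial orders and reduced Groebner bases\<close>

definition expo_deg :: "nat \<Rightarrow> expo \<Rightarrow> nat" where
  "expo_deg n \<alpha> = (\<Sum>i<n. Poly_Mapping.lookup \<alpha> i)"

lemma expo_deg_unit: "i < n \<Longrightarrow> expo_deg n (\<alpha> + unit_expo i) = expo_deg n \<alpha> + 1"
  by (simp add: expo_deg_def unit_expo_def lookup_add sum.distrib lookup_single when_def)

text \<open>Descent on the degree: a point of the complement that is not a corner has a predecessor
  in the complement.\<close>

lemma corner_dvd:
  assumes "\<alpha> \<in> expos n - N"
  obtains c \<gamma> where "c \<in> corners n N" "\<gamma> \<in> expos n" "\<alpha> = \<gamma> + c"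
  using assms
proof (induction "expo_deg n \<alpha>" arbitrary: \<alpha> thesis rule: less_induct)
  case less
  show ?case
  proof (cases "\<alpha> \<in> corners n N")
    case True
    then show ?thesis using less.prems(1)[of \<alpha> 0] by simp
  next
    case False
    then obtain i \<gamma> where i: "i < n" "\<gamma> \<in> expos n - N" "\<gamma> + unit_expo i = \<alpha>"
      using less.prems(2) unfolding corners_def by blast
    have "expo_deg n \<gamma> < expo_deg n \<alpha>" using expo_deg_unit[OF i(1), of \<gamma>] i(3) by simp
    then obtain c \<delta> where "c \<in> corners n N" "\<delta> \<in> expos n" "\<gamma> = \<delta> + c"
      using less.hyps[of \<gamma>] i(2) by blast
    then show ?thesis
      using less.prems(1)[of c "\<delta> + unit_expo i"] i by (simp add: monomials_add unit_expo_expos ac_simps)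
  qed
qed

locale order_data = hilb_data +
  fixes lt :: "expo \<Rightarrow> expo \<Rightarrow> bool"
  assumes order: "monomial_order n lt"
begin

lemma lt_irrefl: "\<alpha> \<in> expos n \<Longrightarrow> \<not> lt \<alpha> \<alpha>"
  using order unfolding monomial_order_def by (blast dest: irreflp_onD)

lemma lt_trans: "lt \<alpha> \<beta> \<Longrightarrow> lt \<beta> \<gamma> \<Longrightarrow> \<alpha> \<in> expos n \<Longrightarrow> \<beta> \<in> expos n \<Longrightarrow> \<gamma> \<in> expos n \<Longrightarrow> lt \<alpha> \<gamma>"
  using order unfolding monomial_order_def by (blast dest: transp_onD)

lemma lt_total: "\<alpha> \<in> expos n \<Longrightarrow> \<beta> \<in> expos n \<Longrightarrow> \<alpha> \<noteq> \<beta> \<Longrightarrow> lt \<alpha> \<beta> \<or> lt \<beta> \<alpha>"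
  using order unfolding monomial_order_def by (blast dest: totalp_onD)

lemma lt_add: "lt \<alpha> \<beta> \<Longrightarrow> \<alpha> \<in> expos n \<Longrightarrow> \<beta> \<in> expos n \<Longrightarrow> \<gamma> \<in> expos n \<Longrightarrow> lt (\<alpha> + \<gamma>) (\<beta> + \<gamma>)"
  using order unfolding monomial_order_def by blast

lemma lt_induct [consumes 1, case_names less]:
  assumes "\<alpha> \<in> expos n"
    and "\<And>\<alpha>. \<alpha> \<in> expos n \<Longrightarrow> (\<And>\<beta>. \<beta> \<in> expos n \<Longrightarrow> lt \<beta> \<alpha> \<Longrightarrow> Q \<beta>) \<Longrightarrow> Q \<alpha>"
  shows "Q \<alpha>"
proof -
  have "wfp_on (expos n) lt" using order by (simp add: monomial_order_def)
  from this assms(1) show ?thesis by (rule wfp_on_induct) (rule assms(2))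
qed

text \<open>A corner differs from 0, as 0 lies in \<Delta>, so it has some predecessor. Being a
  corner forces this predecessor into \<Delta>.\<close>

lemma corner_step:
  assumes "\<alpha> \<in> corners n \<Delta>"
  obtains \<gamma> i where "\<gamma> \<in> \<Delta>" "i < n" "\<alpha> = \<gamma> + unit_expo i"
proof -
  have \<alpha>: "\<alpha> \<in> expos n" "\<alpha> \<notin> \<Delta>" using assms by (auto simp: corners_def)
  have "\<exists>\<gamma>\<in>expos n. \<exists>i<n. \<alpha> = \<gamma> + unit_expo i"
    using \<alpha>(1) \<alpha>(2) zero_\<Delta> by (induction rule: monomials_induct) (auto simp: unit_expo_def)
  then obtain \<gamma> i where g: "\<gamma> \<in> expos n" "i < n" "\<alpha> = \<gamma> + unit_expo i" by blast
  then have "\<gamma> \<in> \<Delta>" using assms unfolding corners_def by blast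
  with g show thesis using that by blast
qed

lemma corners_M: "\<alpha> \<in> corners n \<Delta> \<Longrightarrow> \<alpha> \<in> M"
  using \<Delta>_step by (elim corner_step) simp

lemma finite_corners: "finite (corners n \<Delta>)"
proof (rule finite_subset)
  show "corners n \<Delta> \<subseteq> (\<lambda>(\<gamma>, i). \<gamma> + unit_expo i) ` (\<Delta> \<times> {..<n})"
    by (auto elim!: corner_step)
qed (use finite_\<Delta> in simp)

end

section \<open>Reduction along the monomial order\<close>

locale order_ring = hilb_ring + order_data
begin

text \<open>Well-founded induction along the order. Write \<alpha> = \<gamma> + c with a corner c; a
  remainder of x^c has exponents \<beta> below c, so \<gamma> + \<beta> is below \<alpha> and either
  lies in \<Delta> or is covered by the induction hypothesis.\<close>

lemma corner_reducible:
  assumes J: "ideal J P"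
    and corner: "\<And>c. c \<in> corners n \<Delta> \<Longrightarrow> mpower R c \<in> reducible J {\<beta>\<in>\<Delta>. lt \<beta> c}"
    and \<alpha>: "\<alpha> \<in> expos n" "\<alpha> \<notin> \<Delta>"
  shows "mpower R \<alpha> \<in> reducible J {\<beta>\<in>\<Delta>. lt \<beta> \<alpha>}"
  using \<alpha>
proof (induction rule: lt_induct)
  case (less \<alpha>)
  obtain c \<gamma> where c: "c \<in> corners n \<Delta>" "\<gamma> \<in> expos n" "\<alpha> = \<gamma> + c"
    using corner_dvd[of \<alpha> n \<Delta>] less by blast
  have ce: "c \<in> expos n" using c by (simp add: corners_def)
  have "mpower R \<gamma> \<otimes>\<^bsub>P\<^esub> mpower R c \<in> reducible J {\<beta>\<in>\<Delta>. lt \<beta> \<alpha>}"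
  proof (rule reducible_mpower_mult[OF J c(2) corner[OF c(1)]])
    fix \<beta> assume "\<beta> \<in> {\<beta>\<in>\<Delta>. lt \<beta> c}"
    then have \<beta>: "\<beta> \<in> \<Delta>" "\<beta> \<in> expos n" "lt \<beta> c" using \<Delta>_expos by auto
    have e: "\<gamma> + \<beta> \<in> expos n" using \<beta> c by (simp add: monomials_add)
    have l: "lt (\<gamma> + \<beta>) \<alpha>"
      using lt_add[OF \<beta>(3) \<beta>(2) ce c(2)] c(3) by (simp add: ab_semigroup_add_class.add.commute)
    show "mpower R (\<gamma> + \<beta>) \<in> reducible J {\<beta>\<in>\<Delta>. lt \<beta> \<alpha>}"
    proof (cases "\<gamma> + \<beta> \<in> \<Delta>")
      case True
      then show ?thesis using l e
        by (intro reducible_self[OF J]) (auto simp: mpower_def mterm_apply split: if_splits)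
    next
      case False
      show ?thesis
      proof (rule reducible_mono[OF less.IH[OF e l False]])
        show "{\<beta>' \<in> \<Delta>. lt \<beta>' (\<gamma> + \<beta>)} \<subseteq> {\<beta>\<in>\<Delta>. lt \<beta> \<alpha>}"
          using lt_trans[OF _ l _ e less.hyps] \<Delta>_expos by blast
      qed
    qed
  qed
  then show ?case using mpower_add[OF ce, of \<gamma>] c(3) by simp
qed

text \<open>Reduction expands x^\<alpha> in exponents below \<alpha>. By uniqueness of coordinates
  this expansion is the row of T, which therefore has no entry at a larger exponent.\<close>

lemma corner_reducible_zero_family:
  assumes I: "basis_ideal n \<Delta> R I" and T: "mult_family n \<Delta> M R T" and corr: "corresponds n \<Delta> M R T I"
    and corner: "\<And>c. c \<in> corners n \<Delta> \<Longrightarrow> mpower R c \<in> reducible I {\<beta>\<in>\<Delta>. lt \<beta> c}"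
  shows "zero_family n \<Delta> M lt R T"
  unfolding zero_family_def
proof (intro conjI ballI impI T)
  have J: "ideal I P" using I by (simp add: basis_ideal_def)
  interpret T: mult_family_ring n \<Delta> M R T by unfold_locales (rule T)
  fix \<alpha> \<beta> assume \<alpha>: "\<alpha> \<in> M" and \<beta>: "\<beta> \<in> \<Delta>" and l: "lt \<alpha> \<beta>"
  have e: "\<alpha> \<in> expos n" "\<beta> \<in> expos n" using \<alpha> \<beta> M_expos \<Delta>_expos by auto
  show "T \<alpha> \<beta> = \<zero>"
  proof (cases "\<alpha> \<in> \<Delta>")
    case True
    then show ?thesis using T.T_delta[of \<alpha> \<beta>] \<beta> l lt_irrefl e by auto
  next
    case False
    have red: "mpower R \<alpha> \<in> reducible I {\<beta>\<in>\<Delta>. lt \<beta> \<alpha>}"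
      by (rule corner_reducible[OF J corner e(1) False])
    obtain r where r: "r \<in> carrier P" "\<And>m. r m \<noteq> \<zero> \<Longrightarrow> m \<in> {\<beta>\<in>\<Delta>. lt \<beta> \<alpha>}" "mpower R \<alpha> \<ominus>\<^bsub>P\<^esub> r \<in> I"
      using red by (rule reducibleE) (rule that)
    have "trunc \<Delta> r = r"
    proof
      fix m show "trunc \<Delta> r m = r m" using r(2)[of m] by (cases "r m = \<zero>") (auto simp: trunc_def)
    qed
    then have "mpower R \<alpha> \<ominus>\<^bsub>P\<^esub> trunc \<Delta> r \<in> I" using r by simp
    moreover have "mpower R \<alpha> \<ominus>\<^bsub>P\<^esub> trunc \<Delta> (T \<alpha>) \<in> I"
      using corr \<alpha> by (simp add: corresponds_trunc)
    ultimately have "T \<alpha> \<beta> = r \<beta>"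
      using \<alpha> \<beta> e r(1) by (intro trunc_unique[OF I, of "mpower R \<alpha>" "T \<alpha>" r]) auto
    moreover have "\<not> lt \<beta> \<alpha>" using l lt_trans[of \<alpha> \<beta> \<alpha>] lt_irrefl e by blast
    ultimately show ?thesis using r(2)[of \<beta>] by auto
  qed
qed

end

section \<open>Families compatible with the order and their Groebner bases\<close>

locale order_family = order_ring + mult_family_ring +
  assumes vanish: "\<And>\<alpha> \<beta>. \<alpha> \<in> M \<Longrightarrow> \<beta> \<in> \<Delta> \<Longrightarrow> lt \<alpha> \<beta> \<Longrightarrow> T \<alpha> \<beta> = \<zero>"
begin

text \<open>A corner is not in \<Delta>, so by totality the elements of \<Delta> that are left out
  lie above it, where T vanishes.\<close>

lemma rewrite_poly_lt:
  assumes \<alpha>: "\<alpha> \<in> corners n \<Delta>"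
  shows "rewrite_poly n R {\<beta>\<in>\<Delta>. lt \<beta> \<alpha>} T \<alpha> = rewrite_poly n R \<Delta> T \<alpha>"
proof -
  have M: "\<alpha> \<in> M" by (rule corners_M[OF \<alpha>])
  have e: "\<alpha> \<in> expos n" "\<alpha> \<notin> \<Delta>" using \<alpha> by (auto simp: corners_def)
  have "T \<alpha> m = \<zero>" if "m \<in> \<Delta>" "\<not> lt m \<alpha>" for m
    using that M e lt_total[of \<alpha> m] \<Delta>_expos vanish[of \<alpha> m] by blast
  then have "trunc {\<beta>\<in>\<Delta>. lt \<beta> \<alpha>} (T \<alpha>) = trunc \<Delta> (T \<alpha>)"
    by (intro ext) (auto simp: trunc_def)
  then show ?thesis using M by (subst (1 2) rewrite_poly_trunc) auto
qed

lemma corner_reducible_idealU_lt: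
  assumes "ideal J P" "\<And>\<alpha>. \<alpha> \<in> corners n \<Delta> \<Longrightarrow> rewrite_poly n R {\<beta>\<in>\<Delta>. lt \<beta> \<alpha>} T \<alpha> \<in> J"
    and "\<alpha> \<in> expos n" "\<alpha> \<notin> \<Delta>"
  shows "mpower R \<alpha> \<in> reducible J {\<beta>\<in>\<Delta>. lt \<beta> \<alpha>}"
proof (rule corner_reducible[OF assms(1) _ assms(3,4)])
  fix c assume c: "c \<in> corners n \<Delta>"
  show "mpower R c \<in> reducible J {\<beta>\<in>\<Delta>. lt \<beta> c}"
    by (rule reducible_rewrite_poly[OF assms(1), of _ T]) (use c corners_M assms(2) M_expos in auto)
qed

lemma rewrite_poly_lt_closed:
  "\<alpha> \<in> corners n \<Delta> \<Longrightarrow> rewrite_poly n R {\<beta>\<in>\<Delta>. lt \<beta> \<alpha>} T \<alpha> \<in> carrier P"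
  using corners_M M_expos by (intro rewrite_poly_closed) auto

text \<open>At a corner both ideals have the same generator, so one contains the other. Division by
  corners gives spanning for the smaller ideal, and independence comes from the larger one.\<close>

lemma idealU_lt_eq: "idealU_lt n lt \<Delta> R T = idealU n \<Delta> M R T"
proof (rule basis_ideal_eq[OF _ idealU_basis])
  let ?G = "(\<lambda>\<alpha>. rewrite_poly n R {\<beta>\<in>\<Delta>. lt \<beta> \<alpha>} T \<alpha>) ` corners n \<Delta>"
  have G: "?G \<subseteq> carrier P" using rewrite_poly_lt_closed by blast
  have J: "ideal (idealU_lt n lt \<Delta> R T) P"
    unfolding idealU_lt_def by (rule P.genideal_ideal[OF G])
  have gen: "rewrite_poly n R {\<beta>\<in>\<Delta>. lt \<beta> \<alpha>} T \<alpha> \<in> idealU_lt n lt \<Delta> R T" if "\<alpha> \<in> corners n \<Delta>" for \<alpha>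
    unfolding idealU_lt_def using P.genideal_self[OF G] that by blast
  have "?G \<subseteq> idealU n \<Delta> M R T"
    using rewrite_poly_lt idealU_gen corners_M by auto
  then show sub: "idealU_lt n lt \<Delta> R T \<subseteq> idealU n \<Delta> M R T"
    unfolding idealU_lt_def[of n lt] by (rule P.genideal_minimal[OF idealU_ideal])
  show "basis_ideal n \<Delta> R (idealU_lt n lt \<Delta> R T)"
  proof (rule basis_idealI[OF J])
    fix \<gamma> i assume \<gamma>: "\<gamma> \<in> \<Delta>" "i < n"
    have e: "\<gamma> + unit_expo i \<in> expos n" using \<gamma> \<Delta>_step M_expos by blast
    show "mpower R (\<gamma> + unit_expo i) \<in> reducible (idealU_lt n lt \<Delta> R T) \<Delta>"
    proof (cases "\<gamma> + unit_expo i \<in> \<Delta>")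
      case True
      then show ?thesis using e
        by (intro reducible_self[OF J]) (auto simp: mpower_def mterm_apply split: if_splits)
    next
      case False
      show ?thesis
        by (rule reducible_mono[OF corner_reducible_idealU_lt[OF J gen e False]]) auto
    qed
  next
    show "r = \<zero>\<^bsub>P\<^esub>" if "r \<in> idealU_lt n lt \<Delta> R T" "{m. r m \<noteq> \<zero>} \<subseteq> \<Delta>" for r
      using that sub idealU_basis unfolding basis_ideal_def by blast
  qed
qed

text \<open>Each summand of the recursion vanishes: if \<gamma> is above m, the first factor does by
  induction; otherwise \<gamma> + e_i is at most m + e_i, hence below \<beta>, and the second factor
  is an entry of T that vanishes.\<close>

lemma nf_vanish:
  assumes "\<alpha> \<in> expos n" "\<beta> \<in> \<Delta>" "lt \<alpha> \<beta>" shows "nf \<alpha> \<beta> = \<zero>"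
  using assms
proof (induction arbitrary: \<beta> rule: monomials_induct)
  case zero
  then show ?case using lt_irrefl[of 0] by (auto simp: nf_zero)
next
  case (add m i)
  have i: "i < n" using add by simp
  have \<beta>e: "\<beta> \<in> expos n" using add \<Delta>_expos by blast
  have l: "lt (m + unit_expo i) \<beta>" using add by (simp add: unit_expo_def)
  have me: "m + unit_expo i \<in> expos n" using add i by (simp add: monomials_add unit_expo_expos)
  have "nf (unit_expo i + m) \<beta> = (\<Oplus>\<gamma>\<in>\<Delta>. nf m \<gamma> \<otimes> T (\<gamma> + unit_expo i) \<beta>)"
    by (rule nf_apply) (use add i in auto)
  also have "\<dots> = \<zero>"
  proof (rule finsum_eq_zero)
    fix \<gamma> assume \<gamma>: "\<gamma> \<in> \<Delta>"
    have \<gamma>e: "\<gamma> \<in> expos n" and \<gamma>M: "\<gamma> + unit_expo i \<in> M" using \<gamma> \<Delta>_expos \<Delta>_step i by auto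
    have Tc: "T (\<gamma> + unit_expo i) \<beta> \<in> carrier R" using \<gamma>M add by simp
    have nc: "nf m \<gamma> \<in> carrier R" using nf_closed add by blast
    show "nf m \<gamma> \<otimes> T (\<gamma> + unit_expo i) \<beta> = \<zero>"
    proof (cases "lt m \<gamma>")
      case True
      then show ?thesis using add.IH[OF \<gamma>] Tc by simp
    next
      case False
      then have "\<gamma> = m \<or> lt \<gamma> m" using lt_total \<gamma>e add.hyps by blast
      then have "\<gamma> + unit_expo i = m + unit_expo i \<or> lt (\<gamma> + unit_expo i) (m + unit_expo i)"
        using lt_add \<gamma>e add.hyps unit_expo_expos[OF i] by blast
      then have "lt (\<gamma> + unit_expo i) \<beta>"
        using l lt_trans[OF _ l _ me \<beta>e] \<gamma>M M_expos by auto
      then show ?thesis using vanish[OF \<gamma>M] add nc by simp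
    qed
  qed
  finally show ?case by (simp add: unit_expo_def ab_semigroup_add_class.add.commute)
qed

lemma lead_expo_eq:
  assumes p: "p \<in> carrier P" and \<alpha>: "p \<alpha> \<noteq> \<zero>" and max: "\<And>\<beta>. p \<beta> \<noteq> \<zero> \<Longrightarrow> \<beta> \<noteq> \<alpha> \<Longrightarrow> lt \<beta> \<alpha>"
  shows "lead_expo lt R p = \<alpha>"
  unfolding lead_expo_def
proof (rule the_equality)
  show "p \<alpha> \<noteq> \<zero> \<and> (\<forall>\<beta>. p \<beta> \<noteq> \<zero> \<and> \<beta> \<noteq> \<alpha> \<longrightarrow> lt \<beta> \<alpha>)" using \<alpha> max by blast
  fix \<gamma> assume \<gamma>: "p \<gamma> \<noteq> \<zero> \<and> (\<forall>\<beta>. p \<beta> \<noteq> \<zero> \<and> \<beta> \<noteq> \<gamma> \<longrightarrow> lt \<beta> \<gamma>)"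
  have e: "\<alpha> \<in> expos n" "\<gamma> \<in> expos n" using coeff_outside[OF p] \<alpha> \<gamma> by blast+
  show "\<gamma> = \<alpha>"
  proof (rule ccontr)
    assume "\<gamma> \<noteq> \<alpha>"
    then have "lt \<gamma> \<alpha>" "lt \<alpha> \<gamma>" using \<alpha> max \<gamma> by auto
    then show False using lt_trans[of \<alpha> \<gamma> \<alpha>] lt_irrefl e by blast
  qed
qed

lemma lead_expo_exists:
  assumes p: "p \<in> carrier P" and nz: "p \<noteq> (\<lambda>_. \<zero>)"
  shows "p (lead_expo lt R p) \<noteq> \<zero>" "\<And>\<beta>. p \<beta> \<noteq> \<zero> \<Longrightarrow> \<beta> \<noteq> lead_expo lt R p \<Longrightarrow> lt \<beta> (lead_expo lt R p)"
    "lead_expo lt R p \<in> expos n"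
proof -
  let ?S = "{m. p m \<noteq> \<zero>}"
  have S: "finite ?S" "?S \<noteq> {}" "?S \<subseteq> expos n" using p nz finite_support coeff_outside by blast+
  have "asymp_on ?S lt" "transp_on ?S lt"
    using S(3) lt_irrefl lt_trans by (intro asymp_onI transp_onI; blast)+
  then obtain \<alpha> where \<alpha>: "\<alpha> \<in> ?S" "\<forall>x\<in>?S. x \<noteq> \<alpha> \<longrightarrow> \<not> lt \<alpha> x"
    using Finite_Set.bex_max_element[OF S(1)] S(2) by blast
  have max: "lt \<beta> \<alpha>" if "p \<beta> \<noteq> \<zero>" "\<beta> \<noteq> \<alpha>" for \<beta>
    using \<alpha> that lt_total[of \<alpha> \<beta>] S(3) by blast
  have eq: "lead_expo lt R p = \<alpha>" using \<alpha>(1) max by (intro lead_expo_eq[OF p]) auto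
  show "p (lead_expo lt R p) \<noteq> \<zero>" "\<And>\<beta>. p \<beta> \<noteq> \<zero> \<Longrightarrow> \<beta> \<noteq> lead_expo lt R p \<Longrightarrow> lt \<beta> (lead_expo lt R p)"
    "lead_expo lt R p \<in> expos n"
    unfolding eq using \<alpha>(1) max S(3) by auto
qed

text \<open>If the leading exponent were some \<alpha> in \<Delta>, the functional at \<alpha> would
  see the leading coefficient alone, because smaller monomials have no x^\<alpha> in their
  expansion. But this functional kills the ideal.\<close>

lemma lead_expo_not_\<Delta>:
  assumes p: "p \<in> idealU n \<Delta> M R T" and nz: "p \<noteq> (\<lambda>_. \<zero>)"
  shows "lead_expo lt R p \<notin> \<Delta>"
proof
  let ?\<alpha> = "lead_expo lt R p" and ?S = "{m. p m \<noteq> \<zero>}"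
  assume \<Delta>: "?\<alpha> \<in> \<Delta>"
  have pc: "p \<in> carrier P" and ker: "nf_coeff ?\<alpha> p = \<zero>"
    using p \<Delta> unfolding idealU_nf_ker nf_ker_def by auto
  note lead = lead_expo_exists[OF pc nz]
  have S: "finite ?S" "?S \<subseteq> expos n" using pc finite_support coeff_outside by blast+
  have "nf_coeff ?\<alpha> p = (\<Oplus>m\<in>?S. p m \<otimes> nf m ?\<alpha>)" by (simp add: lin_ext_def)
  also have "\<dots> = p ?\<alpha> \<otimes> nf ?\<alpha> ?\<alpha>"
  proof (rule finsum_single[where f = "\<lambda>m. p m \<otimes> nf m ?\<alpha>"])
    show "p m \<otimes> nf m ?\<alpha> = \<zero>" if "m \<in> ?S" "m \<noteq> ?\<alpha>" for m
      using that lead(2)[of m] nf_vanish[of m ?\<alpha>] \<Delta> S(2) pc by auto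
    show "p ?\<alpha> \<otimes> nf ?\<alpha> ?\<alpha> \<in> carrier R" using coeff_closed[OF pc] nf_closed[OF lead(3)] by (intro m_closed) auto
  qed (use lead S in auto)
  also have "\<dots> = p ?\<alpha>" using \<Delta> \<Delta>_M pc by (subst nf_eq_T) (auto simp: T_delta)
  finally show False using ker lead(1) by simp
qed

lemma lead_expo_monic:
  assumes ne: "\<one> \<noteq> \<zero>" and \<alpha>: "\<alpha> \<in> expos n" and r: "r \<in> carrier P" "\<And>m. r m \<noteq> \<zero> \<Longrightarrow> lt m \<alpha>"
  defines "p \<equiv> mpower R \<alpha> \<ominus>\<^bsub>P\<^esub> r"
  shows "p \<noteq> (\<lambda>_. \<zero>)" "lead_expo lt R p = \<alpha>" "p \<alpha> = \<one>"
proof -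
  have ap: "p m = (if m = \<alpha> then \<one> else \<zero>) \<ominus> r m" for m
    unfolding p_def using \<alpha> r(1) by (simp add: P_minus_apply) (simp add: mpower_def mterm_apply)
  have pc: "p \<in> carrier P" unfolding p_def using \<alpha> r by simp
  have r0: "r \<alpha> = \<zero>" using r(2) lt_irrefl[OF \<alpha>] by blast
  show 1: "p \<alpha> = \<one>" by (simp add: ap r0 minus_eq)
  then show "p \<noteq> (\<lambda>_. \<zero>)" using ne by auto
  show "lead_expo lt R p = \<alpha>"
  proof (rule lead_expo_eq[OF pc])
    show "lt \<beta> \<alpha>" if "p \<beta> \<noteq> \<zero>" "\<beta> \<noteq> \<alpha>" for \<beta>
      using that r by (intro r(2)) (auto simp: ap minus_eq)
  qed (use 1 ne in simp)
qed

text \<open>Each \<alpha> outside of \<Delta> is realized by x^\<alpha> minus a remainder with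
  exponents below \<alpha>; it is a leading exponent because 1 \<noteq> 0.\<close>

lemma lead_expos_idealU:
  assumes ne: "\<one> \<noteq> \<zero>"
  shows "lead_expos lt R (idealU n \<Delta> M R T) = expos n - \<Delta>"
proof (intro subset_antisym subsetI)
  fix \<alpha> assume "\<alpha> \<in> lead_expos lt R (idealU n \<Delta> M R T)"
  then obtain p where p: "p \<in> idealU n \<Delta> M R T" "p \<noteq> (\<lambda>_. \<zero>)" "\<alpha> = lead_expo lt R p"
    unfolding lead_expos_def by blast
  have "p \<in> carrier P" using p(1) unfolding idealU_nf_ker nf_ker_def by blast
  then show "\<alpha> \<in> expos n - \<Delta>" using lead_expo_not_\<Delta>[OF p(1,2)] lead_expo_exists(3) p by blast
next
  fix \<alpha> assume \<alpha>: "\<alpha> \<in> expos n - \<Delta>"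
  have "mpower R \<alpha> \<in> reducible (idealU n \<Delta> M R T) {\<beta>\<in>\<Delta>. lt \<beta> \<alpha>}"
    using rewrite_poly_lt idealU_gen corners_M \<alpha> by (intro corner_reducible_idealU_lt[OF idealU_ideal]) auto
  then obtain r where r: "r \<in> carrier P" "\<And>m. r m \<noteq> \<zero> \<Longrightarrow> m \<in> {\<beta>\<in>\<Delta>. lt \<beta> \<alpha>}"
      "mpower R \<alpha> \<ominus>\<^bsub>P\<^esub> r \<in> idealU n \<Delta> M R T"
    by (rule reducibleE) (rule that)
  have rl: "lt m \<alpha>" if "r m \<noteq> \<zero>" for m using r(2)[OF that] by simp
  have \<alpha>e: "\<alpha> \<in> expos n" using \<alpha> by blast
  show "\<alpha> \<in> lead_expos lt R (idealU n \<Delta> M R T)"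
    unfolding lead_expos_def using lead_expo_monic(1,2)[OF ne \<alpha>e r(1) rl] r(3)
    by (intro image_eqI[of _ _ "mpower R \<alpha> \<ominus>\<^bsub>P\<^esub> r"]) auto
qed

text \<open>Over the zero ring every polynomial is 0. There are no leading exponents, so the
  attached standard set is all of the exponents and has no corners, whatever \<Delta> is. The basis
  elements equal 0 and count as monic since 1 = 0.\<close>

lemma reduced_groebner_basis_zero_ring:
  assumes z: "\<one> = \<zero>"
  shows "reduced_groebner_basis n lt R (idealU n \<Delta> M R T)
    ((\<lambda>\<alpha>. rewrite_poly n R {\<beta>\<in>\<Delta>. lt \<beta> \<alpha>} T \<alpha>) ` corners n \<Delta>)" (is "reduced_groebner_basis n lt R ?I ?G")
proof -
  have c: "carrier R = {\<zero>}" using z by (rule one_zeroD)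
  have zero: "p = (\<lambda>_. \<zero>)" if "p \<in> carrier P" for p
    using coeff_closed[OF that] unfolding c by auto
  have P0: "(\<lambda>_. \<zero>) \<in> carrier P" using P.zero_closed by (simp add: mpoly_ring_simps)
  have id0: "I = {\<lambda>_. \<zero>}" if "ideal I P" for I
  proof -
    interpret I: ideal I P by (rule that)
    have "\<zero>\<^bsub>P\<^esub> \<in> I" by simp
    then have "(\<lambda>_. \<zero>) \<in> I" by (simp only: mpoly_ring_simps)
    moreover have "p = (\<lambda>_. \<zero>)" if "p \<in> I" for p by (rule zero[OF I.Icarr[OF that]])
    ultimately show ?thesis by (intro Set.set_eqI) (metis singleton_iff)
  qed
  have G0: "g = (\<lambda>_. \<zero>)" if "g \<in> ?G" for g 
    using that
  proof
    fix \<alpha> assume "\<alpha> \<in> corners n \<Delta>" "g = rewrite_poly n R {\<beta>\<in>\<Delta>. lt \<beta> \<alpha>} T \<alpha>"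
    then show ?thesis using zero[OF rewrite_poly_lt_closed] by simp
  qed
  have I0: "?I = {\<lambda>_. \<zero>}" by (rule id0[OF idealU_ideal])
  have lt0: "lead_term lt R (\<lambda>_. \<zero>) = (\<lambda>_. \<zero>)" by (auto simp: lead_term_def lead_cf_def mterm_apply)
  have lG: "lead_term lt R ` ?G \<subseteq> carrier P" 
  proof (rule image_subsetI)
    fix g assume "g \<in> ?G"
    then show "lead_term lt R g \<in> carrier P" using G0[of g] lt0 P0 by simp
  qed
  have "corners n (expos n) = {}" by (simp add: corners_def)
  moreover have le: "lead_expos lt R ?G = {}" "lead_expos lt R ?I = {}"
    using G0 I0 by (auto simp: lead_expos_def)
  ultimately have "lead_expos lt R ?G = corners n (attached_std_set n lt R ?I)"
    by (simp add: attached_std_set_def)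
  moreover have "groebner_basis n lt R ?I ?G"
    unfolding groebner_basis_def
  proof (intro conjI)
    show "finite ?G" using finite_corners by simp
    show "?G \<subseteq> ?I" using G0 I0 by auto
    have "Idl\<^bsub>P\<^esub> (lead_term lt R ` ?G) = {\<lambda>_. \<zero>}" by (rule id0[OF P.genideal_ideal[OF lG]])
    moreover have "Idl\<^bsub>P\<^esub> (lead_term lt R ` (?I - {\<lambda>_. \<zero>})) = {\<lambda>_. \<zero>}"
      by (rule id0[OF P.genideal_ideal]) (simp add: I0)
    ultimately show "Idl\<^bsub>P\<^esub> (lead_term lt R ` ?G) = Idl\<^bsub>P\<^esub> (lead_term lt R ` (?I - {\<lambda>_. \<zero>}))"
      by simp
  qed
  moreover have "lead_cf lt R g = \<one>" if "g \<in> ?G" for g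
    using G0[OF that] z by (simp add: lead_cf_def)
  moreover have "g \<beta> = \<zero>" if "g \<in> ?G" for g \<beta> using G0[OF that] by simp
  ultimately show ?thesis unfolding reduced_groebner_basis_def by blast
qed

text \<open>The leading exponents of the ideal are the exponents outside of \<Delta>. Each is
  divisible by a corner, whose polynomial is monic with that corner as leading exponent, while all
  its other exponents lie in \<Delta>.\<close>

lemma reduced_groebner_basis_idealU:
  "reduced_groebner_basis n lt R (idealU n \<Delta> M R T)
    ((\<lambda>\<alpha>. rewrite_poly n R {\<beta>\<in>\<Delta>. lt \<beta> \<alpha>} T \<alpha>) ` corners n \<Delta>)" (is "reduced_groebner_basis n lt R ?I ?G")
proof (cases "\<one> = \<zero>")
  case True
  then show ?thesis by (rule reduced_groebner_basis_zero_ring)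
next
  case ne: False
  let ?g = "\<lambda>\<alpha>. rewrite_poly n R {\<beta>\<in>\<Delta>. lt \<beta> \<alpha>} T \<alpha>"
  have ce: "c \<in> expos n" "c \<notin> \<Delta>" if "c \<in> corners n \<Delta>" for c using that by (auto simp: corners_def)
  have g: "?g c \<noteq> (\<lambda>_. \<zero>)" "lead_expo lt R (?g c) = c" "?g c c = \<one>" if c: "c \<in> corners n \<Delta>" for c
  proof -
    have cM: "c \<in> M" by (rule corners_M[OF c])
    have rw: "?g c = mpower R c \<ominus>\<^bsub>P\<^esub> trunc {\<beta>\<in>\<Delta>. lt \<beta> c} (T c)"
      by (rule rewrite_poly_trunc) (use cM in auto)
    have t: "trunc {\<beta>\<in>\<Delta>. lt \<beta> c} (T c) \<in> carrier P" by (rule trunc_closed) (use cM in auto)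
    have l: "lt m c" if "trunc {\<beta>\<in>\<Delta>. lt \<beta> c} (T c) m \<noteq> \<zero>" for m
      using that by (auto simp: trunc_def split: if_splits)
    show "?g c \<noteq> (\<lambda>_. \<zero>)" "lead_expo lt R (?g c) = c" "?g c c = \<one>"
      unfolding rw by (rule lead_expo_monic[OF ne ce(1)[OF c] t l]; assumption)+
  qed
  have std: "attached_std_set n lt R ?I = \<Delta>"
    unfolding attached_std_set_def lead_expos_idealU[OF ne] using \<Delta>_expos by blast
  have cf: "lead_cf lt R (?g c) = \<one>" if "c \<in> corners n \<Delta>" for c
    using g[OF that] by (simp add: lead_cf_def)
  have lterm: "lead_term lt R (?g c) = mpower R c" if "c \<in> corners n \<Delta>" for c
    using g[OF that] cf[OF that] by (simp add: lead_term_def mpower_def)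
  have GI: "?G \<subseteq> ?I" using rewrite_poly_lt idealU_gen corners_M by auto
  have Ic: "p \<in> carrier P" if "p \<in> ?I" for p using that unfolding idealU_nf_ker nf_ker_def by blast
  have lI: "lead_term lt R ` (?I - {\<lambda>_. \<zero>}) \<subseteq> carrier P"
  proof (rule image_subsetI)
    fix p assume p: "p \<in> ?I - {\<lambda>_. \<zero>}"
    then have "p \<in> carrier P" "p \<noteq> (\<lambda>_. \<zero>)" using Ic by auto
    then show "lead_term lt R p \<in> carrier P"
      using lead_expo_exists(3)[of p] by (simp add: lead_term_def lead_cf_def)
  qed
  have sub: "lead_term lt R ` ?G \<subseteq> lead_term lt R ` (?I - {\<lambda>_. \<zero>})" 
  proof (rule image_mono, rule subsetI)
    fix q assume q: "q \<in> ?G"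
    then have "q \<noteq> (\<lambda>_. \<zero>)" using g(1) by auto
    then show "q \<in> ?I - {\<lambda>_. \<zero>}" using GI q by auto
  qed
  then have lG: "lead_term lt R ` ?G \<subseteq> carrier P" using lI by blast
  have gb: "groebner_basis n lt R ?I ?G"
    unfolding groebner_basis_def
  proof (intro conjI subset_antisym)
    show "finite ?G" using finite_corners by simp
    show "?G \<subseteq> ?I" by (rule GI)
    show "Idl\<^bsub>P\<^esub> (lead_term lt R ` ?G) \<subseteq> Idl\<^bsub>P\<^esub> (lead_term lt R ` (?I - {\<lambda>_. \<zero>}))"
      using sub P.genideal_self[OF lI] by (intro P.genideal_minimal P.genideal_ideal[OF lI]) blast
    show "Idl\<^bsub>P\<^esub> (lead_term lt R ` (?I - {\<lambda>_. \<zero>})) \<subseteq> Idl\<^bsub>P\<^esub> (lead_term lt R ` ?G)"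
    proof (rule P.genideal_minimal[OF P.genideal_ideal[OF lG]], rule subsetI)
      fix q assume "q \<in> lead_term lt R ` (?I - {\<lambda>_. \<zero>})"
      then obtain p where p: "p \<in> ?I" "p \<noteq> (\<lambda>_. \<zero>)" "q = lead_term lt R p" by blast
      have pc: "p \<in> carrier P" by (rule Ic[OF p(1)])
      let ?\<alpha> = "lead_expo lt R p"
      have "?\<alpha> \<in> expos n - \<Delta>" using lead_expo_exists(3)[OF pc p(2)] lead_expo_not_\<Delta>[OF p(1,2)] by blast
      then obtain c \<gamma> where c: "c \<in> corners n \<Delta>" "\<gamma> \<in> expos n" "?\<alpha> = \<gamma> + c" by (rule corner_dvd)
      \<comment> \<open>The leading coefficient of p may be any nonzero element of R. It goes into
        the cofactor, which works because the corner polynomial is monic.\<close>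
      have "q = mterm R (p ?\<alpha>) (\<gamma> + c)" using p c by (simp add: lead_term_def lead_cf_def)
      also have "\<dots> = mterm R (p ?\<alpha>) \<gamma> \<otimes>\<^bsub>P\<^esub> mpower R c"
        unfolding mpower_def using mterm_mult[of "p ?\<alpha>" \<one> c \<gamma>] pc ce(1)[OF c(1)] by simp
      finally have q: "q = mterm R (p ?\<alpha>) \<gamma> \<otimes>\<^bsub>P\<^esub> mpower R c" .
      have "lead_term lt R (?g c) \<in> lead_term lt R ` ?G" using c(1) by (intro imageI)
      then have "mpower R c \<in> Idl\<^bsub>P\<^esub> (lead_term lt R ` ?G)"
        using P.genideal_self[OF lG] unfolding lterm[OF c(1)] by (rule rev_subsetD)
      then show "q \<in> Idl\<^bsub>P\<^esub> (lead_term lt R ` ?G)"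
        unfolding q using pc c(2) by (intro ideal.I_l_closed[OF P.genideal_ideal[OF lG]]) auto
    qed
  qed
  have le: "lead_expos lt R ?G = corners n \<Delta>"
  proof -
    have "?G - {\<lambda>_. \<zero>} = ?G" using g(1) by auto
    then show ?thesis using g(2) by (simp add: lead_expos_def image_image)
  qed
  have nl: "\<beta> \<in> \<Delta>" if c: "c \<in> corners n \<Delta>" and \<beta>: "?g c \<beta> \<noteq> \<zero>" "\<beta> \<noteq> lead_expo lt R (?g c)" for c \<beta>
  proof (rule ccontr)
    assume "\<beta> \<notin> \<Delta>"
    moreover have "\<beta> \<noteq> c" using \<beta>(2) g(2)[OF c] by simp
    moreover have "?g c \<beta> = (if \<beta> = c then \<one> else \<zero>) \<ominus> (if \<beta> \<in> {\<beta>\<in>\<Delta>. lt \<beta> c} then T c \<beta> else \<zero>)"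
      by (rule rewrite_poly_apply) (use ce[OF c] corners_M[OF c] in auto)
    ultimately show False using \<beta>(1) by (simp add: minus_eq)
  qed
  show ?thesis
    unfolding reduced_groebner_basis_def std le using gb cf nl by auto
qed

end

lemma order_familyI:
  assumes "order_data n \<Delta> M lt" "cring B" "zero_family n \<Delta> M lt B T"
  shows "order_family n \<Delta> M B lt T"
  using assms unfolding order_data_def zero_family_def
  by (intro order_family.intro order_ring.intro mult_family_ring.intro hilb_ringI assms(1)
      mult_family_ring_axioms.intro order_family_axioms.intro) auto

lemma Hilb_lt_iff:
  fixes B :: "'b ring"
  assumes D: "order_data n \<Delta> M lt" and B: "cring B"
  shows "I \<in> Hilb_lt n lt \<Delta> B \<longleftrightarrow> (\<exists>T. zero_family n \<Delta> M lt B T \<and> I = idealU n \<Delta> M B T)"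
proof -
  have D': "hilb_data n \<Delta> M" using D by (simp add: order_data_def)
  interpret order_ring n \<Delta> M B lt by (intro order_ring.intro hilb_ringI D D' B)
  \<comment> \<open>The Groebner basis is written with plus signs and the rewriting polynomials with
    minus signs. Hence the coefficients d correspond to -T in both directions.\<close>
  have sum: "mpower B \<alpha> \<oplus>\<^bsub>P\<^esub> (\<Oplus>\<^bsub>P\<^esub>\<beta>\<in>{\<beta>\<in>\<Delta>. lt \<beta> \<alpha>}. mterm B (c \<beta>) \<beta>)
      = mpower B \<alpha> \<ominus>\<^bsub>P\<^esub> trunc {\<beta>\<in>\<Delta>. lt \<beta> \<alpha>} (\<lambda>\<beta>. \<ominus>\<^bsub>B\<^esub> c \<beta>)"
    if "\<alpha> \<in> expos n" "\<And>\<beta>. \<beta> \<in> \<Delta> \<Longrightarrow> c \<beta> \<in> carrier B" for \<alpha> c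
  proof
    fix m
    have t: "trunc {\<beta>\<in>\<Delta>. lt \<beta> \<alpha>} (\<lambda>\<beta>. \<ominus>\<^bsub>B\<^esub> c \<beta>) \<in> carrier P"
      by (rule trunc_closed) (use that in auto)
    have s: "(\<Oplus>\<^bsub>P\<^esub>\<beta>\<in>{\<beta>\<in>\<Delta>. lt \<beta> \<alpha>}. mterm B (c \<beta>) \<beta>) = trunc {\<beta>\<in>\<Delta>. lt \<beta> \<alpha>} c"
      by (rule trunc_finsum) (use that in auto)
    show "(mpower B \<alpha> \<oplus>\<^bsub>P\<^esub> (\<Oplus>\<^bsub>P\<^esub>\<beta>\<in>{\<beta>\<in>\<Delta>. lt \<beta> \<alpha>}. mterm B (c \<beta>) \<beta>)) m
      = (mpower B \<alpha> \<ominus>\<^bsub>P\<^esub> trunc {\<beta>\<in>\<Delta>. lt \<beta> \<alpha>} (\<lambda>\<beta>. \<ominus>\<^bsub>B\<^esub> c \<beta>)) m"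
      unfolding s P_add_apply P_minus_apply[OF mpower_closed[OF that(1)] t]
      using that by (simp add: trunc_def minus_eq)
  qed
  have ce: "\<alpha> \<in> expos n" if "\<alpha> \<in> corners n \<Delta>" for \<alpha> using that by (simp add: corners_def)
  show ?thesis
  proof
    assume I: "I \<in> Hilb_lt n lt \<Delta> B"
    have basis: "basis_ideal n \<Delta> B I"
      using I hilb_ring_Hilb[OF hilb_ringI[OF D' B]] by (simp add: Hilb_lt_def)
    obtain d where d: "\<forall>\<alpha>\<in>corners n \<Delta>. \<forall>\<beta>\<in>\<Delta>. d \<alpha> \<beta> \<in> carrier B"
      "reduced_groebner_basis n lt B I
         ((\<lambda>\<alpha>. mpower B \<alpha> \<oplus>\<^bsub>P\<^esub> (\<Oplus>\<^bsub>P\<^esub>\<beta>\<in>{\<beta>\<in>\<Delta>. lt \<beta> \<alpha>}. mterm B (d \<alpha> \<beta>) \<beta>)) ` corners n \<Delta>)"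
      using I unfolding Hilb_lt_def by blast
    obtain T where T: "\<And>\<alpha> \<beta>. \<alpha> \<in> M \<Longrightarrow> \<beta> \<in> \<Delta> \<Longrightarrow> T \<alpha> \<beta> \<in> carrier B" "corresponds n \<Delta> M B T I"
      using basis_ideal_corresponds[OF basis] by blast
    have mf: "mult_family n \<Delta> M B T" by (rule mult_familyI[OF basis T])
    have "zero_family n \<Delta> M lt B T"
    proof (rule corner_reducible_zero_family[OF basis mf T(2)])
      fix c assume c: "c \<in> corners n \<Delta>"
      let ?r = "trunc {\<beta>\<in>\<Delta>. lt \<beta> c} (\<lambda>\<beta>. \<ominus>\<^bsub>B\<^esub> d c \<beta>)"
      have "mpower B c \<oplus>\<^bsub>P\<^esub> (\<Oplus>\<^bsub>P\<^esub>\<beta>\<in>{\<beta>\<in>\<Delta>. lt \<beta> c}. mterm B (d c \<beta>) \<beta>) \<in> I"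
        using d(2) c unfolding reduced_groebner_basis_def groebner_basis_def by blast
      then have "mpower B c \<ominus>\<^bsub>P\<^esub> ?r \<in> I" using sum[OF ce[OF c], of "d c"] d(1) c by simp
      then show "mpower B c \<in> reducible I {\<beta>\<in>\<Delta>. lt \<beta> c}"
        using d(1) c ce[OF c]
        by (intro reducibleI[of _ ?r] trunc_closed) (auto simp: trunc_def split: if_splits)
    qed
    then show "\<exists>T. zero_family n \<Delta> M lt B T \<and> I = idealU n \<Delta> M B T"
      using idealU_unique[OF basis mf T(2)] by blast
  next
    assume "\<exists>T. zero_family n \<Delta> M lt B T \<and> I = idealU n \<Delta> M B T"
    then obtain T where T: "zero_family n \<Delta> M lt B T" and I: "I = idealU n \<Delta> M B T" by blast
    have mf: "mult_family n \<Delta> M B T" using T by (simp add: zero_family_def)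
    interpret T: order_family n \<Delta> M B lt T by (rule order_familyI[OF D B T])
    have "rewrite_poly n B {\<beta>\<in>\<Delta>. lt \<beta> \<alpha>} T \<alpha>
        = mpower B \<alpha> \<oplus>\<^bsub>P\<^esub> (\<Oplus>\<^bsub>P\<^esub>\<beta>\<in>{\<beta>\<in>\<Delta>. lt \<beta> \<alpha>}. mterm B (\<ominus>\<^bsub>B\<^esub> T \<alpha> \<beta>) \<beta>)"
      if "\<alpha> \<in> corners n \<Delta>" for \<alpha>
    proof -
      have M: "\<alpha> \<in> M" by (rule corners_M[OF that])
      have "trunc {\<beta>\<in>\<Delta>. lt \<beta> \<alpha>} (\<lambda>\<beta>. \<ominus>\<^bsub>B\<^esub> (\<ominus>\<^bsub>B\<^esub> T \<alpha> \<beta>)) = trunc {\<beta>\<in>\<Delta>. lt \<beta> \<alpha>} (T \<alpha>)"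
        using M by (intro ext) (simp add: trunc_def)
      then show ?thesis
        using sum[OF ce[OF that], of "\<lambda>\<beta>. \<ominus>\<^bsub>B\<^esub> T \<alpha> \<beta>"] M rewrite_poly_trunc[of "{\<beta>\<in>\<Delta>. lt \<beta> \<alpha>}" T \<alpha>]
        by simp
    qed
    then have eq: "(\<lambda>\<alpha>. rewrite_poly n B {\<beta>\<in>\<Delta>. lt \<beta> \<alpha>} T \<alpha>) ` corners n \<Delta>
        = (\<lambda>\<alpha>. mpower B \<alpha> \<oplus>\<^bsub>P\<^esub> (\<Oplus>\<^bsub>P\<^esub>\<beta>\<in>{\<beta>\<in>\<Delta>. lt \<beta> \<alpha>}. mterm B (\<ominus>\<^bsub>B\<^esub> T \<alpha> \<beta>) \<beta>)) ` corners n \<Delta>"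
      by (intro image_cong refl)
    have "basis_ideal n \<Delta> B I" unfolding I by (rule T.idealU_basis)
    then have "I \<in> Hilb n \<Delta> B" using hilb_ring_Hilb[OF hilb_ringI[OF D' B]] by blast
    moreover have "\<forall>\<alpha>\<in>corners n \<Delta>. \<forall>\<beta>\<in>\<Delta>. \<ominus>\<^bsub>B\<^esub> T \<alpha> \<beta> \<in> carrier B"
      using corners_M by simp
    ultimately show "I \<in> Hilb_lt n lt \<Delta> B"
      using T.reduced_groebner_basis_idealU unfolding eq I[symmetric] Hilb_lt_def mem_Collect_eq
      by (intro conjI exI[of _ "\<lambda>\<alpha> \<beta>. \<ominus>\<^bsub>B\<^esub> T \<alpha> \<beta>"])
  qed
qed

section \<open>Presentations of the coordinate rings\<close>

lemma hom_minus_eq_zero: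
  assumes P: "cring P" and Q: "cring Q" and h: "h \<in> ring_hom P Q"
    and "p \<in> carrier P" "q \<in> carrier P"
  shows "h (p \<ominus>\<^bsub>P\<^esub> q) = \<zero>\<^bsub>Q\<^esub> \<longleftrightarrow> h p = h q"
proof -
  interpret P: cring P by (rule P)
  interpret Q: cring Q by (rule Q)
  interpret h: ring_hom_cring P Q h by unfold_locales (rule h)
  have "h (p \<ominus>\<^bsub>P\<^esub> q) = h p \<ominus>\<^bsub>Q\<^esub> h q" using assms(4,5) by (simp add: a_minus_def)
  then show ?thesis using assms(4,5) by simp
qed

section \<open>Standard sets and their borders\<close>

lemma standard_set_down:
  "standard_set n N \<Longrightarrow> \<alpha> \<in> expos n \<Longrightarrow> \<gamma> \<in> expos n \<Longrightarrow> \<alpha> + \<gamma> \<in> N \<Longrightarrow> \<alpha> \<in> N"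
  unfolding standard_set_def by blast

lemma expo_split_unit:
  assumes "\<alpha> \<in> expos n" "Poly_Mapping.lookup \<alpha> i \<noteq> 0"
  obtains \<alpha>' where "\<alpha>' \<in> expos n" "\<alpha> = \<alpha>' + unit_expo i"
proof -
  define \<alpha>' where "\<alpha>' = \<alpha> - unit_expo i"
  have "\<alpha> = \<alpha>' + unit_expo i"
    by (rule poly_mapping_eqI)
      (use assms(2) in \<open>auto simp: \<alpha>'_def unit_expo_def lookup_add lookup_minus lookup_single when_def\<close>)
  then show thesis using assms(1) by (intro that[of \<alpha>']) (auto simp: monomials_add)
qed

text \<open>If \<alpha> + \<gamma> = \<beta> + e_i with \<beta> in N, then e_i can be taken off
  \<gamma> or off \<alpha>. In the first case \<alpha> divides \<beta> and lies in N; in the second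
  \<alpha> - e_i does, so \<alpha> lies in N or its border.\<close>

lemma standard_set_border:
  assumes N: "standard_set n N" shows "standard_set n (N \<union> border n N)"
  unfolding standard_set_def
proof (intro conjI ballI)
  have Ne: "N \<subseteq> expos n" using N by (simp add: standard_set_def)
  then show "N \<union> border n N \<subseteq> expos n"
    by (auto simp: border_def monomials_add unit_expo_expos)
  fix \<alpha> \<gamma> assume \<alpha>: "\<alpha> \<in> expos n - (N \<union> border n N)" and \<gamma>: "\<gamma> \<in> expos n"
  have e: "\<alpha> + \<gamma> \<in> expos n" using \<alpha> \<gamma> by (simp add: monomials_add)
  have nN: "\<alpha> + \<gamma> \<notin> N" using \<alpha> \<gamma> standard_set_down[OF N] by blast
  have "\<alpha> + \<gamma> \<notin> border n N"
  proof
    assume "\<alpha> + \<gamma> \<in> border n N"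
    then obtain \<beta> i where \<beta>: "\<beta> \<in> N" "i < n" "\<alpha> + \<gamma> = \<beta> + unit_expo i"
      by (auto simp: border_def)
    show False
    proof (cases "Poly_Mapping.lookup \<gamma> i = 0")
      case False
      then obtain \<gamma>' where g: "\<gamma>' \<in> expos n" "\<gamma> = \<gamma>' + unit_expo i" using expo_split_unit[OF \<gamma>] by blast
      then have "\<alpha> + \<gamma>' = \<beta>" using \<beta>(3) by (simp add: add.assoc[symmetric])
      then show False using \<alpha> \<beta>(1) g(1) standard_set_down[OF N] by blast
    next
      case True
      have "Poly_Mapping.lookup (\<alpha> + \<gamma>) i = Poly_Mapping.lookup (\<beta> + unit_expo i) i" using \<beta>(3) by simp
      then have "Poly_Mapping.lookup \<alpha> i \<noteq> 0" using True by (simp add: lookup_add unit_expo_def)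
      then obtain \<alpha>' where a: "\<alpha>' \<in> expos n" "\<alpha> = \<alpha>' + unit_expo i" using expo_split_unit[of \<alpha> n i] \<alpha> by blast
      then have "\<alpha>' + \<gamma> + unit_expo i = \<beta> + unit_expo i" using \<beta>(3) by (simp add: ac_simps)
      then have "\<alpha>' + \<gamma> = \<beta>" by simp
      then have "\<alpha>' \<in> N" using standard_set_down[OF N a(1) \<gamma>] \<beta>(1) by simp
      then have "\<alpha> \<in> N \<union> border n N" using a(2) \<beta>(2) by (auto simp: border_def)
      then show False using \<alpha> by blast
    qed
  qed
  then show "\<alpha> + \<gamma> \<in> expos n - (N \<union> border n N)" using e nN by blast
qed

lemma border_step: "\<alpha> \<in> N \<Longrightarrow> i < n \<Longrightarrow> \<alpha> + unit_expo i \<in> N \<union> border n N"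
  by (auto simp: border_def)

lemma standard_set_zero:
  assumes "standard_set n N" "\<alpha> \<in> N" shows "0 \<in> N"
  using standard_set_down[OF assms(1), of 0 \<alpha>] assms by (auto simp: standard_set_def)

lemma hilb_data_border:
  assumes "standard_set n \<Delta>" "finite \<Delta>" "\<Delta> \<noteq> {}" "standard_set n N" "\<Delta> \<subseteq> N"
  shows "hilb_data n \<Delta> (N \<union> border n N)"
proof
  show "0 \<in> \<Delta>" using assms(1,3) standard_set_zero by blast
  show "\<Delta> \<subseteq> expos n" using assms(1) by (simp add: standard_set_def)
  show "\<alpha> + unit_expo i \<in> N \<union> border n N" if "\<alpha> \<in> \<Delta>" "i < n" for \<alpha> i
    using border_step assms(5) that by blast
qed (use assms standard_set_border in auto)

text \<open>If \<open>\<alpha> + e\<^sub>i + e\<^sub>j\<close> lies outside of \<open>N \<union> \<B>(N)\<close>, then \<open>\<alpha> + e\<^sub>i\<close> and \<open>\<alpha> + e\<^sub>j\<close> lie in \<open>\<B>(N)\<close>, and the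
  matrices commute at \<open>\<alpha>\<close> by the third set of relations; otherwise by the second set, used twice.\<close>

lemma mult_family_of_relations:
  assumes D: "hilb_data n \<Delta> (N \<union> border n N)" and \<Delta>N: "\<Delta> \<subseteq> N"
    and P: "cring P" and Q: "cring Q" and h: "h \<in> ring_hom P Q"
    and T: "\<And>\<alpha> \<beta>. \<alpha> \<in> N \<union> border n N \<Longrightarrow> \<beta> \<in> \<Delta> \<Longrightarrow> T \<alpha> \<beta> \<in> carrier P"
    and delta: "\<And>p. p \<in> rel_delta P \<Delta> T \<Longrightarrow> h p = \<zero>\<^bsub>Q\<^esub>"
    and step: "\<And>p. p \<in> rel_step P n \<Delta> (N \<union> border n N) T \<Longrightarrow> h p = \<zero>\<^bsub>Q\<^esub>"
    and comm: "\<And>p. p \<in> rel_comm P n \<Delta> N T \<Longrightarrow> h p = \<zero>\<^bsub>Q\<^esub>"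
  shows "mult_family n \<Delta> (N \<union> border n N) Q (\<lambda>\<alpha> \<beta>. h (T \<alpha> \<beta>))"
proof -
  let ?M = "N \<union> border n N" and ?T = "\<lambda>\<alpha> \<beta>. h (T \<alpha> \<beta>)"
  interpret hilb_data n \<Delta> ?M by (rule D)
  interpret P: cring P by (rule P)
  interpret Q: cring Q by (rule Q)
  interpret h: ring_hom_cring P Q h by unfold_locales (rule h)
  note eq = hom_minus_eq_zero[OF P Q h]
  have sc: "shift_sum P \<Delta> T \<alpha> i \<beta> \<in> carrier P" if "\<alpha> \<in> ?M" "i < n" "\<beta> \<in> \<Delta>" for \<alpha> i \<beta>
    by (rule shift_sum_closed[OF P]; rule T) (use that \<Delta>_step in auto)
  have sh: "h (shift_sum P \<Delta> T \<alpha> i \<beta>) = shift_sum Q \<Delta> ?T \<alpha> i \<beta>" if "\<alpha> \<in> ?M" "i < n" "\<beta> \<in> \<Delta>" for \<alpha> i \<beta>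
    by (rule shift_sum_hom[OF P Q h]; rule T) (use that \<Delta>_step in auto)
  have st: "?T (\<alpha> + unit_expo i) \<beta> = shift_sum Q \<Delta> ?T \<alpha> i \<beta>"
    if *: "\<alpha> \<in> ?M" "i < n" "\<alpha> + unit_expo i \<in> ?M" "\<beta> \<in> \<Delta>" for \<alpha> i \<beta>
  proof -
    have "T (\<alpha> + unit_expo i) \<beta> \<ominus>\<^bsub>P\<^esub> shift_sum P \<Delta> T \<alpha> i \<beta> \<in> rel_step P n \<Delta> ?M T"
      unfolding rel_step_def using * by blast
    then have "h (T (\<alpha> + unit_expo i) \<beta>) = h (shift_sum P \<Delta> T \<alpha> i \<beta>)"
      using step eq[OF T[OF *(3,4)] sc[OF *(1,2,4)]] by blast
    then show ?thesis using sh[OF *(1,2,4)] by simp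
  qed
  show ?thesis
    unfolding mult_family_def
  proof (intro conjI ballI allI impI)
    fix \<alpha> \<beta> assume *: "\<alpha> \<in> \<Delta>" "\<beta> \<in> \<Delta>"
    have "T \<alpha> \<beta> \<ominus>\<^bsub>P\<^esub> (if \<alpha> = \<beta> then \<one>\<^bsub>P\<^esub> else \<zero>\<^bsub>P\<^esub>) \<in> rel_delta P \<Delta> T"
      unfolding rel_delta_def using * by blast
    then have "h (T \<alpha> \<beta>) = h (if \<alpha> = \<beta> then \<one>\<^bsub>P\<^esub> else \<zero>\<^bsub>P\<^esub>)"
      using delta eq[of "T \<alpha> \<beta>" "if \<alpha> = \<beta> then \<one>\<^bsub>P\<^esub> else \<zero>\<^bsub>P\<^esub>"] T[of \<alpha> \<beta>] * \<Delta>_M by auto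
    then show "h (T \<alpha> \<beta>) = (if \<alpha> = \<beta> then \<one>\<^bsub>Q\<^esub> else \<zero>\<^bsub>Q\<^esub>)" by simp
  next
    fix \<alpha> i \<beta> assume "\<alpha> \<in> ?M" "i < n" "\<alpha> + unit_expo i \<in> ?M" "\<beta> \<in> \<Delta>"
    then show "h (T (\<alpha> + unit_expo i) \<beta>) = shift_sum Q \<Delta> ?T \<alpha> i \<beta>" by (rule st)
  next
    fix \<alpha> i j \<beta> assume *: "\<alpha> \<in> \<Delta>" "i < n" "j < n" "\<beta> \<in> \<Delta>"
    have M: "\<alpha> + unit_expo i \<in> ?M" "\<alpha> + unit_expo j \<in> ?M" using * \<Delta>_step by auto
    have sw: "\<alpha> + unit_expo i + unit_expo j = \<alpha> + unit_expo j + unit_expo i" by (simp add: ac_simps)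
    show "shift_sum Q \<Delta> ?T (\<alpha> + unit_expo i) j \<beta> = shift_sum Q \<Delta> ?T (\<alpha> + unit_expo j) i \<beta>"
    proof (cases "\<alpha> + unit_expo i + unit_expo j \<in> ?M")
      case True
      then show ?thesis using st[OF M(1) *(3) _ *(4)] st[OF M(2) *(2) _ *(4)] sw by simp
    next
      case False
      then have nN: "\<alpha> + unit_expo i \<notin> N" "\<alpha> + unit_expo j \<notin> N"
        using border_step[of _ N] *(2,3) sw by metis+
      have b: "\<alpha> + unit_expo i \<in> border n N" "\<alpha> + unit_expo j \<in> border n N"
          "\<alpha> + unit_expo i + unit_expo j \<in> border n (N \<union> border n N)"
        using M nN border_step[OF M(1) *(3)] False by auto
      have "shift_sum P \<Delta> T (\<alpha> + unit_expo i) j \<beta> \<ominus>\<^bsub>P\<^esub> shift_sum P \<Delta> T (\<alpha> + unit_expo j) i \<beta>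
          \<in> rel_comm P n \<Delta> N T"
        unfolding rel_comm_def using b * sw by blast
      then have "h (shift_sum P \<Delta> T (\<alpha> + unit_expo i) j \<beta>) = h (shift_sum P \<Delta> T (\<alpha> + unit_expo j) i \<beta>)"
        using comm eq[OF sc[OF M(1) *(3,4)] sc[OF M(2) *(2,4)]] by blast
      then show ?thesis using sh[OF M(1) *(3,4)] sh[OF M(2) *(2,4)] by simp
    qed
  qed (use T in auto)
qed

section \<open>Validity of the relations for every family\<close>

context mult_family_ring
begin

text \<open>The sums in the relations are coordinates of x^\<alpha> x_i. They depend on the exponent
  \<alpha> + e_i and not on its decomposition, even when this exponent lies outside of M.\<close>

lemma shift_sum_nf:
  assumes "\<alpha> \<in> M" "i < n" "\<beta> \<in> \<Delta>"
  shows "shift_sum R \<Delta> T \<alpha> i \<beta> = nf (unit_expo i + \<alpha>) \<beta>"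
proof -
  have "\<alpha> \<in> expos n" using assms M_expos by blast
  then have "nf (unit_expo i + \<alpha>) \<beta> = (\<Oplus>\<gamma>\<in>\<Delta>. nf \<alpha> \<gamma> \<otimes> T (\<gamma> + unit_expo i) \<beta>)"
    using assms by (intro nf_apply)
  also have "\<dots> = shift_sum R \<Delta> T \<alpha> i \<beta>"
    unfolding shift_sum_def by (rule finsum_cong') (use assms nf_eq_T \<Delta>_step in auto)
  finally show ?thesis ..
qed

lemma shift_sum_eq:
  assumes "\<alpha> \<in> M" "\<alpha>' \<in> M" "i < n" "j < n" "\<alpha> + unit_expo i = \<alpha>' + unit_expo j" "\<beta> \<in> \<Delta>"
  shows "shift_sum R \<Delta> T \<alpha> i \<beta> = shift_sum R \<Delta> T \<alpha>' j \<beta>"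
proof -
  have "unit_expo i + \<alpha> = unit_expo j + \<alpha>'"
    using assms(5) by (simp add: ab_semigroup_add_class.add.commute)
  then show ?thesis using assms by (simp add: shift_sum_nf)
qed

end

text \<open>The converse of \<open>mult_family_of_relations\<close>, with the edge relations
  included. Both commutation and edge relations compare two ways to reach the same exponent, so they
  are handled by \<open>shift_sum_eq\<close>.\<close>

lemma relations_vanish:
  assumes D: "hilb_data n \<Delta> M" and P: "cring P" and Q: "cring Q" and h: "h \<in> ring_hom P Q"
    and T: "\<And>\<alpha> \<beta>. \<alpha> \<in> M \<Longrightarrow> \<beta> \<in> \<Delta> \<Longrightarrow> T \<alpha> \<beta> \<in> carrier P"
    and fam: "mult_family n \<Delta> M Q (\<lambda>\<alpha> \<beta>. h (T \<alpha> \<beta>))"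
  shows "p \<in> rel_delta P \<Delta> T \<Longrightarrow> h p = \<zero>\<^bsub>Q\<^esub>"
    and "M' \<subseteq> M \<Longrightarrow> p \<in> rel_step P n \<Delta> M' T \<Longrightarrow> h p = \<zero>\<^bsub>Q\<^esub>"
    and "border n N \<subseteq> M \<Longrightarrow> p \<in> rel_comm P n \<Delta> N T \<Longrightarrow> h p = \<zero>\<^bsub>Q\<^esub>"
    and "p \<in> rel_edge P n \<Delta> T \<Longrightarrow> h p = \<zero>\<^bsub>Q\<^esub>"
proof -
  let ?T = "\<lambda>\<alpha> \<beta>. h (T \<alpha> \<beta>)"
  interpret Q: hilb_ring n \<Delta> M Q by (rule hilb_ringI[OF D Q])
  interpret F: mult_family_ring n \<Delta> M Q ?T by unfold_locales (rule fam)
  interpret P: cring P by (rule P)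
  interpret h: ring_hom_cring P Q h by unfold_locales (rule h)
  note eq = hom_minus_eq_zero[OF P Q h, THEN iffD2]
  have sc: "shift_sum P \<Delta> T \<alpha> i \<beta> \<in> carrier P" if "\<alpha> \<in> M" "i < n" "\<beta> \<in> \<Delta>" for \<alpha> i \<beta>
    by (rule shift_sum_closed[OF P]; rule T) (use that Q.\<Delta>_step in auto)
  have sh: "h (shift_sum P \<Delta> T \<alpha> i \<beta>) = shift_sum Q \<Delta> ?T \<alpha> i \<beta>" if "\<alpha> \<in> M" "i < n" "\<beta> \<in> \<Delta>" for \<alpha> i \<beta>
    by (rule shift_sum_hom[OF P Q h]; rule T) (use that Q.\<Delta>_step in auto)
  have swap: "h (shift_sum P \<Delta> T \<alpha> i \<beta> \<ominus>\<^bsub>P\<^esub> shift_sum P \<Delta> T \<alpha>' j \<beta>) = \<zero>\<^bsub>Q\<^esub>"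
    if "\<alpha> \<in> M" "\<alpha>' \<in> M" "i < n" "j < n" "\<alpha> + unit_expo i = \<alpha>' + unit_expo j" "\<beta> \<in> \<Delta>" for \<alpha> \<alpha>' i j \<beta>
    using that F.shift_sum_eq[OF that] by (intro eq) (simp_all add: sc sh)
  {
    assume "p \<in> rel_delta P \<Delta> T"
    then obtain \<alpha> \<beta> where *: "\<alpha> \<in> \<Delta>" "\<beta> \<in> \<Delta>" and p: "p = T \<alpha> \<beta> \<ominus>\<^bsub>P\<^esub> (if \<alpha> = \<beta> then \<one>\<^bsub>P\<^esub> else \<zero>\<^bsub>P\<^esub>)"
      by (auto simp: rel_delta_def)
    show "h p = \<zero>\<^bsub>Q\<^esub>" unfolding p
      by (rule eq) (use * T Q.\<Delta>_M F.T_delta[OF *] in auto)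
  next
    assume M': "M' \<subseteq> M" and "p \<in> rel_step P n \<Delta> M' T"
    then obtain \<alpha> i \<beta> where *: "\<alpha> \<in> M'" "i < n" "\<alpha> + unit_expo i \<in> M'" "\<beta> \<in> \<Delta>"
      and p: "p = T (\<alpha> + unit_expo i) \<beta> \<ominus>\<^bsub>P\<^esub> shift_sum P \<Delta> T \<alpha> i \<beta>"
      by (auto simp: rel_step_def)
    have M: "\<alpha> \<in> M" "\<alpha> + unit_expo i \<in> M" using * M' by auto
    have "?T (\<alpha> + unit_expo i) \<beta> = shift_sum Q \<Delta> ?T \<alpha> i \<beta>"
      using F.T_step[OF M(1) *(2) M(2) *(4)] by (simp add: shift_sum_def)
    then show "h p = \<zero>\<^bsub>Q\<^esub>" unfolding p
      by (intro eq) (use * M T sc sh in auto)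
  next
    assume N: "border n N \<subseteq> M" and "p \<in> rel_comm P n \<Delta> N T"
    then obtain \<alpha> \<alpha>' i j \<beta> where *: "\<alpha> \<in> border n N" "\<alpha>' \<in> border n N" "i < n" "j < n"
      "\<alpha> + unit_expo i = \<alpha>' + unit_expo j" "\<beta> \<in> \<Delta>"
      and p: "p = shift_sum P \<Delta> T \<alpha> i \<beta> \<ominus>\<^bsub>P\<^esub> shift_sum P \<Delta> T \<alpha>' j \<beta>"
      unfolding rel_comm_def by blast
    show "h p = \<zero>\<^bsub>Q\<^esub>" unfolding p by (rule swap) (use * N in auto)
  next
    assume "p \<in> rel_edge P n \<Delta> T"
    then obtain \<epsilon> i j \<beta> where *: "edge_triple n \<Delta> \<epsilon> i j" "\<beta> \<in> \<Delta>"
      and p: "p = shift_sum P \<Delta> T (\<epsilon> + unit_expo j) i \<beta> \<ominus>\<^bsub>P\<^esub> shift_sum P \<Delta> T (\<epsilon> + unit_expo i) j \<beta>"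
      unfolding rel_edge_def by blast
    have e: "\<epsilon> \<in> \<Delta>" "i < n" "j < n" using *(1) by (auto simp: edge_triple_def)
    show "h p = \<zero>\<^bsub>Q\<^esub>" unfolding p
      by (rule swap) (use e * Q.\<Delta>_step in \<open>auto simp: ab_semigroup_add_class.add_ac\<close>)
  }
qed

lemma relations_closed:
  assumes D: "hilb_data n \<Delta> M" and P: "cring P"
    and T: "\<And>\<alpha> \<beta>. \<alpha> \<in> M \<Longrightarrow> \<beta> \<in> \<Delta> \<Longrightarrow> T \<alpha> \<beta> \<in> carrier P"
  shows "rel_delta P \<Delta> T \<subseteq> carrier P"
    and "M' \<subseteq> M \<Longrightarrow> rel_step P n \<Delta> M' T \<subseteq> carrier P"
    and "border n N \<subseteq> M \<Longrightarrow> rel_comm P n \<Delta> N T \<subseteq> carrier P"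
    and "rel_edge P n \<Delta> T \<subseteq> carrier P"
proof -
  interpret hilb_data n \<Delta> M by (rule D)
  interpret P: cring P by (rule P)
  have sc: "shift_sum P \<Delta> T \<alpha> i \<beta> \<in> carrier P" if "\<alpha> \<in> M" "i < n" "\<beta> \<in> \<Delta>" for \<alpha> i \<beta>
    by (rule shift_sum_closed[OF P]; rule T) (use that \<Delta>_step in auto)
  show "rel_delta P \<Delta> T \<subseteq> carrier P" using T \<Delta>_M by (auto simp: rel_delta_def)
  show "M' \<subseteq> M \<Longrightarrow> rel_step P n \<Delta> M' T \<subseteq> carrier P"
    using T sc by (auto simp: rel_step_def subset_iff intro!: P.minus_closed)
  show "border n N \<subseteq> M \<Longrightarrow> rel_comm P n \<Delta> N T \<subseteq> carrier P"
    using sc by (auto simp: rel_comm_def subset_iff intro!: P.minus_closed)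
  show "rel_edge P n \<Delta> T \<subseteq> carrier P"
    using sc \<Delta>_step by (auto simp: rel_edge_def edge_triple_def intro!: P.minus_closed)
qed

section \<open>Algebras given by generators and relations\<close>

locale presentation = mpoly_over k V for k :: "('k, 'm) ring_scheme" and V :: "(expo \<times> expo) set" +
  fixes S :: "((expo \<times> expo \<Rightarrow>\<^sub>0 nat) \<Rightarrow> 'k) set"
  assumes S_closed: "S \<subseteq> carrier P"
begin

definition I where "I = Idl\<^bsub>P\<^esub> S"

abbreviation "coset \<equiv> \<lambda>p. I +>\<^bsub>P\<^esub> p"

abbreviation "A \<equiv> P Quot I"

abbreviation "\<iota> \<equiv> \<lambda>c. coset (mconst k c)"

lemma I_ideal: "ideal I P"
  unfolding I_def by (rule P.genideal_ideal[OF S_closed])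

lemma A_cring: "cring A"
  using ideal.quotient_is_cring[OF I_ideal P.is_cring] .

lemma coset_hom: "coset \<in> ring_hom P A"
  by (rule ideal.rcos_ring_hom[OF I_ideal])

lemma coset_closed: "p \<in> carrier P \<Longrightarrow> coset p \<in> carrier A"
  using ring_hom_closed[OF coset_hom] .

lemma coset_zero: "p \<in> S \<Longrightarrow> coset p = \<zero>\<^bsub>A\<^esub>"
  using P.a_rcos_zero[OF I_ideal] P.genideal_self[OF S_closed] by (auto simp: I_def FactRing_def)

lemma k_algebra_A: "k_algebra k A \<iota>"
  unfolding k_algebra_def using A_cring ring_hom_trans[OF mconst_hom coset_hom] by (simp add: comp_def)

lemma kernel_genideal:
  assumes B: "cring B" and g: "g \<in> ring_hom P B" and G: "\<And>p. p \<in> G \<Longrightarrow> g p = \<zero>\<^bsub>B\<^esub>" "G \<subseteq> carrier P"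
    and p: "p \<in> Idl\<^bsub>P\<^esub> G"
  shows "g p = \<zero>\<^bsub>B\<^esub>"
proof -
  have rh: "ring_hom_ring P B g" by (rule ring_hom_ringI2[OF P.ring_axioms cring.axioms(1)[OF B] g])
  have "Idl\<^bsub>P\<^esub> G \<subseteq> a_kernel P B g"
    by (rule P.genideal_minimal[OF ring_hom_ring.kernel_is_ideal[OF rh]])
      (use G in \<open>auto simp: a_kernel_def'\<close>)
  then show ?thesis using p by (auto simp: a_kernel_def')
qed

lemma alg_hom_exists:
  assumes B: "k_algebra k B \<iota>B" and g: "g \<in> ring_hom P B"
    and const: "\<And>c. c \<in> carrier k \<Longrightarrow> g (mconst k c) = \<iota>B c" and S: "\<And>p. p \<in> S \<Longrightarrow> g p = \<zero>\<^bsub>B\<^esub>"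
  obtains f where "f \<in> alg_homs k A \<iota> B \<iota>B" "\<And>p. p \<in> carrier P \<Longrightarrow> f (coset p) = g p"
proof -
  have Bc: "cring B" using B by (simp add: k_algebra_def)
  have ker: "g p = \<zero>\<^bsub>B\<^esub>" if "p \<in> I" for p
    using kernel_genideal[OF Bc g S S_closed] that by (simp add: I_def)
  obtain f where "f \<in> ring_hom A B \<inter> extensional (carrier A)" "\<And>p. p \<in> carrier P \<Longrightarrow> f (coset p) = g p"
    using P.quotient_lift[OF I_ideal Bc g ker] by blast
  then show thesis using const by (intro that[of f]) (auto simp: alg_homs_def)
qed

lemma alg_hom_unique:
  assumes B: "k_algebra k B \<iota>B" and f: "f \<in> alg_homs k A \<iota> B \<iota>B" and g: "g \<in> alg_homs k A \<iota> B \<iota>B"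
    and eq: "\<And>v. v \<in> V \<Longrightarrow> f (coset (mvar k v)) = g (coset (mvar k v))"
  shows "f = g"
proof (rule extensionalityI[of _ "carrier A"])
  show "f \<in> extensional (carrier A)" "g \<in> extensional (carrier A)" using f g by (auto simp: alg_homs_def)
  have Bc: "cring B" using B by (simp add: k_algebra_def)
  fix C assume "C \<in> carrier A"
  then obtain p where p: "p \<in> carrier P" "C = coset p" unfolding FactRing_simps by auto
  have "(f \<circ> coset) p = (g \<circ> coset) p"
  proof (rule ring_hom_eqI[OF _ _ Bc _ _ p(1)])
    show "f \<circ> coset \<in> ring_hom P B" "g \<circ> coset \<in> ring_hom P B"
      using f g by (auto simp: alg_homs_def intro: ring_hom_trans[OF coset_hom])
    show "(f \<circ> coset) (mconst k c) = (g \<circ> coset) (mconst k c)" if "c \<in> carrier k" for c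
      using f g that by (simp add: alg_homs_def)
  qed (simp add: eq)
  then show "f C = g C" using p(2) by simp
qed

text \<open>The variables may be a part of the entries of T, so \<open>det\<close> asks that their
  values determine the others; this is immediate when every entry is a variable, and an induction
  for corner variables. By \<open>rel\<close>, a family over B passes to the quotient. The family
  over the quotient is an input, \<open>fam\<close>, because its origin varies: relations in most
  cases, representability for edge triples.\<close>

lemma universal_object_presentation:
  fixes H :: "'b ring \<Rightarrow> (expo \<Rightarrow> 'b) set set"
  assumes D: "hilb_data n \<Delta> M"
    and T: "\<And>\<alpha> \<beta>. \<alpha> \<in> M \<Longrightarrow> \<beta> \<in> \<Delta> \<Longrightarrow> T \<alpha> \<beta> \<in> carrier P"
    and var: "\<And>\<alpha> \<beta>. (\<alpha>, \<beta>) \<in> V \<Longrightarrow> \<alpha> \<in> M \<and> \<beta> \<in> \<Delta> \<and> T \<alpha> \<beta> = mvar k (\<alpha>, \<beta>)"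
    and det: "\<And>(B :: 'b ring) g a \<alpha> \<beta>. cring B \<Longrightarrow> g \<in> ring_hom P B \<Longrightarrow> zero_family n \<Delta> M Z B a \<Longrightarrow>
      (\<And>\<alpha> \<beta>. (\<alpha>, \<beta>) \<in> V \<Longrightarrow> g (mvar k (\<alpha>, \<beta>)) = a \<alpha> \<beta>) \<Longrightarrow> \<alpha> \<in> M \<Longrightarrow> \<beta> \<in> \<Delta> \<Longrightarrow> g (T \<alpha> \<beta>) = a \<alpha> \<beta>"
    and rel: "\<And>(B :: 'b ring) g p. cring B \<Longrightarrow> g \<in> ring_hom P B \<Longrightarrow>
      zero_family n \<Delta> M Z B (\<lambda>\<alpha> \<beta>. g (T \<alpha> \<beta>)) \<Longrightarrow> p \<in> S \<Longrightarrow> g p = \<zero>\<^bsub>B\<^esub>"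
    and fam: "zero_family n \<Delta> M Z A (\<lambda>\<alpha> \<beta>. coset (T \<alpha> \<beta>))"
    and J: "J = idealU n \<Delta> M A (\<lambda>\<alpha> \<beta>. coset (T \<alpha> \<beta>))" and HA: "J \<in> HA"
    and H: "\<And>B I. cring B \<Longrightarrow> I \<in> H B \<longleftrightarrow> (\<exists>a. zero_family n \<Delta> M Z B a \<and> I = idealU n \<Delta> M B a)"
  shows "universal_object k n \<Delta> M A \<iota> (\<lambda>\<alpha> \<beta>. coset (T \<alpha> \<beta>)) HA H
    (xring n A Quot J) (\<lambda>p. J +>\<^bsub>xring n A\<^esub> p)"
proof (rule universal_objectI[OF D k_algebra_A fam J HA H])
  fix B :: "'b ring" and \<iota>B a
  assume B: "k_algebra k B \<iota>B" and a: "zero_family n \<Delta> M Z B a"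
  have Bc: "cring B" and hB: "\<iota>B \<in> ring_hom k B" using B by (auto simp: k_algebra_def)
  have mf: "mult_family n \<Delta> M B a" using a by (simp add: zero_family_def)
  have "a \<alpha> \<beta> \<in> carrier B" if "\<alpha> \<in> M" "\<beta> \<in> \<Delta>" for \<alpha> \<beta>
    using mf that unfolding mult_family_def by blast
  \<comment> \<open>The variables are given the values prescribed by a; \<open>det\<close> extends
    the agreement to all entries of T.\<close>
  then have ac: "case_prod a \<in> V \<rightarrow> carrier B" using var by auto
  obtain g where g: "g \<in> ring_hom P B" and gc: "\<And>c. c \<in> carrier k \<Longrightarrow> g (mconst k c) = \<iota>B c"
      and gv: "\<And>v. v \<in> V \<Longrightarrow> g (mvar k v) = case_prod a v"
    by (rule mpoly_eval[OF Bc hB ac]) (rule that)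
  have gT: "g (T \<alpha> \<beta>) = a \<alpha> \<beta>" if "\<alpha> \<in> M" "\<beta> \<in> \<Delta>" for \<alpha> \<beta>
    by (rule det[OF Bc g a _ that]) (simp add: gv)
  have "mult_family n \<Delta> M B (\<lambda>\<alpha> \<beta>. g (T \<alpha> \<beta>))"
    by (rule mult_family_cong[OF D Bc mf gT])
  then have "zero_family n \<Delta> M Z B (\<lambda>\<alpha> \<beta>. g (T \<alpha> \<beta>))"
    using a gT by (simp add: zero_family_def)
  then have "g p = \<zero>\<^bsub>B\<^esub>" if "p \<in> S" for p using rel[OF Bc g] that by blast
  then obtain f where f: "f \<in> alg_homs k A \<iota> B \<iota>B" "\<And>p. p \<in> carrier P \<Longrightarrow> f (coset p) = g p"
    using alg_hom_exists[OF B g gc] by blast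
  have "f (coset (T \<alpha> \<beta>)) = a \<alpha> \<beta>" if "\<alpha> \<in> M" "\<beta> \<in> \<Delta>" for \<alpha> \<beta>
    using f(2)[OF T[OF that]] gT[OF that] by simp
  with f(1) show "\<exists>f\<in>alg_homs k A \<iota> B \<iota>B. \<forall>\<alpha>\<in>M. \<forall>\<beta>\<in>\<Delta>. f (coset (T \<alpha> \<beta>)) = a \<alpha> \<beta>"
    by blast
next
  fix B :: "'b ring" and \<iota>B f g
  assume B: "k_algebra k B \<iota>B" and f: "f \<in> alg_homs k A \<iota> B \<iota>B" and g: "g \<in> alg_homs k A \<iota> B \<iota>B"
    and eq: "\<forall>\<alpha>\<in>M. \<forall>\<beta>\<in>\<Delta>. f (coset (T \<alpha> \<beta>)) = g (coset (T \<alpha> \<beta>))"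
  show "f = g"
  proof (rule alg_hom_unique[OF B f g])
    fix v assume v: "v \<in> V"
    obtain \<alpha> \<beta> where [simp]: "v = (\<alpha>, \<beta>)" by (cases v)
    have *: "\<alpha> \<in> M" "\<beta> \<in> \<Delta>" "T \<alpha> \<beta> = mvar k v" using var[of \<alpha> \<beta>] v by auto
    have "f (coset (T \<alpha> \<beta>)) = g (coset (T \<alpha> \<beta>))" using eq *(1,2) by blast
    then show "f (coset (mvar k v)) = g (coset (mvar k v))" unfolding *(3) .
  qed
qed

end

section \<open>Presentations with a variable for every coefficient\<close>

lemma Tvar_closed: "cring k \<Longrightarrow> \<alpha> \<in> M \<Longrightarrow> \<beta> \<in> \<Delta> \<Longrightarrow> Tvar k \<alpha> \<beta> \<in> carrier (Tring k (M \<times> \<Delta>))"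
  using mpoly_over.mvar_closed[of k "(\<alpha>, \<beta>)" "M \<times> \<Delta>"] by (simp add: Tvar_def mpoly_over.intro)

locale border_data = cring k for k :: "('k, 'm) ring_scheme" +
  fixes n :: nat and \<Delta> N :: "expo set"
  assumes \<Delta>: "standard_set n \<Delta>" "finite \<Delta>" "\<Delta> \<noteq> {}"
    and N: "standard_set n N" "\<Delta> \<subseteq> N"
begin

abbreviation "M \<equiv> N \<union> border n N"

abbreviation "P \<equiv> Tring k (M \<times> \<Delta>)"

abbreviation "border_rels \<equiv>
  rel_delta P \<Delta> (Tvar k) \<union> rel_step P n \<Delta> M (Tvar k) \<union> rel_comm P n \<Delta> N (Tvar k)"

sublocale hilb_data n \<Delta> M
  by (rule hilb_data_border[OF \<Delta> N])

lemma P_cring: "cring P"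
  by (rule mpoly_cring)

lemma Tvar_M: "\<alpha> \<in> M \<Longrightarrow> \<beta> \<in> \<Delta> \<Longrightarrow> Tvar k \<alpha> \<beta> \<in> carrier P"
  by (rule Tvar_closed[OF is_cring])

lemma border_rels_closed: "border_rels \<subseteq> carrier P"
  using relations_closed[OF hilb_data_axioms P_cring Tvar_M] by simp

lemma universal_object_border:
  "let P = Tring k ((N \<union> border n N) \<times> \<Delta>); I = ideal_border k n \<Delta> N; R = P Quot I;
       \<iota> = (\<lambda>c. I +>\<^bsub>P\<^esub> mconst k c); T = (\<lambda>\<alpha> \<beta>. I +>\<^bsub>P\<^esub> Tvar k \<alpha> \<beta>);
       J = idealU n \<Delta> (N \<union> border n N) R T
   in universal_object k n \<Delta> (N \<union> border n N) R \<iota> T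
        (Hilb n \<Delta> R) (Hilb n \<Delta> :: 'b ring \<Rightarrow> (expo \<Rightarrow> 'b) set set)
        (xring n R Quot J) (\<lambda>p. J +>\<^bsub>xring n R\<^esub> p)"
proof -
  interpret pres: presentation k "M \<times> \<Delta>" border_rels
    by (intro presentation.intro mpoly_over.intro is_cring presentation_axioms.intro border_rels_closed)
  have I: "ideal_border k n \<Delta> N = pres.I" unfolding pres.I_def by (simp add: ideal_border_def Let_def)
  have fam: "zero_family n \<Delta> M (\<lambda>_ _. False) pres.A (\<lambda>\<alpha> \<beta>. pres.coset (Tvar k \<alpha> \<beta>))"
    unfolding zero_family_def
    using mult_family_of_relations[OF hilb_data_axioms N(2) P_cring pres.A_cring pres.coset_hom Tvar_M]
      pres.coset_zero by simp
  show ?thesis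
    unfolding Let_def I
  proof (rule pres.universal_object_presentation[where Z = "\<lambda>_ _. False", OF hilb_data_axioms Tvar_M _ _ _ fam refl])
    show "idealU n \<Delta> M pres.A (\<lambda>\<alpha> \<beta>. pres.coset (Tvar k \<alpha> \<beta>)) \<in> Hilb n \<Delta> pres.A"
      unfolding Hilb_iff[OF hilb_data_axioms pres.A_cring] using fam by blast
    show "I \<in> Hilb n \<Delta> B \<longleftrightarrow> (\<exists>a. zero_family n \<Delta> M (\<lambda>_ _. False) B a \<and> I = idealU n \<Delta> M B a)"
      if "cring B" for B :: "'b ring" and I by (rule Hilb_iff[OF hilb_data_axioms that])
    fix B :: "'b ring" and g p
    assume B: "cring B" and g: "g \<in> ring_hom P B"
      and z: "zero_family n \<Delta> M (\<lambda>_ _. False) B (\<lambda>\<alpha> \<beta>. g (Tvar k \<alpha> \<beta>))" and p: "p \<in> border_rels"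
    have mf: "mult_family n \<Delta> M B (\<lambda>\<alpha> \<beta>. g (Tvar k \<alpha> \<beta>))" using z by (simp add: zero_family_def)
    show "g p = \<zero>\<^bsub>B\<^esub>"
      using p relations_vanish(1-3)[where T = "Tvar k" and p = p, OF hilb_data_axioms P_cring B g Tvar_M mf] by blast
  qed (auto simp: Tvar_def)
qed

lemma universal_object_lt:
  assumes order: "monomial_order n lt"
  shows "let P = Tring k ((N \<union> border n N) \<times> \<Delta>); I = ideal_lt k n lt \<Delta> N; R = P Quot I;
       \<iota> = (\<lambda>c. I +>\<^bsub>P\<^esub> mconst k c); T = (\<lambda>\<alpha> \<beta>. I +>\<^bsub>P\<^esub> Tvar k \<alpha> \<beta>);
       J = idealU_lt n lt \<Delta> R T
   in universal_object k n \<Delta> (N \<union> border n N) R \<iota> T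
        (Hilb_lt n lt \<Delta> R) (Hilb_lt n lt \<Delta> :: 'b ring \<Rightarrow> (expo \<Rightarrow> 'b) set set)
        (xring n R Quot J) (\<lambda>p. J +>\<^bsub>xring n R\<^esub> p)"
proof -
  let ?S = "ideal_border k n \<Delta> N \<union> {Tvar k \<alpha> \<beta> | \<alpha> \<beta>. \<alpha> \<in> M \<and> \<beta> \<in> \<Delta> \<and> lt \<alpha> \<beta>}"
  have OD: "order_data n \<Delta> M lt" by (intro order_data.intro hilb_data_axioms order_data_axioms.intro order)
  interpret P: cring P by (rule P_cring)
  have I0: "ideal_border k n \<Delta> N = Idl\<^bsub>P\<^esub> border_rels" by (simp add: ideal_border_def Let_def)
  have "ideal_border k n \<Delta> N \<subseteq> carrier P"
    unfolding I0 using ideal.Icarr[OF P.genideal_ideal[OF border_rels_closed]] by blast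
  then have S: "?S \<subseteq> carrier P" using Tvar_M by auto
  interpret pres: presentation k "M \<times> \<Delta>" ?S
    by (intro presentation.intro mpoly_over.intro is_cring presentation_axioms.intro S)
  have I: "ideal_lt k n lt \<Delta> N = pres.I" by (simp only: ideal_lt_def pres.I_def)
  have sub: "p \<in> ?S" if "p \<in> border_rels" for p
    using P.genideal_self[OF border_rels_closed] that unfolding I0 by blast
  have "mult_family n \<Delta> M pres.A (\<lambda>\<alpha> \<beta>. pres.coset (Tvar k \<alpha> \<beta>))"
    by (rule mult_family_of_relations[OF hilb_data_axioms N(2) P_cring pres.A_cring pres.coset_hom Tvar_M];
        (assumption | rule pres.coset_zero[OF sub]; blast))
  moreover have "pres.coset (Tvar k \<alpha> \<beta>) = \<zero>\<^bsub>pres.A\<^esub>" if "\<alpha> \<in> M" "\<beta> \<in> \<Delta>" "lt \<alpha> \<beta>" for \<alpha> \<beta>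
    by (rule pres.coset_zero) (use that in blast)
  ultimately have fam: "zero_family n \<Delta> M lt pres.A (\<lambda>\<alpha> \<beta>. pres.coset (Tvar k \<alpha> \<beta>))"
    unfolding zero_family_def by blast
  \<comment> \<open>The family over the quotient is compatible with the order, so the corner
    polynomials generate the ideal of all its rewriting polynomials.\<close>
  note J = order_family.idealU_lt_eq[OF order_familyI[OF OD pres.A_cring fam]]
  show ?thesis
    unfolding Let_def I
  proof (rule pres.universal_object_presentation[where Z = lt, OF hilb_data_axioms Tvar_M _ _ _ fam J])
    show "idealU_lt n lt \<Delta> pres.A (\<lambda>\<alpha> \<beta>. pres.coset (Tvar k \<alpha> \<beta>)) \<in> Hilb_lt n lt \<Delta> pres.A"
      unfolding J Hilb_lt_iff[OF OD pres.A_cring] using fam by blast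
    show "I \<in> Hilb_lt n lt \<Delta> B \<longleftrightarrow> (\<exists>a. zero_family n \<Delta> M lt B a \<and> I = idealU n \<Delta> M B a)"
      if "cring B" for B :: "'b ring" and I by (rule Hilb_lt_iff[OF OD that])
    fix B :: "'b ring" and g p
    assume B: "cring B" and g: "g \<in> ring_hom P B"
      and z: "zero_family n \<Delta> M lt B (\<lambda>\<alpha> \<beta>. g (Tvar k \<alpha> \<beta>))" and p: "p \<in> ?S"
    have mf: "mult_family n \<Delta> M B (\<lambda>\<alpha> \<beta>. g (Tvar k \<alpha> \<beta>))" using z by (simp add: zero_family_def)
    have "g q = \<zero>\<^bsub>B\<^esub>" if "q \<in> border_rels" for q
      using that relations_vanish(1-3)[where T = "Tvar k" and p = q, OF hilb_data_axioms P_cring B g Tvar_M mf] by blast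
    \<comment> \<open>The generating set contains the whole ideal of the border relations, so
      vanishing has to pass from these relations to the ideal they generate.\<close>
    then have "g q = \<zero>\<^bsub>B\<^esub>" if "q \<in> ideal_border k n \<Delta> N" for q
      using pres.kernel_genideal[OF B g _ border_rels_closed] that unfolding I0 by blast
    then show "g p = \<zero>\<^bsub>B\<^esub>" using p z unfolding zero_family_def by blast
  qed (auto simp: Tvar_def)
qed

end

text \<open>The edge relations need not suffice to make the multiplication matrices commute. Here the variables
  form a family of structure constants because \<open>R\<close> is assumed to represent the functor, which is
  applied to the identity of \<open>R\<close>.\<close>

lemma universal_object_edge:
  assumes k: "cring k" and \<Delta>: "standard_set n \<Delta>" "finite \<Delta>" "\<Delta> \<noteq> {}"
  shows "let P = Tring k ((\<Delta> \<union> border n \<Delta>) \<times> \<Delta>); I = ideal_edge k n \<Delta>; R = P Quot I;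
       \<iota> = (\<lambda>c. I +>\<^bsub>P\<^esub> mconst k c); T = (\<lambda>\<alpha> \<beta>. I +>\<^bsub>P\<^esub> Tvar k \<alpha> \<beta>);
       J = idealU n \<Delta> (\<Delta> \<union> border n \<Delta>) R T
   in coordinate_ring k n \<Delta> (\<Delta> \<union> border n \<Delta>) R \<iota> T (Hilb n \<Delta>) \<longrightarrow>
      universal_object k n \<Delta> (\<Delta> \<union> border n \<Delta>) R \<iota> T
        (Hilb n \<Delta> R) (Hilb n \<Delta> :: 'b ring \<Rightarrow> (expo \<Rightarrow> 'b) set set)
        (xring n R Quot J) (\<lambda>p. J +>\<^bsub>xring n R\<^esub> p)"
proof -
  let ?M = "\<Delta> \<union> border n \<Delta>"
  let ?P = "Tring k (?M \<times> \<Delta>)"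
  let ?S = "rel_delta ?P \<Delta> (Tvar k) \<union> rel_step ?P n \<Delta> (border n \<Delta>) (Tvar k) \<union> rel_edge ?P n \<Delta> (Tvar k)"
  have D: "hilb_data n \<Delta> ?M" by (rule hilb_data_border[OF \<Delta> \<Delta>(1) subset_refl])
  have Pc: "cring ?P" by (rule cring.mpoly_cring[OF k])
  note Tc = Tvar_closed[OF k, of _ ?M _ \<Delta>]
  have S: "?S \<subseteq> carrier ?P" using relations_closed[OF D Pc Tc] by simp
  interpret pres: presentation k "?M \<times> \<Delta>" ?S
    by (intro presentation.intro mpoly_over.intro k presentation_axioms.intro S)
  have I: "ideal_edge k n \<Delta> = pres.I" unfolding pres.I_def by (simp add: ideal_edge_def Let_def)
  interpret A: hilb_ring n \<Delta> ?M pres.A by (rule hilb_ringI[OF D pres.A_cring])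
  let ?T = "\<lambda>\<alpha> \<beta>. pres.coset (Tvar k \<alpha> \<beta>)"
  have TA: "?T \<alpha> \<beta> \<in> carrier pres.A" if "\<alpha> \<in> ?M" "\<beta> \<in> \<Delta>" for \<alpha> \<beta>
    by (rule pres.coset_closed[OF Tc[OF that]])
  show ?thesis
    unfolding Let_def I
  proof (rule impI)
    assume cr: "coordinate_ring k n \<Delta> ?M pres.A pres.\<iota> ?T (Hilb n \<Delta>)"
    \<comment> \<open>The identity in extensional form. Representability concerns algebras over the
      type of elements of the quotient, hence it applies to the quotient itself.\<close>
    let ?f = "restrict (\<lambda>x. x) (carrier pres.A)"
    have "\<forall>f\<in>alg_homs k pres.A pres.\<iota> pres.A pres.\<iota>.
        \<exists>!I. I \<in> Hilb n \<Delta> pres.A \<and> corresponds n \<Delta> ?M pres.A (\<lambda>\<alpha> \<beta>. f (?T \<alpha> \<beta>)) I"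
      using cr pres.k_algebra_A unfolding coordinate_ring_def by blast
    moreover have "?f \<in> alg_homs k pres.A pres.\<iota> pres.A pres.\<iota>"
      using pres.coset_closed pres.mconst_closed unfolding alg_homs_def
      by (auto intro!: ring_hom_memI simp: A.m_closed A.a_closed)
    ultimately obtain I where "I \<in> Hilb n \<Delta> pres.A" "corresponds n \<Delta> ?M pres.A (\<lambda>\<alpha> \<beta>. ?f (?T \<alpha> \<beta>)) I"
      by blast
    \<comment> \<open>The ideal that corresponds to the identity has the required basis, and by
      uniqueness of coordinates its expansion coefficients satisfy all commutation
      conditions.\<close>
    then have "mult_family n \<Delta> ?M pres.A (\<lambda>\<alpha> \<beta>. ?f (?T \<alpha> \<beta>))"
      using TA hilb_ring_Hilb[OF A.hilb_ring_axioms] by (intro A.mult_familyI[of I]) auto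
    then have "mult_family n \<Delta> ?M pres.A ?T"
      by (rule mult_family_cong[OF D pres.A_cring]) (use TA in simp)
    then have fam: "zero_family n \<Delta> ?M (\<lambda>_ _. False) pres.A ?T" by (simp add: zero_family_def)
    show "universal_object k n \<Delta> ?M pres.A pres.\<iota> ?T (Hilb n \<Delta> pres.A)
      (Hilb n \<Delta> :: 'b ring \<Rightarrow> (expo \<Rightarrow> 'b) set set)
      (xring n pres.A Quot idealU n \<Delta> ?M pres.A ?T) (\<lambda>p. idealU n \<Delta> ?M pres.A ?T +>\<^bsub>xring n pres.A\<^esub> p)"
    proof (rule pres.universal_object_presentation[where Z = "\<lambda>_ _. False", OF D Tc _ _ _ fam refl])
      show "idealU n \<Delta> ?M pres.A ?T \<in> Hilb n \<Delta> pres.A"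
        unfolding Hilb_iff[OF D pres.A_cring] using fam by blast
      show "I \<in> Hilb n \<Delta> B \<longleftrightarrow> (\<exists>a. zero_family n \<Delta> ?M (\<lambda>_ _. False) B a \<and> I = idealU n \<Delta> ?M B a)"
        if "cring B" for B :: "'b ring" and I by (rule Hilb_iff[OF D that])
      fix B :: "'b ring" and g p
      assume B: "cring B" and g: "g \<in> ring_hom ?P B"
        and z: "zero_family n \<Delta> ?M (\<lambda>_ _. False) B (\<lambda>\<alpha> \<beta>. g (Tvar k \<alpha> \<beta>))" and p: "p \<in> ?S"
      have mf: "mult_family n \<Delta> ?M B (\<lambda>\<alpha> \<beta>. g (Tvar k \<alpha> \<beta>))" using z by (simp add: zero_family_def)
      show "g p = \<zero>\<^bsub>B\<^esub>"
        using p relations_vanish(1,2,4)[where T = "Tvar k" and p = p, OF D Pc B g Tc mf] by blast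
    qed (auto simp: Tvar_def)
  qed
qed

section \<open>The presentation by variables at the corners\<close>

context order_data
begin

text \<open>By totality, failure would mean equality or the reverse inequality, and both are
  preserved by addition.\<close>

lemma lt_add_cancel:
  assumes "lt (\<alpha> + \<gamma>) (\<beta> + \<gamma>)" "\<alpha> \<in> expos n" "\<beta> \<in> expos n" "\<gamma> \<in> expos n"
  shows "lt \<alpha> \<beta>"
proof (rule ccontr)
  assume "\<not> lt \<alpha> \<beta>"
  then have "\<alpha> = \<beta> \<or> lt \<beta> \<alpha>" using lt_total assms by blast
  moreover have e: "\<alpha> + \<gamma> \<in> expos n" "\<beta> + \<gamma> \<in> expos n" using assms by (simp_all add: monomials_add)
  ultimately show False
    using lt_irrefl[OF e(1)] lt_trans[OF assms(1) _ e(1) e(2) e(1)] lt_add[of \<beta> \<alpha> \<gamma>] assms by auto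
qed

text \<open>If \<alpha> + e_i were below \<alpha>, adding e_i repeatedly would give an infinite
  descent, against well-foundedness.\<close>

lemma lt_unit:
  assumes "\<alpha> \<in> expos n" "i < n" shows "lt \<alpha> (\<alpha> + unit_expo i)"
proof -
  have u: "unit_expo i \<in> expos n" using assms(2) by (rule unit_expo_expos)
  have "\<not> lt (\<alpha> + unit_expo i) \<alpha>"
    using assms(1)
  proof (induction rule: lt_induct)
    case (less \<alpha>)
    show ?case
    proof
      assume l: "lt (\<alpha> + unit_expo i) \<alpha>"
      have e: "\<alpha> + unit_expo i \<in> expos n" using less u by (simp add: monomials_add)
      have "lt (\<alpha> + unit_expo i + unit_expo i) (\<alpha> + unit_expo i)" by (rule lt_add[OF l e less.hyps u])
      then show False using less.IH[OF e l] by blast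
    qed
  qed
  moreover have "\<alpha> \<noteq> \<alpha> + unit_expo i"
  proof
    assume "\<alpha> = \<alpha> + unit_expo i"
    then have "Poly_Mapping.lookup \<alpha> i = Poly_Mapping.lookup (\<alpha> + unit_expo i) i" by simp
    then show False by (simp add: lookup_add unit_expo_def)
  qed
  ultimately show ?thesis using lt_total[of \<alpha> "\<alpha> + unit_expo i"] assms u by (auto simp: monomials_add)
qed

lemma wf_lt: "wf {(\<alpha>', \<alpha>). \<alpha>' \<in> expos n \<and> \<alpha> \<in> expos n \<and> lt \<alpha>' \<alpha>}"
proof -
  have "wfp (\<lambda>\<alpha>' \<alpha>. lt \<alpha>' \<alpha> \<and> \<alpha>' \<in> expos n \<and> \<alpha> \<in> expos n)"
    using order wfp_on_iff_wfp[THEN iffD1, of "expos n" lt] by (simp add: monomial_order_def)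
  then have "wf {(\<alpha>', \<alpha>). lt \<alpha>' \<alpha> \<and> \<alpha>' \<in> expos n \<and> \<alpha> \<in> expos n}" by (rule wfp_def[THEN iffD1])
  moreover have "{(\<alpha>', \<alpha>). lt \<alpha>' \<alpha> \<and> \<alpha>' \<in> expos n \<and> \<alpha> \<in> expos n}
      = {(\<alpha>', \<alpha>). \<alpha>' \<in> expos n \<and> \<alpha> \<in> expos n \<and> lt \<alpha>' \<alpha>}" by auto
  ultimately show ?thesis by simp
qed

end

locale corner_family = order_data n \<Delta> "\<Delta> \<union> border n \<Delta>" lt + k: cring k
  for n :: nat and \<Delta> :: "expo set" and lt :: "expo \<Rightarrow> expo \<Rightarrow> bool"
    and k :: "('k, 'm) ring_scheme" +
  fixes \<nu> :: "expo \<Rightarrow> nat"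
  assumes dir: "admissible_dir n \<Delta> \<nu>"
begin

abbreviation "M \<equiv> \<Delta> \<union> border n \<Delta>"

abbreviation "V \<equiv> {(\<alpha>, \<beta>). \<alpha> \<in> corners n \<Delta> \<and> \<beta> \<in> \<Delta> \<and> lt \<beta> \<alpha>}"

abbreviation "P \<equiv> Tring k V"

abbreviation "T \<equiv> Tfam_corner k n lt \<Delta> \<nu>"

abbreviation "below i \<alpha> \<beta> \<equiv> {\<gamma>\<in>\<Delta>. lt (\<gamma> + unit_expo i) \<alpha> \<and> (lt \<beta> (\<gamma> + unit_expo i) \<or> \<beta> = \<gamma> + unit_expo i)}"

sublocale P: cring P
  by (rule k.mpoly_cring)

text \<open>Adds to the admissible direction that the predecessor is smaller in the order, as the
  recursion requires.\<close>

lemma dir_step: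
  assumes "\<alpha> \<in> border n \<Delta>" "\<alpha> \<notin> corners n \<Delta>"
  obtains \<alpha>' i where "i < n" "\<nu> \<alpha> = i" "\<alpha>' \<in> border n \<Delta>" "\<alpha> = \<alpha>' + unit_expo i" "lt \<alpha>' \<alpha>"
proof -
  obtain \<alpha>' where *: "\<nu> \<alpha> < n" "\<alpha>' \<in> border n \<Delta>" "\<alpha>' + unit_expo (\<nu> \<alpha>) = \<alpha>"
    using dir assms unfolding admissible_dir_def by blast
  have "\<alpha>' \<in> expos n" using *(2) M_expos by blast
  then have "lt \<alpha>' \<alpha>" using lt_unit[of \<alpha>' "\<nu> \<alpha>"] * by metis
  then show thesis by (rule that[OF *(1) refl *(2) *(3)[symmetric]])
qed

lemma Tfam_\<Delta>: "\<alpha> \<in> \<Delta> \<Longrightarrow> T \<alpha> \<beta> = (if \<alpha> = \<beta> then \<one>\<^bsub>P\<^esub> else \<zero>\<^bsub>P\<^esub>)"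
  unfolding Tfam_corner_def Let_def Tring_corner_def by (subst wfrec[OF wf_lt]) simp

lemma Tfam_lt: "\<alpha> \<notin> \<Delta> \<Longrightarrow> lt \<alpha> \<beta> \<Longrightarrow> T \<alpha> \<beta> = \<zero>\<^bsub>P\<^esub>"
  unfolding Tfam_corner_def Let_def Tring_corner_def by (subst wfrec[OF wf_lt]) simp

lemma Tfam_corner: "\<alpha> \<in> corners n \<Delta> \<Longrightarrow> \<not> lt \<alpha> \<beta> \<Longrightarrow> T \<alpha> \<beta> = Tvar k \<alpha> \<beta>"
  unfolding Tfam_corner_def Let_def Tring_corner_def by (subst wfrec[OF wf_lt]) (auto simp: corners_def)

text \<open>Unfolding \<open>wfrec\<close> leaves its recursive calls cut off below \<alpha>. The
  cut has no effect at \<alpha>' and at the exponents \<gamma> + e_i in question, which are smaller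
  than \<alpha>. For the second factor it stays hidden in \<open>T'\<close>: congruence of
  \<open>finsum\<close> needs values in the carrier, which \<open>Tfam_closed\<close> derives from
  this form.\<close>

lemma Tfam_border_cut:
  fixes i :: nat
  assumes \<alpha>: "\<alpha> \<in> border n \<Delta>" "\<alpha> \<notin> corners n \<Delta>" and l: "\<not> lt \<alpha> \<beta>"
    and s: "i < n" "\<nu> \<alpha> = i" "\<alpha>' \<in> border n \<Delta>" "\<alpha> = \<alpha>' + unit_expo i" "lt \<alpha>' \<alpha>"
  obtains T' where "T \<alpha> \<beta> = (\<Oplus>\<^bsub>P\<^esub>\<gamma>\<in>below i \<alpha> \<beta>. T \<alpha>' \<gamma> \<otimes>\<^bsub>P\<^esub> T' (\<gamma> + unit_expo i) \<beta>)"
    "\<And>\<gamma>. \<gamma> \<in> below i \<alpha> \<beta> \<Longrightarrow> T' (\<gamma> + unit_expo i) = T (\<gamma> + unit_expo i)"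
proof -
  let ?r = "{(\<alpha>', \<alpha>). \<alpha>' \<in> expos n \<and> \<alpha> \<in> expos n \<and> lt \<alpha>' \<alpha>}"
  have \<alpha>e: "\<alpha> \<in> expos n" "\<alpha>' \<in> expos n" and n\<Delta>: "\<alpha> \<notin> \<Delta>"
    using \<alpha>(1) s(3) M_expos by (auto simp: border_def)
  have sub: "\<alpha> - unit_expo i = \<alpha>'" unfolding s(4) by simp
  have cut1: "cut T ?r \<alpha> \<alpha>' = T \<alpha>'" using \<alpha>e s(5) by (simp add: cut_apply)
  have cut2: "cut T ?r \<alpha> (\<gamma> + unit_expo i) = T (\<gamma> + unit_expo i)" if "\<gamma> \<in> below i \<alpha> \<beta>" for \<gamma>
  proof -
    have "\<gamma> + unit_expo i \<in> expos n" using that \<Delta>_step[OF _ s(1)] M_expos by blast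
    then show ?thesis using that \<alpha>e by (simp add: cut_apply)
  qed
  have "T \<alpha> \<beta> = (\<Oplus>\<^bsub>P\<^esub>\<gamma>\<in>below i \<alpha> \<beta>. cut T ?r \<alpha> (\<alpha> - unit_expo i) \<gamma> \<otimes>\<^bsub>P\<^esub> cut T ?r \<alpha> (\<gamma> + unit_expo i) \<beta>)"
    unfolding Tfam_corner_def Let_def Tring_corner_def by (subst wfrec[OF wf_lt]) (simp add: n\<Delta> l \<alpha>(2) s(2))
  then show thesis unfolding sub cut1 using cut2 by (rule that)
qed

lemma Tvar_closed: "(\<alpha>, \<beta>) \<in> V \<Longrightarrow> Tvar k \<alpha> \<beta> \<in> carrier P"
  using mpoly_over.mvar_closed[of k "(\<alpha>, \<beta>)" V] k.is_cring
  by (simp add: Tvar_def mpoly_over.intro)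

lemma not_lt_corner: "\<alpha> \<in> corners n \<Delta> \<Longrightarrow> \<beta> \<in> \<Delta> \<Longrightarrow> \<not> lt \<alpha> \<beta> \<Longrightarrow> (\<alpha>, \<beta>) \<in> V"
  using lt_total[of \<alpha> \<beta>] \<Delta>_expos by (auto simp: corners_def)

lemma Tfam_closed:
  assumes "\<alpha> \<in> M" "\<beta> \<in> \<Delta>" shows "T \<alpha> \<beta> \<in> carrier P"
proof -
  have "\<alpha> \<in> expos n" using assms M_expos by blast
  then show ?thesis using assms
  proof (induction arbitrary: \<beta> rule: lt_induct)
    case (less \<alpha>)
    consider "\<alpha> \<in> \<Delta>" | "\<alpha> \<notin> \<Delta>" "lt \<alpha> \<beta>" | "\<alpha> \<in> corners n \<Delta>" "\<not> lt \<alpha> \<beta>"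
      | "\<alpha> \<in> border n \<Delta>" "\<alpha> \<notin> corners n \<Delta>" "\<not> lt \<alpha> \<beta>"
      using less.prems by blast
    then show ?case
    proof cases
      case 1 then show ?thesis by (simp add: Tfam_\<Delta>)
    next
      case 2 then show ?thesis by (simp add: Tfam_lt)
    next
      case 3 then show ?thesis using not_lt_corner less.prems by (simp add: Tfam_corner Tvar_closed)
    next
      case 4
      obtain \<alpha>' i where s: "i < n" "\<nu> \<alpha> = i" "\<alpha>' \<in> border n \<Delta>" "\<alpha> = \<alpha>' + unit_expo i" "lt \<alpha>' \<alpha>"
        by (rule dir_step[OF 4(1,2)])
      obtain T' where T': "T \<alpha> \<beta> = (\<Oplus>\<^bsub>P\<^esub>\<gamma>\<in>below i \<alpha> \<beta>. T \<alpha>' \<gamma> \<otimes>\<^bsub>P\<^esub> T' (\<gamma> + unit_expo i) \<beta>)"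
          "\<And>\<gamma>. \<gamma> \<in> below i \<alpha> \<beta> \<Longrightarrow> T' (\<gamma> + unit_expo i) = T (\<gamma> + unit_expo i)"
        by (rule Tfam_border_cut[OF 4 s]) (rule that)
      show ?thesis
        unfolding T'(1)
      proof (intro P.finsum_closed Pi_I P.m_closed)
        fix \<gamma> assume \<gamma>: "\<gamma> \<in> below i \<alpha> \<beta>"
        have \<alpha>'e: "\<alpha>' \<in> expos n" using s(3) M_expos by blast
        show "T \<alpha>' \<gamma> \<in> carrier P" using less.IH[OF \<alpha>'e s(5)] s(3) \<gamma> by blast
        have M: "\<gamma> + unit_expo i \<in> M" using \<gamma> \<Delta>_step[OF _ s(1)] by blast
        then have "\<gamma> + unit_expo i \<in> expos n" using M_expos by blast
        then show "T' (\<gamma> + unit_expo i) \<beta> \<in> carrier P"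
          unfolding T'(2)[OF \<gamma>] using less.IH M \<gamma> less.prems(2) by blast
      qed
    qed
  qed
qed

lemma Tfam_border:
  fixes i :: nat
  assumes \<alpha>: "\<alpha> \<in> border n \<Delta>" "\<alpha> \<notin> corners n \<Delta>" and l: "\<not> lt \<alpha> \<beta>"
    and s: "i < n" "\<nu> \<alpha> = i" "\<alpha>' \<in> border n \<Delta>" "\<alpha> = \<alpha>' + unit_expo i" "lt \<alpha>' \<alpha>"
    and \<beta>: "\<beta> \<in> \<Delta>"
  shows "T \<alpha> \<beta> = (\<Oplus>\<^bsub>P\<^esub>\<gamma>\<in>below i \<alpha> \<beta>. T \<alpha>' \<gamma> \<otimes>\<^bsub>P\<^esub> T (\<gamma> + unit_expo i) \<beta>)"
proof -
  obtain T' where T': "T \<alpha> \<beta> = (\<Oplus>\<^bsub>P\<^esub>\<gamma>\<in>below i \<alpha> \<beta>. T \<alpha>' \<gamma> \<otimes>\<^bsub>P\<^esub> T' (\<gamma> + unit_expo i) \<beta>)"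
      "\<And>\<gamma>. \<gamma> \<in> below i \<alpha> \<beta> \<Longrightarrow> T' (\<gamma> + unit_expo i) = T (\<gamma> + unit_expo i)"
    by (rule Tfam_border_cut[OF \<alpha> l s]) (rule that)
  show ?thesis unfolding T'(1)
  proof (rule P.finsum_cong'[OF refl])
    show "(\<lambda>\<gamma>. T \<alpha>' \<gamma> \<otimes>\<^bsub>P\<^esub> T (\<gamma> + unit_expo i) \<beta>) \<in> below i \<alpha> \<beta> \<rightarrow> carrier P"
    proof (intro Pi_I P.m_closed)
      fix \<gamma> assume "\<gamma> \<in> below i \<alpha> \<beta>"
      then have \<gamma>: "\<gamma> \<in> \<Delta>" by blast
      show "T \<alpha>' \<gamma> \<in> carrier P" by (rule Tfam_closed) (use s(3) \<gamma> in auto)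
      show "T (\<gamma> + unit_expo i) \<beta> \<in> carrier P" by (rule Tfam_closed[OF \<Delta>_step[OF \<gamma> s(1)] \<beta>])
    qed
    fix \<gamma> assume "\<gamma> \<in> below i \<alpha> \<beta>"
    then show "T \<alpha>' \<gamma> \<otimes>\<^bsub>P\<^esub> T' (\<gamma> + unit_expo i) \<beta> = T \<alpha>' \<gamma> \<otimes>\<^bsub>P\<^esub> T (\<gamma> + unit_expo i) \<beta>"
      by (simp only: T'(2))
  qed
qed

text \<open>Induction along the order. The family a obeys the same recursion by
  \<open>T_step\<close>, with the sum over all of \<Delta>; the summands outside of the range
  \<alpha> \<succ> \<gamma> + e_i \<succeq> \<beta> vanish because a is compatible with the
  order.\<close>

lemma hom_Tfam:
  assumes B: "cring B" and g: "g \<in> ring_hom P B" and a: "zero_family n \<Delta> M lt B a"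
    and ga: "\<And>\<alpha> \<beta>. (\<alpha>, \<beta>) \<in> V \<Longrightarrow> g (Tvar k \<alpha> \<beta>) = a \<alpha> \<beta>"
    and "\<alpha> \<in> M" "\<beta> \<in> \<Delta>"
  shows "g (T \<alpha> \<beta>) = a \<alpha> \<beta>"
proof -
  interpret B: cring B by (rule B)
  interpret g: ring_hom_cring P B g by unfold_locales (rule g)
  have mf: "mult_family n \<Delta> M B a" using a by (simp add: zero_family_def)
  interpret F: mult_family_ring n \<Delta> M B a
    by (intro mult_family_ring.intro hilb_ringI hilb_data_axioms B mult_family_ring_axioms.intro mf)
  have z: "a \<alpha> \<beta> = \<zero>\<^bsub>B\<^esub>" if "\<alpha> \<in> M" "\<beta> \<in> \<Delta>" "lt \<alpha> \<beta>" for \<alpha> \<beta>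
    using a that unfolding zero_family_def by blast
  have "\<alpha> \<in> expos n" using assms(5) M_expos by blast
  then show ?thesis using assms(5,6)
  proof (induction arbitrary: \<beta> rule: lt_induct)
    case (less \<alpha>)
    consider "\<alpha> \<in> \<Delta>" | "\<alpha> \<notin> \<Delta>" "lt \<alpha> \<beta>" | "\<alpha> \<in> corners n \<Delta>" "\<not> lt \<alpha> \<beta>"
      | "\<alpha> \<in> border n \<Delta>" "\<alpha> \<notin> corners n \<Delta>" "\<not> lt \<alpha> \<beta>"
      using less.prems by blast
    then show ?case
    proof cases
      case 1 then show ?thesis using F.T_delta[OF 1 less.prems(2)] by (simp add: Tfam_\<Delta>)
    next
      case 2 then show ?thesis using z[OF less.prems] by (simp add: Tfam_lt)
    next
      case 3 then show ?thesis using not_lt_corner[OF 3(1) less.prems(2) 3(2)] ga by (simp add: Tfam_corner)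
    next
      case 4
      obtain \<alpha>' i where s: "i < n" "\<nu> \<alpha> = i" "\<alpha>' \<in> border n \<Delta>" "\<alpha> = \<alpha>' + unit_expo i" "lt \<alpha>' \<alpha>"
        by (rule dir_step[OF 4(1,2)])
      let ?e = "unit_expo i"
      have u: "?e \<in> expos n" using s(1) by (rule unit_expo_expos)
      have \<alpha>': "\<alpha>' \<in> expos n" "\<alpha>' \<in> M" "\<alpha>' \<notin> \<Delta>" using s(3) M_expos by (auto simp: border_def)
      have st: "\<gamma> + ?e \<in> M" "\<gamma> + ?e \<in> expos n" "\<gamma> \<in> expos n" if "\<gamma> \<in> \<Delta>" for \<gamma>
        using \<Delta>_step[OF that s(1)] M_expos \<Delta>_expos that by auto
      have Tc: "T \<alpha>' \<gamma> \<in> carrier P" "T (\<gamma> + ?e) \<beta> \<in> carrier P" if "\<gamma> \<in> \<Delta>" for \<gamma>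
        using Tfam_closed \<alpha>'(2) st(1)[OF that] less.prems(2) that by auto
      have ac: "a \<alpha>' \<gamma> \<in> carrier B" "a (\<gamma> + ?e) \<beta> \<in> carrier B" if "\<gamma> \<in> \<Delta>" for \<gamma>
        using \<alpha>'(2) st(1)[OF that] less.prems(2) that by auto
      have "g (T \<alpha> \<beta>) = (\<Oplus>\<^bsub>B\<^esub>\<gamma>\<in>below i \<alpha> \<beta>. g (T \<alpha>' \<gamma> \<otimes>\<^bsub>P\<^esub> T (\<gamma> + ?e) \<beta>))"
        unfolding Tfam_border[OF 4 s less.prems(2)] using Tc by (subst g.hom_finsum) (auto simp: comp_def)
      also have "\<dots> = (\<Oplus>\<^bsub>B\<^esub>\<gamma>\<in>below i \<alpha> \<beta>. a \<alpha>' \<gamma> \<otimes>\<^bsub>B\<^esub> a (\<gamma> + ?e) \<beta>)"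
      proof (rule B.finsum_cong')
        fix \<gamma> assume \<gamma>: "\<gamma> \<in> below i \<alpha> \<beta>"
        then have "\<gamma> \<in> \<Delta>" "lt (\<gamma> + ?e) \<alpha>" by auto
        then show "g (T \<alpha>' \<gamma> \<otimes>\<^bsub>P\<^esub> T (\<gamma> + ?e) \<beta>) = a \<alpha>' \<gamma> \<otimes>\<^bsub>B\<^esub> a (\<gamma> + ?e) \<beta>"
          using less.IH[OF \<alpha>'(1) s(5) \<alpha>'(2)] less.IH[OF st(2) _ st(1) less.prems(2)] Tc by simp
      qed (use ac in auto)
      also have "\<dots> = (\<Oplus>\<^bsub>B\<^esub>\<gamma>\<in>\<Delta>. a \<alpha>' \<gamma> \<otimes>\<^bsub>B\<^esub> a (\<gamma> + ?e) \<beta>)"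
      proof (rule B.add.finprod_mono_neutral_cong_left)
        fix \<gamma> assume \<gamma>: "\<gamma> \<in> \<Delta> - below i \<alpha> \<beta>"
        then have \<gamma>\<Delta>: "\<gamma> \<in> \<Delta>" by blast
        show "a \<alpha>' \<gamma> \<otimes>\<^bsub>B\<^esub> a (\<gamma> + ?e) \<beta> = \<zero>\<^bsub>B\<^esub>"
        proof (cases "lt (\<gamma> + ?e) \<alpha>")
          case True
          have "\<beta> \<in> expos n" using less.prems(2) \<Delta>_expos by blast
          \<comment> \<open>Here \<gamma> is excluded because \<gamma> + e_i is below \<beta>, so
            the second factor vanishes.\<close>
          then have "lt (\<gamma> + ?e) \<beta>" using \<gamma> True lt_total[of "\<gamma> + ?e" \<beta>] st[OF \<gamma>\<Delta>] by blast
          then show ?thesis using z[OF st(1)[OF \<gamma>\<Delta>] less.prems(2)] ac[OF \<gamma>\<Delta>] by simp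
        next
          case False
          \<comment> \<open>Equality would make \<gamma> equal to \<alpha>', which lies in the
            border and so outside of \<Delta>. Hence \<gamma> + e_i is above \<alpha>; cancelling
            e_i puts \<gamma> above \<alpha>', and the first factor vanishes.\<close>
          have "\<gamma> + ?e \<noteq> \<alpha>" using s(4) \<alpha>'(3) \<gamma>\<Delta> by auto
          then have "lt (\<alpha>' + ?e) (\<gamma> + ?e)"
            using False lt_total[OF st(2)[OF \<gamma>\<Delta>] less.hyps] s(4) by auto
          then have "lt \<alpha>' \<gamma>" by (rule lt_add_cancel[OF _ \<alpha>'(1) st(3)[OF \<gamma>\<Delta>] u])
          then show ?thesis using z[OF \<alpha>'(2) \<gamma>\<Delta>] ac[OF \<gamma>\<Delta>] by simp
        qed
      qed (use finite_\<Delta> ac in auto)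
      also have "\<dots> = a \<alpha> \<beta>"
        using F.T_step[OF \<alpha>'(2) s(1) _ less.prems(2)] less.prems(1) s(4) by simp
      finally show ?thesis .
    qed
  qed
qed

lemma universal_object_corner:
  "let P = Tring_corner k n lt \<Delta>; I = ideal_corner k n lt \<Delta> \<nu>; R = P Quot I;
       \<iota> = (\<lambda>c. I +>\<^bsub>P\<^esub> mconst k c); T = (\<lambda>\<alpha> \<beta>. I +>\<^bsub>P\<^esub> Tfam_corner k n lt \<Delta> \<nu> \<alpha> \<beta>);
       J = idealU_lt n lt \<Delta> R T
   in universal_object k n \<Delta> (\<Delta> \<union> border n \<Delta>) R \<iota> T
        (Hilb_lt n lt \<Delta> R) (Hilb_lt n lt \<Delta> :: 'b ring \<Rightarrow> (expo \<Rightarrow> 'b) set set)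
        (xring n R Quot J) (\<lambda>p. J +>\<^bsub>xring n R\<^esub> p)"
proof -
  let ?S = "rel_delta P \<Delta> T \<union> rel_step P n \<Delta> M T \<union> rel_comm P n \<Delta> \<Delta> T"
  have S: "?S \<subseteq> carrier P" using relations_closed[OF hilb_data_axioms P.is_cring Tfam_closed] by simp
  interpret pres: presentation k V ?S
    by (intro presentation.intro mpoly_over.intro k.is_cring presentation_axioms.intro S)
  have I: "ideal_corner k n lt \<Delta> \<nu> = pres.I"
    unfolding pres.I_def ideal_corner_def Let_def Tring_corner_def ..
  let ?T = "\<lambda>\<alpha> \<beta>. pres.coset (T \<alpha> \<beta>)"
  have coset0: "pres.coset \<zero>\<^bsub>P\<^esub> = \<zero>\<^bsub>pres.A\<^esub>"
    by (rule ring_hom_zero[OF pres.coset_hom P.ring_axioms cring.axioms(1)[OF pres.A_cring]])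
  have "mult_family n \<Delta> M pres.A ?T"
    by (rule mult_family_of_relations[OF hilb_data_axioms subset_refl P.is_cring pres.A_cring pres.coset_hom
          Tfam_closed]; (assumption | rule pres.coset_zero; blast))
  moreover have "?T \<alpha> \<beta> = \<zero>\<^bsub>pres.A\<^esub>" if "\<alpha> \<in> M" "\<beta> \<in> \<Delta>" "lt \<alpha> \<beta>" for \<alpha> \<beta>
  proof -
    \<comment> \<open>These zeros are built into the recursive family rather than imposed by
      relations: for \<alpha> in \<Delta> they are off-diagonal entries of the identity, otherwise a
      case of the definition.\<close>
    have "T \<alpha> \<beta> = \<zero>\<^bsub>P\<^esub>"
      using that Tfam_lt Tfam_\<Delta> lt_irrefl M_expos by (cases "\<alpha> \<in> \<Delta>") auto
    then show ?thesis using coset0 by simp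
  qed
  ultimately have fam: "zero_family n \<Delta> M lt pres.A ?T"
    unfolding zero_family_def by blast
  note J = order_family.idealU_lt_eq[OF order_familyI[OF order_data_axioms pres.A_cring fam]]
  show ?thesis
    unfolding Let_def I Tring_corner_def
  proof (rule pres.universal_object_presentation[where T = T, OF hilb_data_axioms Tfam_closed _ _ _ fam J])
    show "\<alpha> \<in> M \<and> \<beta> \<in> \<Delta> \<and> T \<alpha> \<beta> = mvar k (\<alpha>, \<beta>)" if "(\<alpha>, \<beta>) \<in> V" for \<alpha> \<beta>
    proof -
      have v: "\<alpha> \<in> corners n \<Delta>" "\<beta> \<in> \<Delta>" "lt \<beta> \<alpha>" using that by auto
      have e: "\<alpha> \<in> expos n" "\<beta> \<in> expos n" using v \<Delta>_expos by (auto simp: corners_def)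
      have "\<not> lt \<alpha> \<beta>" using lt_trans[OF v(3) _ e(2) e(1) e(2)] lt_irrefl[OF e(2)] by blast
      then show ?thesis using Tfam_corner[OF v(1)] corners_M[OF v(1)] v(2) by (simp add: Tvar_def)
    qed
    show "idealU_lt n lt \<Delta> pres.A ?T \<in> Hilb_lt n lt \<Delta> pres.A"
      unfolding J Hilb_lt_iff[OF order_data_axioms pres.A_cring] using fam by blast
    show "I \<in> Hilb_lt n lt \<Delta> B \<longleftrightarrow> (\<exists>a. zero_family n \<Delta> M lt B a \<and> I = idealU n \<Delta> M B a)"
      if "cring B" for B :: "'b ring" and I by (rule Hilb_lt_iff[OF order_data_axioms that])
    fix B :: "'b ring" and g
    assume B: "cring B" and g: "g \<in> ring_hom P B"
    show "g p = \<zero>\<^bsub>B\<^esub>" if z: "zero_family n \<Delta> M lt B (\<lambda>\<alpha> \<beta>. g (T \<alpha> \<beta>))" and p: "p \<in> ?S" for p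
    proof -
      have mf: "mult_family n \<Delta> M B (\<lambda>\<alpha> \<beta>. g (T \<alpha> \<beta>))" using z by (simp add: zero_family_def)
      show ?thesis
        using p relations_vanish(1-3)[where T = T and p = p, OF hilb_data_axioms P.is_cring B g Tfam_closed mf]
        by blast
    qed
    fix a \<alpha> \<beta>
    assume "zero_family n \<Delta> M lt B a" "\<And>\<alpha> \<beta>. (\<alpha>, \<beta>) \<in> V \<Longrightarrow> g (mvar k (\<alpha>, \<beta>)) = a \<alpha> \<beta>"
      and "\<alpha> \<in> M" "\<beta> \<in> \<Delta>"
    then show "g (T \<alpha> \<beta>) = a \<alpha> \<beta>" by (intro hom_Tfam[OF B g]) (simp_all add: Tvar_def)
  qed
qed

end

theorem proposition4:
  fixes k :: "('k, 'm) ring_scheme" and n d :: nat and lt :: "expo \<Rightarrow> expo \<Rightarrow> bool"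
    and \<Delta> N :: "expo set"
  assumes "cring k" and "monomial_order n lt"
    and "standard_set n \<Delta>" and "finite \<Delta>" and "card \<Delta> = d" and "d \<ge> 1"
    and "standard_set n N" and "\<Delta> \<subseteq> N"
  shows
    "(let P = Tring k ((N \<union> border n N) \<times> \<Delta>); I = ideal_border k n \<Delta> N; R = P Quot I;
          \<iota> = (\<lambda>c. I +>\<^bsub>P\<^esub> mconst k c); T = (\<lambda>\<alpha> \<beta>. I +>\<^bsub>P\<^esub> Tvar k \<alpha> \<beta>);
          J = idealU n \<Delta> (N \<union> border n N) R T
      in universal_object k n \<Delta> (N \<union> border n N) R \<iota> T
           (Hilb n \<Delta> R) (Hilb n \<Delta> :: 'b ring \<Rightarrow> (expo \<Rightarrow> 'b) set set)
           (xring n R Quot J) (\<lambda>p. J +>\<^bsub>xring n R\<^esub> p)) \<and>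
     (let P = Tring k ((\<Delta> \<union> border n \<Delta>) \<times> \<Delta>); I = ideal_edge k n \<Delta>; R = P Quot I;
          \<iota> = (\<lambda>c. I +>\<^bsub>P\<^esub> mconst k c); T = (\<lambda>\<alpha> \<beta>. I +>\<^bsub>P\<^esub> Tvar k \<alpha> \<beta>);
          J = idealU n \<Delta> (\<Delta> \<union> border n \<Delta>) R T
      in coordinate_ring k n \<Delta> (\<Delta> \<union> border n \<Delta>) R \<iota> T (Hilb n \<Delta>) \<longrightarrow>
         universal_object k n \<Delta> (\<Delta> \<union> border n \<Delta>) R \<iota> T
           (Hilb n \<Delta> R) (Hilb n \<Delta> :: 'b ring \<Rightarrow> (expo \<Rightarrow> 'b) set set)
           (xring n R Quot J) (\<lambda>p. J +>\<^bsub>xring n R\<^esub> p)) \<and>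
     (let P = Tring k ((N \<union> border n N) \<times> \<Delta>); I = ideal_lt k n lt \<Delta> N; R = P Quot I;
          \<iota> = (\<lambda>c. I +>\<^bsub>P\<^esub> mconst k c); T = (\<lambda>\<alpha> \<beta>. I +>\<^bsub>P\<^esub> Tvar k \<alpha> \<beta>);
          J = idealU_lt n lt \<Delta> R T
      in universal_object k n \<Delta> (N \<union> border n N) R \<iota> T
           (Hilb_lt n lt \<Delta> R) (Hilb_lt n lt \<Delta> :: 'b ring \<Rightarrow> (expo \<Rightarrow> 'b) set set)
           (xring n R Quot J) (\<lambda>p. J +>\<^bsub>xring n R\<^esub> p)) \<and>
     (\<forall>\<nu>. admissible_dir n \<Delta> \<nu> \<longrightarrow>
        (let P = Tring_corner k n lt \<Delta>; I = ideal_corner k n lt \<Delta> \<nu>; R = P Quot I;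
             \<iota> = (\<lambda>c. I +>\<^bsub>P\<^esub> mconst k c); T = (\<lambda>\<alpha> \<beta>. I +>\<^bsub>P\<^esub> Tfam_corner k n lt \<Delta> \<nu> \<alpha> \<beta>);
             J = idealU_lt n lt \<Delta> R T
         in universal_object k n \<Delta> (\<Delta> \<union> border n \<Delta>) R \<iota> T
              (Hilb_lt n lt \<Delta> R) (Hilb_lt n lt \<Delta> :: 'b ring \<Rightarrow> (expo \<Rightarrow> 'b) set set)
              (xring n R Quot J) (\<lambda>p. J +>\<^bsub>xring n R\<^esub> p)))"
    (is "?border \<and> ?edge \<and> ?lt \<and> (\<forall>\<nu>. admissible_dir n \<Delta> \<nu> \<longrightarrow> ?corner \<nu>)")
proof (intro conjI allI impI)
  have ne: "\<Delta> \<noteq> {}" using assms(5,6) by auto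
  interpret border_data k n \<Delta> N
    by (intro border_data.intro border_data_axioms.intro assms ne)
  show ?border by (rule universal_object_border)
  show ?edge by (rule universal_object_edge[OF assms(1,3,4) ne])
  show ?lt by (rule universal_object_lt[OF assms(2)])
  show "?corner \<nu>" if "admissible_dir n \<Delta> \<nu>" for \<nu>
    by (intro corner_family.universal_object_corner corner_family.intro order_data.intro hilb_data_border
        assms(1-4) ne subset_refl order_data_axioms.intro corner_family_axioms.intro that)
qed

end
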